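(* For every prime $p$, there exist a power $q$ of $p$ and a finite simple group of automorphisms $H\le \mathrm{Aut}(K_q)$ of the group $K_q=SL(\infty,\mathbb{F}_q)$ such that the centraliser of $H$ in $K_q$ is trivial, i.e. $\{g\in K_q : h(g)=g \text{ for all } h\in H\}=\{1\}$.
   Context: $\mathbb{F}_q$ is the finite field with $q$ elements. $SL(\infty,\mathbb{F}_q)$ denotes the union (colimit) of the groups $SL(n,\mathbb{F}_q)$ under the natural inclusions $SL(n,\mathbb{F}_q)\to SL(n+1,\mathbb{F}_q)$ fixing the new basis vector. For a group $H$ of automorphisms of a group $K$, the centraliser of $H$ in $K$ is the subgroup of elements of $K$ fixed by every element of $H$. *)

theory Defs
  imports "HOL-Algebra.Bij" "HOL-Algebra.SimpleGroups" "HOL-Algebra.Ring"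
    "HOL-Combinatorics.Permutations"
begin

text \<open>The determinant of the upper left \<open>n \<times> n\<close> block of \<open>A\<close>, by the Leibniz formula; the
  library's determinants are only for rings given as type classes.\<close>

definition block_det :: "('a, 'b) ring_scheme \<Rightarrow> nat \<Rightarrow> (nat \<Rightarrow> nat \<Rightarrow> 'a) \<Rightarrow> 'a" where
  "block_det F n A =
     (\<Oplus>\<^bsub>F\<^esub>\<sigma>\<in>{\<sigma>. \<sigma> permutes {..<n}}.
        if evenperm \<sigma> then (\<Otimes>\<^bsub>F\<^esub>i\<in>{..<n}. A i (\<sigma> i))
        else \<ominus>\<^bsub>F\<^esub> (\<Otimes>\<^bsub>F\<^esub>i\<in>{..<n}. A i (\<sigma> i)))"

definition id_matrix :: "('a, 'b) ring_scheme \<Rightarrow> nat \<Rightarrow> nat \<Rightarrow> 'a" where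
  "id_matrix F = (\<lambda>i j. if i = j then \<one>\<^bsub>F\<^esub> else \<zero>\<^bsub>F\<^esub>)"

text \<open>\<open>SL n F\<close> is represented by the matrices over \<open>F\<close> with index set \<open>nat\<close> which are block
  diagonal with an \<open>n \<times> n\<close> block of determinant one followed by the infinite identity matrix.
  In this representation the natural embedding of \<open>SL n F\<close> into \<open>SL (Suc n) F\<close>, which fixes the
  new basis vector, is the inclusion of sets, and the colimit is the union.\<close>

definition SL :: "nat \<Rightarrow> ('a, 'b) ring_scheme \<Rightarrow> (nat \<Rightarrow> nat \<Rightarrow> 'a) set" where
  "SL n F = {A. (\<forall>i j. A i j \<in> carrier F) \<and>
                (\<forall>i j. n \<le> i \<or> n \<le> j \<longrightarrow> A i j = id_matrix F i j) \<and>
                block_det F n A = \<one>\<^bsub>F\<^esub>}"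

text \<open>The summation range is restricted to the support of the \<open>i\<close>-th row of \<open>A\<close>, which is finite
  for \<open>A\<close> in the carrier: a HOL-Algebra sum over an infinite index set is zero by convention.\<close>

definition SL_inf :: "('a, 'b) ring_scheme \<Rightarrow> (nat \<Rightarrow> nat \<Rightarrow> 'a) monoid" where
  "SL_inf F =
     \<lparr>carrier = (\<Union>n. SL n F),
      monoid.mult = (\<lambda>A B i j. \<Oplus>\<^bsub>F\<^esub>k\<in>{k. A i k \<noteq> \<zero>\<^bsub>F\<^esub>}. A i k \<otimes>\<^bsub>F\<^esub> B k j),
      one = id_matrix F\<rparr>"

definition centraliser_aut :: "('a, 'b) monoid_scheme \<Rightarrow> ('a \<Rightarrow> 'a) set \<Rightarrow> 'a set" where
  "centraliser_aut K H = {g \<in> carrier K. \<forall>h\<in>H. h g = g}"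

end

theory Submission
  imports Defs "Jordan_Normal_Form.Determinant" "HOL-Algebra.Multiplicative_Group"
    "HOL-Algebra.Weak_Morphisms" "HOL-Number_Theory.Residues" "HOL-Library.Countable_Set"
begin

text \<open>
  Let \<open>F\<close> be the field with \<open>q = p ^ 8\<close> elements. The group \<open>H\<close> is \<open>PSL(2,q)\<close>, and it acts on
  \<open>SL_inf F\<close> by conjugation with infinite matrices that come from a representation of \<open>SL(2,q)\<close>
  on a space \<open>V\<close> of countable dimension.

  \<^item> A matrix with finite rows and columns whose inverse is of the same kind normalises the group of
    matrices that differ from the identity in finitely many entries. It preserves determinants
    because \<open>det (1 + P Q) = det (1 + Q P)\<close> (lemma \<open>SL_conj\<close>). So a representation of a group \<open>G\<close> by
    such matrices gives a group of automorphisms of \<open>SL_inf F\<close>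
    (\<open>exists_simple_group_of_automorphisms\<close>). If every normal subgroup of \<open>G\<close> is \<open>G\<close> or acts
    trivially, this group is simple. For \<open>SL(2,q)\<close> the relevant normal subgroups are those that
    consist of scalar matrices (\<open>SL2_normal_dichotomy\<close>).

  \<^item> An element \<open>1 + X\<close> of \<open>SL_inf F\<close> is fixed by the whole group if and only if the matrix \<open>X\<close>, which
    has finite support, commutes with the representation. So it suffices that \<open>V\<close> has no nonzero
    endomorphisms of finite support. This rules out direct sums of modules of finite dimension, whose
    projections to the summands are such endomorphisms.

  \<^item> \<open>V\<close> is induced from the Borel subgroup \<open>B\<close> of upper triangular matrices, with a module of
    infinite dimension for \<open>B\<close>. By the Mackey decomposition and \<open>G = B \<union> B w B\<close>, an endomorphism of
    \<open>V\<close> consists of an endomorphism of that module and a map between the module and its twist by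
    \<open>w\<close> that respects the action of the torus. As \<open>w\<close> inverts the torus and no two weights of the
    module are opposite to each other, the second part vanishes
    (\<open>commuting_finite_matrix_eq_zero\<close>).

  \<^item> It remains to find a module for \<open>B\<close>. The root subgroup of \<open>B\<close> is the additive group of \<open>F\<close>, and
    it has the homomorphisms \<open>x \<mapsto> x ^ (p ^ j)\<close> to \<open>F\<close>, on which the torus acts with different
    weights. Four of them are used to extend a space \<open>A\<close>, of one weight, by four spaces
    \<open>B0\<close>, ..., \<open>B3\<close>, each of its own weight, along arbitrary linear maps from \<open>A\<close> to the four
    spaces. Endomorphisms of this module are the same as endomorphisms of \<open>A\<close> that respect the four
    kernels, so this is the four subspace problem. It has a solution of infinite dimension in which
    the endomorphisms are constant along diagonals. Such a matrix with finite support is zero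
    (\<open>finite_commuting_matrix_eq_zero\<close>).

  The exponent 8 is the result of three quadratic extensions of the prime field. It is large enough
  to keep different weights apart, and sums of two weights nonzero, modulo \<open>q - 1\<close>.
\<close>

section \<open>Row-finite and column-finite matrices\<close>

text \<open>The sum extends over the support of a row, as in the multiplication of \<open>SL_inf\<close>, so that on
  indices in \<open>nat\<close> this is the multiplication of that monoid. Other index types are needed for
  the module of the Borel subgroup.\<close>

definition mprod :: "('a, 'b) ring_scheme \<Rightarrow> ('i \<Rightarrow> 'k \<Rightarrow> 'a) \<Rightarrow> ('k \<Rightarrow> 'j \<Rightarrow> 'a) \<Rightarrow> 'i \<Rightarrow> 'j \<Rightarrow> 'a" where
  "mprod F A B = (\<lambda>i j. \<Oplus>\<^bsub>F\<^esub>k\<in>{k. A i k \<noteq> \<zero>\<^bsub>F\<^esub>}. A i k \<otimes>\<^bsub>F\<^esub> B k j)"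

definition madd :: "('a, 'b) ring_scheme \<Rightarrow> ('i \<Rightarrow> 'j \<Rightarrow> 'a) \<Rightarrow> ('i \<Rightarrow> 'j \<Rightarrow> 'a) \<Rightarrow> 'i \<Rightarrow> 'j \<Rightarrow> 'a" where
  "madd F A B = (\<lambda>i j. A i j \<oplus>\<^bsub>F\<^esub> B i j)"

definition unit_matrix :: "('a, 'b) ring_scheme \<Rightarrow> 'i \<Rightarrow> 'i \<Rightarrow> 'a" where
  "unit_matrix F = (\<lambda>i j. if i = j then \<one>\<^bsub>F\<^esub> else \<zero>\<^bsub>F\<^esub>)"

text \<open>Finite rows make \<open>mprod\<close> associative. Finite columns are needed in addition for conjugation to
  preserve finite support.\<close>

definition row_finite :: "('a, 'b) ring_scheme \<Rightarrow> ('i \<Rightarrow> 'j \<Rightarrow> 'a) \<Rightarrow> bool" where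
  "row_finite F A \<longleftrightarrow> (\<forall>i j. A i j \<in> carrier F) \<and> (\<forall>i. finite {j. A i j \<noteq> \<zero>\<^bsub>F\<^esub>})"

definition col_finite :: "('a, 'b) ring_scheme \<Rightarrow> ('i \<Rightarrow> 'j \<Rightarrow> 'a) \<Rightarrow> bool" where
  "col_finite F A \<longleftrightarrow> (\<forall>i j. A i j \<in> carrier F) \<and> (\<forall>j. finite {i. A i j \<noteq> \<zero>\<^bsub>F\<^esub>})"

lemma id_matrix_eq_unit_matrix: "id_matrix F = unit_matrix F"
  by (simp add: id_matrix_def unit_matrix_def)

lemma mult_SL_inf [simp]: "A \<otimes>\<^bsub>SL_inf F\<^esub> B = mprod F A B"
  by (simp add: SL_inf_def mprod_def)

lemma one_SL_inf [simp]: "\<one>\<^bsub>SL_inf F\<^esub> = unit_matrix F"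
  by (simp add: SL_inf_def id_matrix_eq_unit_matrix)

lemma row_finiteD:
  assumes "row_finite F A" shows "A i j \<in> carrier F" "finite {j. A i j \<noteq> \<zero>\<^bsub>F\<^esub>}"
  using assms by (auto simp: row_finite_def)

context ring begin

lemma finsum_superset:
  assumes "finite S" "T \<subseteq> S" "f \<in> S \<rightarrow> carrier R" "\<And>k. k \<in> S - T \<Longrightarrow> f k = \<zero>"
  shows "finsum R f T = finsum R f S"
  by (rule add.finprod_mono_neutral_cong_left) (use assms in auto)

lemma mprod_eq_finsum:
  assumes "finite S" "{k. A i k \<noteq> \<zero>} \<subseteq> S" "\<And>k. A i k \<in> carrier R" "\<And>k. B k j \<in> carrier R"
  shows "mprod R A B i j = (\<Oplus>k\<in>S. A i k \<otimes> B k j)"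
  unfolding mprod_def
  by (rule finsum_superset) (use assms in auto)

lemma mprod_eq_single:
  assumes "\<And>k. k \<noteq> l \<Longrightarrow> A i k = \<zero>" "\<And>k. A i k \<in> carrier R" "\<And>k. B k j \<in> carrier R"
  shows "mprod R A B i j = A i l \<otimes> B l j"
  using mprod_eq_finsum[of "{l}" A i B j] assms by auto

lemma mprod_closed [intro]:
  assumes "\<And>k. A i k \<in> carrier R" "\<And>k. B k j \<in> carrier R"
  shows "mprod R A B i j \<in> carrier R"
  unfolding mprod_def using assms by (intro finsum_closed) auto

lemma mprod_eq_zero:
  assumes "\<And>k. A i k \<noteq> \<zero> \<Longrightarrow> B k j = \<zero>" "\<And>k. A i k \<in> carrier R"
  shows "mprod R A B i j = \<zero>"
  unfolding mprod_def by (rule add.finprod_one_eqI) (use assms in auto)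

lemma row_finite_unit_matrix: "row_finite R (unit_matrix R)"
  by (auto simp: row_finite_def unit_matrix_def)

lemma row_finite_mprod:
  assumes "row_finite R A" "row_finite R B"
  shows "row_finite R (mprod R A B)"
proof -
  have "finite {j. mprod R A B i j \<noteq> \<zero>}" for i
  proof (rule finite_subset)
    show "{j. mprod R A B i j \<noteq> \<zero>} \<subseteq> (\<Union>k\<in>{k. A i k \<noteq> \<zero>}. {j. B k j \<noteq> \<zero>})"
      using mprod_eq_zero[of A i B] row_finiteD(1)[OF assms(1)] by blast
    show "finite (\<Union>k\<in>{k. A i k \<noteq> \<zero>}. {j. B k j \<noteq> \<zero>})"
      using row_finiteD(2)[OF assms(1)] row_finiteD(2)[OF assms(2)] by blast
  qed
  then show ?thesis
    using assms unfolding row_finite_def by (blast intro: mprod_closed)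
qed

lemma mprod_assoc:
  assumes A: "row_finite R A" and B: "row_finite R B" and C: "\<And>i j. C i j \<in> carrier R"
  shows "mprod R (mprod R A B) C = mprod R A (mprod R B C)"
proof (intro ext)
  fix i j
  define S where "S = {k. A i k \<noteq> \<zero>}"
  define T where "T = (\<Union>k\<in>S. {l. B k l \<noteq> \<zero>})"
  have S: "finite S" "{k. A i k \<noteq> \<zero>} \<subseteq> S" unfolding S_def using row_finiteD(2)[OF A] by auto
  have T: "finite T" unfolding T_def using S row_finiteD(2)[OF B] by auto
  note a = row_finiteD(1)[OF A] and b = row_finiteD(1)[OF B]
  have sub: "{k. mprod R A B i k \<noteq> \<zero>} \<subseteq> T"
    unfolding T_def S_def using mprod_eq_zero[of A i B] a by blast
  have "mprod R (mprod R A B) C i j = (\<Oplus>l\<in>T. mprod R A B i l \<otimes> C l j)"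
    by (rule mprod_eq_finsum) (use T sub C a b in auto)
  also have "\<dots> = (\<Oplus>l\<in>T. (\<Oplus>k\<in>S. A i k \<otimes> B k l) \<otimes> C l j)"
    using mprod_eq_finsum[where A=A and i=i and B=B and S=S] S a b
    by (intro finsum_cong') (auto intro!: m_closed finsum_closed C a b)
  also have "\<dots> = (\<Oplus>l\<in>T. (\<Oplus>k\<in>S. A i k \<otimes> B k l \<otimes> C l j))"
    by (intro finsum_cong' refl finsum_ldistr) (auto intro!: m_closed finsum_closed C a b S)
  also have "\<dots> = (\<Oplus>k\<in>S. (\<Oplus>l\<in>T. A i k \<otimes> B k l \<otimes> C l j))"
    by (rule finsum_finsum_swap) (auto intro!: m_closed finsum_closed C a b S T)
  also have "\<dots> = (\<Oplus>k\<in>S. A i k \<otimes> mprod R B C k j)"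
  proof (intro finsum_cong' refl)
    fix k assume k: "k \<in> S"
    have "mprod R B C k j = (\<Oplus>l\<in>T. B k l \<otimes> C l j)"
      by (rule mprod_eq_finsum) (use T b C k in \<open>auto simp: T_def\<close>)
    then show "(\<Oplus>l\<in>T. A i k \<otimes> B k l \<otimes> C l j) = A i k \<otimes> mprod R B C k j"
      using a b C T by (simp add: finsum_rdistr Pi_def m_assoc)
  qed (auto intro!: m_closed mprod_closed C a b)
  also have "\<dots> = mprod R A (mprod R B C) i j"
    by (rule mprod_eq_finsum[symmetric]) (use S a b C in \<open>auto intro!: mprod_closed\<close>)
  finally show "mprod R (mprod R A B) C i j = mprod R A (mprod R B C) i j" .
qed

lemma mprod_unit_left:
  assumes "\<And>i j. A i j \<in> carrier R" shows "mprod R (unit_matrix R) A = A"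
proof (intro ext)
  fix i j show "mprod R (unit_matrix R) A i j = A i j"
    using mprod_eq_single[of i "unit_matrix R" i A j] assms by (simp add: unit_matrix_def)
qed

lemma mprod_unit_right:
  assumes "row_finite R A" shows "mprod R A (unit_matrix R) = A"
proof (intro ext)
  fix i j
  note a = row_finiteD[OF assms]
  have "mprod R A (unit_matrix R) i j = (\<Oplus>k\<in>insert j {k. A i k \<noteq> \<zero>}. A i k \<otimes> unit_matrix R k j)"
    by (rule mprod_eq_finsum) (use a in \<open>auto simp: unit_matrix_def\<close>)
  also have "\<dots> = (\<Oplus>k\<in>insert j {k. A i k \<noteq> \<zero>}. if j = k then A i k else \<zero>)"
    using a by (intro finsum_cong') (auto simp: unit_matrix_def)
  also have "\<dots> = A i j" by (rule finsum_singleton) (use a in auto)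
  finally show "mprod R A (unit_matrix R) i j = A i j" .
qed

lemma mprod_madd_right:
  assumes "row_finite R A" "\<And>i j. B i j \<in> carrier R" "\<And>i j. C i j \<in> carrier R"
  shows "mprod R A (madd R B C) = madd R (mprod R A B) (mprod R A C)"
proof (intro ext)
  fix i j
  note a = row_finiteD[OF assms(1)]
  show "mprod R A (madd R B C) i j = madd R (mprod R A B) (mprod R A C) i j"
    unfolding mprod_def madd_def using a assms(2,3)
    by (simp add: r_distr finsum_addf Pi_def cong: finsum_cong)
qed

lemma mprod_madd_left:
  assumes "row_finite R A" "row_finite R B" "\<And>i j. C i j \<in> carrier R"
  shows "mprod R (madd R A B) C = madd R (mprod R A C) (mprod R B C)"
proof (intro ext)
  fix i j
  note a = row_finiteD[OF assms(1)] and b = row_finiteD[OF assms(2)]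
  define S where "S = {k. A i k \<noteq> \<zero>} \<union> {k. B i k \<noteq> \<zero>}"
  have S: "finite S" "{k. A i k \<noteq> \<zero>} \<subseteq> S" "{k. B i k \<noteq> \<zero>} \<subseteq> S" "{k. madd R A B i k \<noteq> \<zero>} \<subseteq> S"
    using a b by (auto simp: S_def madd_def)
  show "mprod R (madd R A B) C i j = madd R (mprod R A C) (mprod R B C) i j"
    using mprod_eq_finsum[where S=S and A=A and i=i and B=C and j=j]
      mprod_eq_finsum[where S=S and A=B and i=i and B=C and j=j]
      mprod_eq_finsum[where S=S and A="madd R A B" and i=i and B=C and j=j] S a b assms(3)
    by (simp add: madd_def l_distr finsum_addf Pi_def)
qed

lemma mprod_eq_finsum_right:
  assumes A: "row_finite R A" and S: "finite S" and z: "\<And>k. k \<notin> S \<Longrightarrow> A i k \<noteq> \<zero> \<Longrightarrow> B k j = \<zero>"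
    and B: "\<And>k. B k j \<in> carrier R"
  shows "mprod R A B i j = (\<Oplus>k\<in>S. A i k \<otimes> B k j)"
proof -
  note a = row_finiteD[OF A]
  have "mprod R A B i j = (\<Oplus>k\<in>S \<union> {k. A i k \<noteq> \<zero>}. A i k \<otimes> B k j)"
    by (rule mprod_eq_finsum) (use S a B in auto)
  also have "\<dots> = (\<Oplus>k\<in>S. A i k \<otimes> B k j)"
    by (rule finsum_superset[symmetric]) (use S a B z in auto)
  finally show ?thesis .
qed

lemma mprod_eq_single_right:
  assumes A: "row_finite R A" and z: "\<And>k. k \<noteq> l \<Longrightarrow> B k j = \<zero>" and B: "\<And>k. B k j \<in> carrier R"
  shows "mprod R A B i j = A i l \<otimes> B l j"
  using mprod_eq_finsum_right[OF A, of "{l}" i B j] z B row_finiteD(1)[OF A] by auto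

end

section \<open>Determinants over a finite field\<close>

text \<open>Sylvester's identity. Both sides are the determinant of the block matrix with rows
  \<open>(1, P)\<close> and \<open>(-Q, 1)\<close>, which is a product with a unitriangular block matrix in two ways.\<close>

lemma det_one_plus_swap:
  fixes P Q :: "'a :: idom mat"
  assumes P: "P \<in> carrier_mat n n" and Q: "Q \<in> carrier_mat n n"
  shows "det (1\<^sub>m n + P * Q) = det (1\<^sub>m n + Q * P)"
proof -
  let ?I = "1\<^sub>m n :: 'a mat" and ?O = "0\<^sub>m n n :: 'a mat"
  define L where "L = four_block_mat (?I + P * Q) P ?O ?I"
  define E where "E = four_block_mat ?I ?O (- Q) ?I"
  define L' where "L' = four_block_mat ?I P ?O (?I + Q * P)"
  have c: "?I + P * Q \<in> carrier_mat n n" "?I + Q * P \<in> carrier_mat n n" "- Q \<in> carrier_mat n n"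
    using P Q by auto
  have carr: "L \<in> carrier_mat (n + n) (n + n)" "E \<in> carrier_mat (n + n) (n + n)" "L' \<in> carrier_mat (n + n) (n + n)"
    unfolding L_def E_def L'_def using P Q by auto
  \<comment> \<open>The determinants of \<open>L\<close>, \<open>L'\<close> and \<open>E\<close> are the two sides of the claim and one.\<close>
  have e1: "?I + P * Q + P * (- Q) = ?I"
    using P Q by (intro eq_matI) auto
  have e2: "- Q * P + (?I + Q * P) = ?I"
    using P Q by (intro eq_matI) auto
  have "L * E = four_block_mat ?I P (- Q) ?I"
    unfolding L_def E_def using mult_four_block_mat[OF c(1) P zero_carrier_mat one_carrier_mat one_carrier_mat zero_carrier_mat c(3) one_carrier_mat]
    P Q c e1 by simp
  moreover have "E * L' = four_block_mat ?I P (- Q) ?I"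
    unfolding L'_def E_def using mult_four_block_mat[OF one_carrier_mat zero_carrier_mat c(3) one_carrier_mat one_carrier_mat P zero_carrier_mat c(2)]
    P Q c e2 by simp
  ultimately have "det L * det E = det E * det L'"
    using det_mult carr by metis
  moreover have "det E = 1"
    unfolding E_def using det_four_block_mat_upper_right_zero[of ?I n ?O n "- Q" ?I] c by simp
  moreover have "det L = det (?I + P * Q)"
    unfolding L_def using det_four_block_mat_lower_left_zero[of "?I + P * Q" n P n ?O ?I] c P by simp
  moreover have "det L' = det (?I + Q * P)"
    unfolding L'_def using det_four_block_mat_lower_left_zero[of ?I n P n ?O "?I + Q * P"] c P by simp
  ultimately show ?thesis by simp
qed

context cring begin

text \<open>Evaluation of integer polynomials at an element of the ring. At a generator of the multiplicative
  group of a finite field it is onto, and this is how facts about determinants over rings that are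
  types reach a field that is only a record: matrices are lifted to integer polynomials, and the
  Leibniz formula is preserved by ring homomorphisms.\<close>

definition int_poly_eval :: "'a \<Rightarrow> int poly \<Rightarrow> 'a" where
  "int_poly_eval z f = fold_coeffs (\<lambda>a v. [a] \<cdot> \<one> \<oplus> z \<otimes> v) f \<zero>"

lemma int_add_pow_0: "[(0::int)] \<cdot> x = \<zero>"
  by (simp add: add_pow_def int_pow_def)

context
  fixes z assumes z: "z \<in> carrier R"
begin

lemma int_poly_eval_0 [simp]: "int_poly_eval z 0 = \<zero>"
  by (simp add: int_poly_eval_def)

lemma int_poly_eval_pCons [simp]: "int_poly_eval z (pCons a f) = [a] \<cdot> \<one> \<oplus> z \<otimes> int_poly_eval z f"
  using z by (cases "a = 0 \<and> f = 0") (auto simp: int_poly_eval_def int_add_pow_0)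

lemma int_poly_eval_closed [simp, intro]: "int_poly_eval z f \<in> carrier R"
  by (induction f) (auto simp: z)

lemma int_poly_eval_add: "int_poly_eval z (f + g) = int_poly_eval z f \<oplus> int_poly_eval z g"
  using z by (induction f g rule: poly_induct2) (auto simp: add.int_pow_mult r_distr a_ac)

lemma int_poly_eval_smult: "int_poly_eval z (smult c f) = [c] \<cdot> \<one> \<otimes> int_poly_eval z f"
  using z by (induction f) (auto simp: r_distr m_lcomm add_pow_ldistr_int add.int_pow_pow add.int_pow_closed mult.commute)

lemma int_poly_eval_mult: "int_poly_eval z (f * g) = int_poly_eval z f \<otimes> int_poly_eval z g"
  using z by (induction f) (auto simp: int_poly_eval_add int_poly_eval_smult l_distr m_assoc int_add_pow_0)

lemma int_poly_eval_1 [simp]: "int_poly_eval z 1 = \<one>"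
  using z by (simp add: one_pCons)

lemma int_poly_eval_uminus: "int_poly_eval z (- f) = \<ominus> int_poly_eval z f"
  using int_poly_eval_add[of f "- f"] by (metis a_comm int_poly_eval_0 int_poly_eval_closed minus_equality right_minus)

lemma int_poly_eval_sum:
  "finite A \<Longrightarrow> int_poly_eval z (sum f A) = (\<Oplus>i\<in>A. int_poly_eval z (f i))"
  by (induction A rule: finite_induct) (auto simp: int_poly_eval_add)

lemma int_poly_eval_prod:
  "finite A \<Longrightarrow> int_poly_eval z (prod f A) = (\<Otimes>i\<in>A. int_poly_eval z (f i))"
  by (induction A rule: finite_induct) (auto simp: int_poly_eval_mult)

text \<open>The entries of \<open>A\<close> outside of the block do not occur in \<open>block_det R n A\<close>, so they need no lift.\<close>

lemma int_poly_eval_det: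
  assumes "M \<in> carrier_mat n n" "\<And>i j. i < n \<Longrightarrow> j < n \<Longrightarrow> int_poly_eval z (M $$ (i, j)) = A i j"
  shows "int_poly_eval z (det M) = block_det R n A"
proof -
  have prod: "int_poly_eval z (\<Prod>i = 0..<n. M $$ (i, p i)) = (\<Otimes>i\<in>{..<n}. A i (p i))"
    if "p permutes {..<n}" for p
  proof -
    have p: "p i < n" if "i < n" for i using permutes_in_image[OF \<open>p permutes _\<close>, of i] that by auto
    have "int_poly_eval z (\<Prod>i = 0..<n. M $$ (i, p i)) = (\<Otimes>i\<in>{..<n}. int_poly_eval z (M $$ (i, p i)))"
      by (simp add: int_poly_eval_prod atLeast0LessThan)
    also have "\<dots> = (\<Otimes>i\<in>{..<n}. A i (p i))"
      by (rule finprod_cong') (auto simp: p assms(2)[symmetric])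
    finally show ?thesis .
  qed
  have clos: "(\<Otimes>i\<in>{..<n}. A i (p i)) \<in> carrier R" if "p permutes {..<n}" for p
    using prod[OF that] int_poly_eval_closed by metis
  have "int_poly_eval z (det M) = (\<Oplus>p\<in>{p. p permutes {..<n}}.
      int_poly_eval z (signof p * (\<Prod>i = 0..<n. M $$ (i, p i))))"
    unfolding det_def'[OF assms(1)] by (subst int_poly_eval_sum) (auto simp: finite_permutations atLeast0LessThan)
  also have "\<dots> = block_det R n A"
    unfolding block_det_def
    by (rule finsum_cong') (auto simp: prod sign_def int_poly_eval_uminus clos)
  finally show ?thesis .
qed

end

end

lemma SL_D:
  assumes "A \<in> SL n F"
  shows "A i j \<in> carrier F" "n \<le> i \<or> n \<le> j \<Longrightarrow> A i j = unit_matrix F i j" "block_det F n A = \<one>\<^bsub>F\<^esub>"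
  using assms by (auto simp: SL_def id_matrix_eq_unit_matrix)

lemma SL_I:
  assumes "\<And>i j. A i j \<in> carrier F" "\<And>i j. n \<le> i \<or> n \<le> j \<Longrightarrow> A i j = unit_matrix F i j"
    "block_det F n A = \<one>\<^bsub>F\<^esub>"
  shows "A \<in> SL n F"
  using assms by (auto simp: SL_def id_matrix_eq_unit_matrix)

lemma (in field) finite_field_int_poly_eval_surj:
  assumes "finite (carrier R)"
  obtains z L where "z \<in> carrier R" "\<And>x. x \<in> carrier R \<Longrightarrow> int_poly_eval z (L x) = x"
proof -
  obtain z where z: "z \<in> carrier (mult_of R)" "carrier (mult_of R) = {z [^] i | i::nat. i \<in> UNIV}"
    using finite_field_mult_group_has_gen[OF assms] by blast
  have zc: "z \<in> carrier R" using z by (simp add: carrier_mult_of)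
  have pow: "int_poly_eval z (Polynomial.monom 1 i) = z [^] i" for i
    by (induction i) (use zc in \<open>simp_all add: Polynomial.monom_0 Polynomial.monom_Suc int_add_pow_0 m_comm\<close>)
  have "\<exists>f. int_poly_eval z f = x" if "x \<in> carrier R" for x
  proof (cases "x = \<zero>")
    case False
    then have "x \<in> carrier (mult_of R)" using that by (simp add: carrier_mult_of)
    then obtain i :: nat where "x = z [^] i" using z(2) by blast
    then show ?thesis using pow by blast
  qed (use int_poly_eval_0 zc in blast)
  then have "\<exists>L. \<forall>x\<in>carrier R. int_poly_eval z (L x) = x" by (intro bchoice) blast
  then show thesis using that zc by blast
qed

locale finite_field = field +
  assumes finite_carrier: "finite (carrier R)"
begin

text \<open>The rows of the block of \<open>A\<close> have to vanish outside of the block, for otherwise entries of \<open>B\<close> from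
  outside enter the block of the product.\<close>

lemma block_det_mprod:
  assumes A: "\<And>i j. A i j \<in> carrier R" and B: "\<And>i j. B i j \<in> carrier R"
    and supp: "\<And>i j. i < n \<Longrightarrow> n \<le> j \<Longrightarrow> A i j = \<zero>"
  shows "block_det R n (mprod R A B) = block_det R n A \<otimes> block_det R n B"
proof -
  obtain z L where z: "z \<in> carrier R" and L: "\<And>x. x \<in> carrier R \<Longrightarrow> int_poly_eval z (L x) = x"
    using finite_field_int_poly_eval_surj finite_carrier by metis
  define M where "M = mat n n (\<lambda>(i, j). L (A i j))"
  define N where "N = mat n n (\<lambda>(i, j). L (B i j))"
  have c: "M \<in> carrier_mat n n" "N \<in> carrier_mat n n" by (auto simp: M_def N_def)
  have "int_poly_eval z ((M * N) $$ (i, j)) = mprod R A B i j" if "i < n" "j < n" for i j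
  proof -
    have "int_poly_eval z ((M * N) $$ (i, j)) = (\<Oplus>k\<in>{..<n}. int_poly_eval z (L (A i k) * L (B k j)))"
      using that z by (simp add: M_def N_def scalar_prod_def atLeast0LessThan int_poly_eval_sum)
    also have "\<dots> = (\<Oplus>k\<in>{..<n}. A i k \<otimes> B k j)"
      using A B by (intro finsum_cong') (auto simp: int_poly_eval_mult z L)
    also have "\<dots> = mprod R A B i j"
    proof (rule mprod_eq_finsum[symmetric])
      show "{k. A i k \<noteq> \<zero>} \<subseteq> {..<n}" using supp[OF \<open>i < n\<close>] not_le by blast
    qed (use A B in auto)
    finally show ?thesis .
  qed
  then have "block_det R n (mprod R A B) = int_poly_eval z (det (M * N))"
    using int_poly_eval_det[of z "M * N" n "mprod R A B"] c z by auto
  also have "\<dots> = int_poly_eval z (det M) \<otimes> int_poly_eval z (det N)"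
    using c z by (simp add: det_mult int_poly_eval_mult)
  also have "int_poly_eval z (det M) = block_det R n A"
    by (rule int_poly_eval_det) (use z L A in \<open>auto simp: M_def\<close>)
  also have "int_poly_eval z (det N) = block_det R n B"
    by (rule int_poly_eval_det) (use z L B in \<open>auto simp: N_def\<close>)
  finally show ?thesis .
qed

lemma block_det_enlarge:
  assumes A: "\<And>i j. A i j \<in> carrier R" and "n \<le> N"
    and eq: "\<And>i j. n \<le> i \<or> n \<le> j \<Longrightarrow> A i j = unit_matrix R i j"
  shows "block_det R N A = block_det R n A"
proof -
  obtain z L where z: "z \<in> carrier R" and L: "\<And>x. x \<in> carrier R \<Longrightarrow> int_poly_eval z (L x) = x"
    using finite_field_int_poly_eval_surj finite_carrier by metis
  define M where "M = mat n n (\<lambda>(i, j). L (A i j))"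
  define M' where "M' = four_block_mat M (0\<^sub>m n (N - n)) (0\<^sub>m (N - n) n) (1\<^sub>m (N - n))"
  have c: "M \<in> carrier_mat n n" by (auto simp: M_def)
  have "M' \<in> carrier_mat (n + (N - n)) (n + (N - n))" unfolding M'_def using c by auto
  then have c': "M' \<in> carrier_mat N N" using \<open>n \<le> N\<close> by simp
  have "int_poly_eval z (det M') = block_det R N A"
  proof (rule int_poly_eval_det[OF z c'])
    fix i j assume "i < N" "j < N"
    then show "int_poly_eval z (M' $$ (i, j)) = A i j"
      using z L A eq[of i j] \<open>n \<le> N\<close> c by (auto simp: M'_def M_def unit_matrix_def)
  qed
  moreover have "det M' = det M"
    unfolding M'_def using det_four_block_mat_upper_right_zero[OF c refl, of "0\<^sub>m (N - n) n" "N - n" "1\<^sub>m (N - n)"] by simp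
  moreover have "int_poly_eval z (det M) = block_det R n A"
    by (rule int_poly_eval_det) (use z L A in \<open>auto simp: M_def\<close>)
  ultimately show ?thesis by simp
qed

lemma block_det_one_plus_swap:
  assumes U: "\<And>i j. U i j \<in> carrier R" "\<And>i j. n \<le> j \<Longrightarrow> U i j = \<zero>"
    and W: "\<And>i j. W i j \<in> carrier R" "\<And>i j. n \<le> j \<Longrightarrow> W i j = \<zero>"
  shows "block_det R n (madd R (unit_matrix R) (mprod R U W)) = block_det R n (madd R (unit_matrix R) (mprod R W U))"
proof -
  obtain z L where z: "z \<in> carrier R" and L: "\<And>x. x \<in> carrier R \<Longrightarrow> int_poly_eval z (L x) = x"
    using finite_field_int_poly_eval_surj finite_carrier by metis
  define M where "M A = mat n n (\<lambda>(i, j). L (A i j))" for A :: "nat \<Rightarrow> nat \<Rightarrow> 'a"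
  have c: "M A \<in> carrier_mat n n" for A by (auto simp: M_def)
  have *: "int_poly_eval z (det (1\<^sub>m n + M A * M B)) = block_det R n (madd R (unit_matrix R) (mprod R A B))"
    if A: "\<And>i j. A i j \<in> carrier R" "\<And>i j. n \<le> j \<Longrightarrow> A i j = \<zero>" and B: "\<And>i j. B i j \<in> carrier R" for A B
  proof (rule int_poly_eval_det[OF z])
    fix i j assume "i < n" "j < n"
    then have "int_poly_eval z ((M A * M B) $$ (i, j)) = (\<Oplus>k\<in>{..<n}. int_poly_eval z (L (A i k) * L (B k j)))"
      using z by (simp add: M_def scalar_prod_def atLeast0LessThan int_poly_eval_sum)
    also have "\<dots> = (\<Oplus>k\<in>{..<n}. A i k \<otimes> B k j)"
      using A B by (intro finsum_cong') (auto simp: int_poly_eval_mult z L)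
    also have "\<dots> = mprod R A B i j"
    proof (rule mprod_eq_finsum[symmetric])
      show "{k. A i k \<noteq> \<zero>} \<subseteq> {..<n}" using A(2) not_le by blast
    qed (use A B in auto)
    finally have "int_poly_eval z ((M A * M B) $$ (i, j)) = mprod R A B i j" .
    then show "int_poly_eval z ((1\<^sub>m n + M A * M B) $$ (i, j)) = madd R (unit_matrix R) (mprod R A B) i j"
      using \<open>i < n\<close> \<open>j < n\<close> c[of A] c[of B] z by (auto simp: madd_def unit_matrix_def int_poly_eval_add)
  qed (rule add_carrier_mat[OF mult_carrier_mat[OF c c]])
  show ?thesis
    using *[of U W] *[of W U] U W det_one_plus_swap[OF c c, of U W] by simp
qed

lemma SL_enlarge: "A \<in> SL n R \<Longrightarrow> n \<le> N \<Longrightarrow> A \<in> SL N R"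
  by (rule SL_I) (use SL_D[of A n R] block_det_enlarge[of A n N] in auto)

lemma row_finite_SL:
  assumes "A \<in> SL n R" shows "row_finite R A"
proof -
  have "finite {j. A i j \<noteq> \<zero>}" for i
  proof (rule finite_subset)
    show "{j. A i j \<noteq> \<zero>} \<subseteq> {..<n} \<union> {i}"
    proof
      fix j assume "j \<in> {j. A i j \<noteq> \<zero>}"
      then show "j \<in> {..<n} \<union> {i}"
        using SL_D(2)[OF assms, of i j] by (cases "n \<le> j") (auto simp: unit_matrix_def split: if_splits)
    qed
  qed auto
  then show ?thesis using SL_D(1)[OF assms] by (auto simp: row_finite_def)
qed

lemma SL_mprod:
  assumes A: "A \<in> SL n R" and B: "B \<in> SL m R"
  shows "mprod R A B \<in> SL (max n m) R"
proof -
  define N where "N = max n m"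
  have A: "A \<in> SL N R" and B: "B \<in> SL N R" using assms SL_enlarge by (auto simp: N_def)
  note a = SL_D[OF A] and b = SL_D[OF B]
  have "mprod R A B \<in> SL N R"
  proof (rule SL_I)
    show "mprod R A B i j \<in> carrier R" for i j using a b by (auto intro!: mprod_closed)
    show "mprod R A B i j = unit_matrix R i j" if "N \<le> i \<or> N \<le> j" for i j
    proof (cases "N \<le> i")
      case True
      then have "mprod R A B i j = A i i \<otimes> B i j"
        by (intro mprod_eq_single) (use a b in \<open>auto simp: unit_matrix_def\<close>)
      then show ?thesis using True a(2)[of i i] b(2)[of i j] by (auto simp: unit_matrix_def)
    next
      case False
      with that have j: "N \<le> j" "i \<noteq> j" by auto
      have "mprod R A B i j = \<zero>"
      proof (rule mprod_eq_zero)
        fix k assume "A i k \<noteq> \<zero>"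
        then have "k \<noteq> j" using a(2)[of i j] j by (auto simp: unit_matrix_def)
        then show "B k j = \<zero>" using b(2)[of k j] j by (auto simp: unit_matrix_def)
      qed (use a in auto)
      then show ?thesis using j by (simp add: unit_matrix_def)
    qed
    have "block_det R N (mprod R A B) = block_det R N A \<otimes> block_det R N B"
      by (rule block_det_mprod) (use a b in \<open>auto simp: unit_matrix_def\<close>)
    then show "block_det R N (mprod R A B) = \<one>" using a(3) b(3) by simp
  qed
  then show ?thesis by (simp add: N_def)
qed

lemma SL_eq_one_plus_finite:
  assumes A: "A \<in> SL n R"
  obtains X where "A = madd R (unit_matrix R) X" "\<And>i j. X i j \<in> carrier R"
    "\<And>i j. n \<le> i \<or> n \<le> j \<Longrightarrow> X i j = \<zero>" "row_finite R X"
proof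
  note a = SL_D[OF A]
  define X where "X = (\<lambda>i j. A i j \<ominus> unit_matrix R i j)"
  have uc: "unit_matrix R i j \<in> carrier R" for i j :: nat by (simp add: unit_matrix_def)
  show Xc: "X i j \<in> carrier R" for i j using a uc by (simp add: X_def)
  show X0: "X i j = \<zero>" if "n \<le> i \<or> n \<le> j" for i j using a(2)[OF that] uc by (simp add: X_def minus_eq r_neg)
  have "{j. X i j \<noteq> \<zero>} \<subseteq> {..<n}" for i using X0 not_le by blast
  then show "row_finite R X" using Xc finite_subset unfolding row_finite_def by blast
  show "A = madd R (unit_matrix R) X"
  proof (intro ext)
    fix i j show "A i j = madd R (unit_matrix R) X i j"
      using a(1)[of i j] uc[of i j] by (simp add: madd_def X_def) algebra
  qed
qed

text \<open>With \<open>A = 1 + X\<close> the conjugate is \<open>1 + P X Q\<close>. Finite columns of \<open>P\<close> and finite rows of \<open>Q\<close> confine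
  \<open>P X Q\<close> to a finite block. Its determinant is \<open>det (1 + P' W)\<close> for \<open>W = X Q\<close> and the part \<open>P'\<close> of
  \<open>P\<close> in the first \<open>n\<close> columns, hence equal to \<open>det (1 + W P') = det (1 + X)\<close>.\<close>

lemma SL_conj:
  assumes A: "A \<in> SL n R" and P: "row_finite R P" "col_finite R P" and Q: "row_finite R Q"
    and PQ: "mprod R P Q = unit_matrix R" and QP: "mprod R Q P = unit_matrix R"
  shows "\<exists>N. mprod R (mprod R P A) Q \<in> SL N R"
proof -
  note a = SL_D[OF A] and p = row_finiteD[OF P(1)] and q = row_finiteD[OF Q]
  have uc: "unit_matrix R i j \<in> carrier R" for i j :: nat by (simp add: unit_matrix_def)
  obtain X where AX: "A = madd R (unit_matrix R) X" and Xc: "\<And>i j. X i j \<in> carrier R"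
    and X0: "\<And>i j. n \<le> i \<or> n \<le> j \<Longrightarrow> X i j = \<zero>" and Xr: "row_finite R X"
    using SL_eq_one_plus_finite[OF A] by blast
  \<comment> \<open>\<open>N\<close> bounds the nonzero entries in the first \<open>n\<close> columns of \<open>P\<close> and the first \<open>n\<close> rows of \<open>Q\<close>.\<close>
  have fin: "finite ((\<Union>k<n. {i. P i k \<noteq> \<zero>}) \<union> (\<Union>k<n. {j. Q k j \<noteq> \<zero>}) \<union> {..<n})"
    using P(2) q(2) by (auto simp: col_finite_def)
  obtain N where N: "\<And>i k. k < n \<Longrightarrow> N \<le> i \<Longrightarrow> P i k = \<zero>" "\<And>k j. k < n \<Longrightarrow> N \<le> j \<Longrightarrow> Q k j = \<zero>" "n \<le> N"
  proof -
    obtain N where N: "\<forall>x\<in>(\<Union>k<n. {i. P i k \<noteq> \<zero>}) \<union> (\<Union>k<n. {j. Q k j \<noteq> \<zero>}) \<union> {..<n}. x < N"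
      using fin finite_nat_set_iff_bounded by metis
    have "n \<le> N"
    proof (rule ccontr)
      assume "\<not> n \<le> N"
      then have "N < N" using N by (metis UnI2 lessThan_iff not_le)
      then show False by simp
    qed
    moreover have "P i k = \<zero>" if "k < n" "N \<le> i" for i k
    proof (rule ccontr)
      assume "P i k \<noteq> \<zero>"
      then have "i < N" using N that by blast
      then show False using that by simp
    qed
    moreover have "Q k j = \<zero>" if "k < n" "N \<le> j" for k j
    proof (rule ccontr)
      assume "Q k j \<noteq> \<zero>"
      then have "j < N" using N that by blast
      then show False using that by simp
    qed
    ultimately show thesis using that by blast
  qed
  define W where "W = mprod R X Q"
  \<comment> \<open>As the rows of \<open>X\<close> from \<open>n\<close> on vanish, only the first \<open>n\<close> columns of \<open>P\<close> matter in \<open>P X Q\<close>.\<close>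
  define P' where "P' = (\<lambda>i j. if j < n then P i j else \<zero>)"
  have P'c: "P' i j \<in> carrier R" for i j using p by (simp add: P'_def)
  have Wr: "row_finite R W" unfolding W_def using Xr Q by (rule row_finite_mprod)
  note w = row_finiteD[OF Wr]
  have W0: "W i j = \<zero>" if "n \<le> i \<or> N \<le> j" for i j
    unfolding W_def
  proof (rule mprod_eq_zero)
    fix k assume "X i k \<noteq> \<zero>"
    then have "i < n" "k < n" using X0 not_le by blast+
    then show "Q k j = \<zero>" using that N(2) by auto
  qed (use Xc in auto)
  have "mprod R (mprod R P A) Q = madd R (unit_matrix R) (mprod R P W)"
  proof -
    have "mprod R P A = madd R P (mprod R P X)"
      unfolding AX using mprod_madd_right[of P "unit_matrix R" X] P(1) uc Xc mprod_unit_right[of P] by simp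
    then have "mprod R (mprod R P A) Q = madd R (mprod R P Q) (mprod R (mprod R P X) Q)"
      using mprod_madd_left[of P "mprod R P X" Q] P(1) row_finite_mprod[OF P(1) Xr] q(1) by simp
    then show ?thesis using mprod_assoc[of P X Q] P(1) Xr q(1) by (simp add: PQ W_def)
  qed
  moreover have "mprod R P W = mprod R P' W"
  proof (intro ext)
    fix i j
    have "mprod R P W i j = (\<Oplus>k\<in>{k. P i k \<noteq> \<zero>}. P' i k \<otimes> W k j)"
      unfolding mprod_def using p w W0 by (intro finsum_cong') (auto simp: P'_def not_less)
    also have "\<dots> = mprod R P' W i j"
      by (rule mprod_eq_finsum[symmetric]) (use p P'c w in \<open>auto simp: P'_def split: if_splits\<close>)
    finally show "mprod R P W i j = mprod R P' W i j" .
  qed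
  ultimately have eq: "mprod R (mprod R P A) Q = madd R (unit_matrix R) (mprod R P' W)" by simp
  have "mprod R W P' = X"
  proof -
    have "mprod R W P' = mprod R X (mprod R Q P')"
      unfolding W_def using mprod_assoc[of X Q P'] Xr Q P'c by simp
    also have "\<dots> = X"
    proof (intro ext)
      fix i j
      have QP': "mprod R Q P' k j = (if j < n then unit_matrix R k j else \<zero>)" for k
      proof (cases "j < n")
        case True
        then have "mprod R Q P' k j = mprod R Q P k j" by (simp add: mprod_def P'_def)
        then show ?thesis using True QP by simp
      qed (auto intro!: mprod_eq_zero simp: P'_def q)
      show "mprod R X (mprod R Q P') i j = X i j"
      proof (cases "j < n")
        case True
        then have "mprod R X (mprod R Q P') i j = mprod R X (unit_matrix R) i j"
          unfolding mprod_def[of R X] by (simp only: QP' if_True)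
        then show ?thesis using mprod_unit_right[OF Xr] by simp
      next
        case False
        then show ?thesis using X0[of i j] Xc mprod_eq_zero[of X i "mprod R Q P'" j] by (simp add: QP')
      qed
    qed
    finally show ?thesis .
  qed
  have "mprod R (mprod R P A) Q \<in> SL N R"
  proof (rule SL_I)
    have mc: "mprod R P' W i j \<in> carrier R" for i j using P'c w by (auto intro!: mprod_closed)
    show "mprod R (mprod R P A) Q i j \<in> carrier R" for i j
      unfolding eq madd_def using uc mc by simp
    show "mprod R (mprod R P A) Q i j = unit_matrix R i j" if "N \<le> i \<or> N \<le> j" for i j
    proof -
      have "mprod R P' W i j = \<zero>"
      proof (rule mprod_eq_zero)
        fix k assume "P' i k \<noteq> \<zero>"
        then have "k < n" "i < N" using N(1)[of k i] by (auto simp: P'_def not_le[symmetric] split: if_splits)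
        then show "W k j = \<zero>" using W0 that by auto
      qed (use P'c in auto)
      then show ?thesis unfolding eq madd_def using uc by simp
    qed
    have "block_det R N (mprod R (mprod R P A) Q) = block_det R N (madd R (unit_matrix R) (mprod R W P'))"
      unfolding eq by (rule block_det_one_plus_swap) (use P'c w W0 N in \<open>auto simp: P'_def\<close>)
    also have "\<dots> = block_det R N A" unfolding \<open>mprod R W P' = X\<close> AX ..
    also have "\<dots> = \<one>" using SL_D(3)[OF SL_enlarge[OF A N(3)]] .
    finally show "block_det R N (mprod R (mprod R P A) Q) = \<one>" .
  qed
  then show ?thesis by blast
qed

end

section \<open>Conjugation automorphisms of the infinite special linear group\<close>

text \<open>Preimages of normal subgroups are normal, so a proper nontrivial normal subgroup of the image
  would have a preimage that is excluded by the last assumption.\<close>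

lemma (in group) simple_group_quotientI:
  assumes S: "group S" and hom: "f \<in> hom G S" and onto: "f ` carrier G = carrier S"
    and fin: "finite (carrier S)" and nontriv: "\<exists>g\<in>carrier G. f g \<noteq> \<one>\<^bsub>S\<^esub>"
    and dich: "\<And>N. N \<lhd> G \<Longrightarrow> N = carrier G \<or> (\<forall>g\<in>N. f g = \<one>\<^bsub>S\<^esub>)"
  shows "simple_group S"
proof -
  interpret S: group S by (rule S)
  interpret f: group_hom G S f using hom by unfold_locales
  show ?thesis
  proof (unfold_locales)
    obtain g where g: "g \<in> carrier G" "f g \<noteq> \<one>\<^bsub>S\<^esub>" using nontriv by blast
    then have "{\<one>\<^bsub>S\<^esub>, f g} \<subseteq> carrier S" by auto
    then have "card {\<one>\<^bsub>S\<^esub>, f g} \<le> card (carrier S)" by (rule card_mono[OF fin])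
    then show "1 < Coset.order S" using g by (simp add: Coset.order_def)
  next
    fix N assume N: "N \<lhd> S"
    then interpret N: normal N S .
    define M where "M = {g \<in> carrier G. f g \<in> N}"
    have "subgroup M G"
      by (rule subgroupI) (auto simp: M_def intro: exI[of _ \<one>])
    moreover have "x \<otimes> h \<otimes> inv x \<in> M" if "x \<in> carrier G" "h \<in> M" for x h
      using that N.inv_op_closed2 by (auto simp: M_def)
    ultimately have "M \<lhd> G" by (simp add: normal_inv_iff)
    moreover have "N = f ` M" using onto N.subset by (auto simp: M_def)
    ultimately show "N = carrier S \<or> N = {\<one>\<^bsub>S\<^esub>}"
      using dich[of M] onto N.one_closed by (auto simp: image_iff)
  qed
qed

context finite_field begin

lemma carrier_SL_inf: "carrier (SL_inf R) = (\<Union>n. SL n R)"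
  by (simp add: SL_inf_def)

text \<open>Restricted to the carrier, because the elements of \<open>AutoGroup\<close> are extensional functions.\<close>

definition conj_by :: "(nat \<Rightarrow> nat \<Rightarrow> 'a) \<Rightarrow> (nat \<Rightarrow> nat \<Rightarrow> 'a) \<Rightarrow> (nat \<Rightarrow> nat \<Rightarrow> 'a) \<Rightarrow> nat \<Rightarrow> nat \<Rightarrow> 'a" where
  "conj_by P Q = (\<lambda>A\<in>carrier (SL_inf R). mprod R (mprod R P A) Q)"

lemma SL_inf_closed:
  assumes "A \<in> carrier (SL_inf R)" "B \<in> carrier (SL_inf R)"
  shows "mprod R A B \<in> carrier (SL_inf R)"
  using assms SL_mprod unfolding carrier_SL_inf by blast

lemma row_finite_SL_inf: "A \<in> carrier (SL_inf R) \<Longrightarrow> row_finite R A"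
  using row_finite_SL by (auto simp: carrier_SL_inf)

lemma unit_matrix_in_SL: "unit_matrix R \<in> SL 0 R"
  by (rule SL_I) (auto simp: unit_matrix_def block_det_def)

lemma unit_matrix_in_SL_inf: "unit_matrix R \<in> carrier (SL_inf R)"
  using unit_matrix_in_SL by (auto simp: carrier_SL_inf)

text \<open>This makes the group of automorphisms nontrivial: on a trivial group the identity alone would
  have trivial centraliser. The witness is an elementary matrix of size two.\<close>

lemma SL_inf_nontrivial: "\<exists>A\<in>carrier (SL_inf R). A \<noteq> unit_matrix R"
proof -
  define A :: "nat \<Rightarrow> nat \<Rightarrow> 'a" where "A = (\<lambda>i j. if i = 0 \<and> j = 1 then \<one> else unit_matrix R i j)"
  have Ac: "A i j \<in> carrier R" for i j by (simp add: A_def unit_matrix_def)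
  have "block_det R 2 A = \<one>"
  proof -
    have p: "{p. p permutes {..<2::nat}} = {id, transpose 0 1}"
    proof -
      have "{..<2::nat} = {0, 1}" by auto
      then show ?thesis using permutes_doubleton_iff[of _ 0 "1::nat"] by auto
    qed
    have n: "{..<2::nat} = insert 0 {1}" by auto
    have "id \<noteq> transpose 0 (1::nat)" by (metis id_apply transpose_apply_first zero_neq_one)
    moreover have "\<not> evenperm (transpose 0 (1::nat))" by (simp add: evenperm_swap)
    ultimately show ?thesis
      unfolding block_det_def p by (simp add: n A_def unit_matrix_def)
  qed
  then have "A \<in> SL 2 R" by (intro SL_I Ac) (auto simp: A_def)
  moreover have "A 0 1 \<noteq> unit_matrix R (0::nat) (1::nat)" by (simp add: A_def unit_matrix_def)
  ultimately show ?thesis unfolding carrier_SL_inf by (metis UN_I UNIV_I)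
qed

end

locale SL_inf_action = finite_field R + G: group G
  for R :: "('a, 'm) ring_scheme" (structure) and G :: "('g, 'n) monoid_scheme" +
  fixes \<rho> :: "'g \<Rightarrow> nat \<Rightarrow> nat \<Rightarrow> 'a"
  assumes row_finite: "g \<in> carrier G \<Longrightarrow> row_finite R (\<rho> g)"
    and col_finite: "g \<in> carrier G \<Longrightarrow> col_finite R (\<rho> g)"
    and rho_one: "\<rho> \<one>\<^bsub>G\<^esub> = unit_matrix R"
    and rho_mult: "g \<in> carrier G \<Longrightarrow> h \<in> carrier G \<Longrightarrow> \<rho> (g \<otimes>\<^bsub>G\<^esub> h) = mprod R (\<rho> g) (\<rho> h)"
begin

definition \<Phi> :: "'g \<Rightarrow> (nat \<Rightarrow> nat \<Rightarrow> 'a) \<Rightarrow> nat \<Rightarrow> nat \<Rightarrow> 'a" where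
  "\<Phi> g = conj_by (\<rho> g) (\<rho> (inv\<^bsub>G\<^esub> g))"

lemma rho_inv: "g \<in> carrier G \<Longrightarrow> mprod R (\<rho> g) (\<rho> (inv\<^bsub>G\<^esub> g)) = unit_matrix R"
  "g \<in> carrier G \<Longrightarrow> mprod R (\<rho> (inv\<^bsub>G\<^esub> g)) (\<rho> g) = unit_matrix R"
  using rho_mult[of g "inv\<^bsub>G\<^esub> g"] rho_mult[of "inv\<^bsub>G\<^esub> g" g] rho_one by auto

lemma Phi_apply: "A \<in> carrier (SL_inf R) \<Longrightarrow> \<Phi> g A = mprod R (mprod R (\<rho> g) A) (\<rho> (inv\<^bsub>G\<^esub> g))"
  by (simp add: \<Phi>_def conj_by_def)

lemma Phi_closed:
  assumes g: "g \<in> carrier G" and A: "A \<in> carrier (SL_inf R)"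
  shows "\<Phi> g A \<in> carrier (SL_inf R)"
proof -
  obtain n where n: "A \<in> SL n R" using A by (auto simp: carrier_SL_inf)
  have "\<exists>N. mprod R (mprod R (\<rho> g) A) (\<rho> (inv\<^bsub>G\<^esub> g)) \<in> SL N R"
    by (rule SL_conj[OF n]) (use g row_finite col_finite rho_inv in auto)
  then show ?thesis using A by (auto simp: Phi_apply carrier_SL_inf)
qed

lemma Phi_mult:
  assumes g: "g \<in> carrier G" and h: "h \<in> carrier G" and A: "A \<in> carrier (SL_inf R)"
  shows "\<Phi> (g \<otimes>\<^bsub>G\<^esub> h) A = \<Phi> g (\<Phi> h A)"
proof -
  note rg = row_finite[OF g] row_finite[OF h] row_finite[OF G.inv_closed[OF g]] row_finite[OF G.inv_closed[OF h]]
    row_finite_SL_inf[OF A]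
  show ?thesis
    unfolding Phi_apply[OF Phi_closed[OF h A]]
    unfolding Phi_apply[OF A]
    using g h rg by (simp add: G.inv_mult_group rho_mult mprod_assoc row_finite_mprod row_finiteD)
qed

lemma Phi_one: "A \<in> carrier (SL_inf R) \<Longrightarrow> \<Phi> \<one>\<^bsub>G\<^esub> A = A"
  using row_finite_SL_inf[of A] by (simp add: Phi_apply rho_one mprod_unit_left mprod_unit_right row_finiteD)

lemma Phi_hom:
  assumes g: "g \<in> carrier G" and A: "A \<in> carrier (SL_inf R)" and B: "B \<in> carrier (SL_inf R)"
  shows "\<Phi> g (mprod R A B) = mprod R (\<Phi> g A) (\<Phi> g B)"
proof -
  note rf = row_finite[OF g] row_finite[OF G.inv_closed[OF g]] row_finite_SL_inf[OF A] row_finite_SL_inf[OF B]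
  have "mprod R (\<Phi> g A) (\<Phi> g B)
      = mprod R (mprod R (\<rho> g) A) (mprod R (mprod R (\<rho> (inv\<^bsub>G\<^esub> g)) (\<rho> g)) (mprod R B (\<rho> (inv\<^bsub>G\<^esub> g))))"
    unfolding Phi_apply[OF A] Phi_apply[OF B]
    using rf by (simp add: mprod_assoc row_finite_mprod row_finiteD)
  also have "\<dots> = \<Phi> g (mprod R A B)"
    unfolding Phi_apply[OF SL_inf_closed[OF A B]] rho_inv(2)[OF g]
    using rf by (simp add: mprod_unit_left mprod_assoc row_finite_mprod row_finiteD)
  finally show ?thesis by simp
qed

lemma Phi_in_auto:
  assumes g: "g \<in> carrier G" shows "\<Phi> g \<in> auto (SL_inf R)"
proof -
  have "bij_betw (\<Phi> g) (carrier (SL_inf R)) (carrier (SL_inf R))"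
  proof (rule bij_betwI)
    fix A assume A: "A \<in> carrier (SL_inf R)"
    show "\<Phi> (inv\<^bsub>G\<^esub> g) (\<Phi> g A) = A" "\<Phi> g (\<Phi> (inv\<^bsub>G\<^esub> g) A) = A"
      using g A Phi_mult[of "inv\<^bsub>G\<^esub> g" g A] Phi_mult[of g "inv\<^bsub>G\<^esub> g" A] Phi_one[OF A] by auto
  qed (use g Phi_closed in auto)
  then have "\<Phi> g \<in> Bij (carrier (SL_inf R))"
    by (simp add: Bij_def \<Phi>_def conj_by_def)
  moreover have "\<Phi> g \<in> hom (SL_inf R) (SL_inf R)"
    using g by (auto simp: hom_def Phi_closed Phi_hom)
  ultimately show ?thesis by (simp add: auto_def)
qed

lemma Phi_in_BijGroup: "\<Phi> \<in> hom G (BijGroup (carrier (SL_inf R)))"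
proof (rule homI)
  fix g h assume g: "g \<in> carrier G" and h: "h \<in> carrier G"
  have "\<Phi> g \<in> Bij (carrier (SL_inf R))" "\<Phi> h \<in> Bij (carrier (SL_inf R))"
    using Phi_in_auto g h by (auto simp: auto_def)
  moreover have "\<Phi> (g \<otimes>\<^bsub>G\<^esub> h) = compose (carrier (SL_inf R)) (\<Phi> g) (\<Phi> h)"
  proof
    fix A show "\<Phi> (g \<otimes>\<^bsub>G\<^esub> h) A = compose (carrier (SL_inf R)) (\<Phi> g) (\<Phi> h) A"
      using Phi_mult[OF g h, of A]
      by (cases "A \<in> carrier (SL_inf R)") (auto simp: compose_def \<Phi>_def conj_by_def)
  qed
  ultimately show "\<Phi> (g \<otimes>\<^bsub>G\<^esub> h) = \<Phi> g \<otimes>\<^bsub>BijGroup (carrier (SL_inf R))\<^esub> \<Phi> h"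
    by (simp add: BijGroup_def)
next
  show "\<Phi> g \<in> carrier (BijGroup (carrier (SL_inf R)))" if "g \<in> carrier G" for g
    using Phi_in_auto[OF that] by (simp add: BijGroup_def auto_def)
qed

text \<open>An element is fixed under conjugation by the group if and only if it commutes with all matrices
  of the representation, and \<open>SL_inf\<close> is not trivial, so some element of \<open>G\<close> acts as a nontrivial
  automorphism. The inverse in \<open>AutoGroup\<close> is compared with the inverse in the group of all
  bijections by uniqueness, without the inverses of the monoid \<open>SL_inf\<close>.\<close>

theorem exists_simple_group_of_automorphisms:
  assumes fin: "finite (carrier G)"
    and dich: "\<And>N. N \<lhd> G \<Longrightarrow> N = carrier G \<or> (\<forall>g\<in>N. \<rho> g = unit_matrix R)"
    and triv: "\<And>A. A \<in> carrier (SL_inf R) \<Longrightarrow>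
      (\<And>g. g \<in> carrier G \<Longrightarrow> mprod R (\<rho> g) A = mprod R A (\<rho> g)) \<Longrightarrow> A = unit_matrix R"
  shows "\<exists>H. subgroup H (AutoGroup (SL_inf R)) \<and> finite H \<and>
           simple_group ((AutoGroup (SL_inf R))\<lparr>carrier := H\<rparr>) \<and>
           centraliser_aut (SL_inf R) H = {\<one>\<^bsub>SL_inf R\<^esub>}"
proof (intro exI conjI)
  let ?B = "BijGroup (carrier (SL_inf R))"
  let ?H = "\<Phi> ` carrier G"
  interpret B: group ?B by (rule group_BijGroup)
  interpret f: group_hom G ?B \<Phi> using Phi_in_BijGroup by unfold_locales
  have sub: "subgroup ?H ?B" by (rule f.img_is_subgroup)
  have aut: "?H \<subseteq> auto (SL_inf R)" using Phi_in_auto by blast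
  have aut_sub: "auto (SL_inf R) \<subseteq> carrier ?B" by (auto simp: auto_def BijGroup_def)
  have inv_eq: "inv\<^bsub>AutoGroup (SL_inf R)\<^esub> x = inv\<^bsub>?B\<^esub> x" if "x \<in> ?H" for x
  proof -
    have x: "x \<in> carrier ?B" "inv\<^bsub>?B\<^esub> x \<in> ?H" using that subgroup.m_inv_closed[OF sub] subgroup.subset[OF sub] by blast+
    show ?thesis
      unfolding m_inv_def[of "AutoGroup (SL_inf R)"]
    proof (rule the_equality)
      show "inv\<^bsub>?B\<^esub> x \<in> carrier (AutoGroup (SL_inf R)) \<and>
        x \<otimes>\<^bsub>AutoGroup (SL_inf R)\<^esub> inv\<^bsub>?B\<^esub> x = \<one>\<^bsub>AutoGroup (SL_inf R)\<^esub> \<and>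
        inv\<^bsub>?B\<^esub> x \<otimes>\<^bsub>AutoGroup (SL_inf R)\<^esub> x = \<one>\<^bsub>AutoGroup (SL_inf R)\<^esub>"
        using x aut B.r_inv[OF x(1)] B.l_inv[OF x(1)] by (auto simp: AutoGroup_def simp del: B.r_inv B.l_inv)
      fix y assume "y \<in> carrier (AutoGroup (SL_inf R)) \<and>
        x \<otimes>\<^bsub>AutoGroup (SL_inf R)\<^esub> y = \<one>\<^bsub>AutoGroup (SL_inf R)\<^esub> \<and>
        y \<otimes>\<^bsub>AutoGroup (SL_inf R)\<^esub> x = \<one>\<^bsub>AutoGroup (SL_inf R)\<^esub>"
      then have "y \<in> carrier ?B" "y \<otimes>\<^bsub>?B\<^esub> x = \<one>\<^bsub>?B\<^esub>"
        using aut_sub by (auto simp: AutoGroup_def)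
      then show "y = inv\<^bsub>?B\<^esub> x" using B.inv_equality x(1) by metis
    qed
  qed
  show "subgroup ?H (AutoGroup (SL_inf R))"
  proof (rule subgroup.intro)
    show "?H \<subseteq> carrier (AutoGroup (SL_inf R))" using aut by (simp add: AutoGroup_def)
    show "x \<otimes>\<^bsub>AutoGroup (SL_inf R)\<^esub> y \<in> ?H" if "x \<in> ?H" "y \<in> ?H" for x y
      using subgroup.m_closed[OF sub that] by (simp add: AutoGroup_def)
    show "\<one>\<^bsub>AutoGroup (SL_inf R)\<^esub> \<in> ?H"
      using subgroup.one_closed[OF sub] by (simp add: AutoGroup_def)
    show "inv\<^bsub>AutoGroup (SL_inf R)\<^esub> x \<in> ?H" if "x \<in> ?H" for x
      using subgroup.m_inv_closed[OF sub that] inv_eq[OF that] by simp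
  qed
  show "finite ?H" using fin by simp
  have fixed: "A = unit_matrix R" if A: "A \<in> carrier (SL_inf R)" and inv: "\<forall>g\<in>carrier G. \<Phi> g A = A" for A
  proof (rule triv[OF A])
    fix g assume g: "g \<in> carrier G"
    note rf = row_finite[OF g] row_finite[OF G.inv_closed[OF g]] row_finite_SL_inf[OF A]
    have "mprod R A (\<rho> g) = mprod R (\<Phi> g A) (\<rho> g)" using bspec[OF inv g] by simp
    also have "\<dots> = mprod R (\<rho> g) A"
      unfolding Phi_apply[OF A]
      using rf by (simp add: mprod_assoc row_finite_mprod row_finiteD rho_inv[OF g] mprod_unit_right)
    finally show "mprod R (\<rho> g) A = mprod R A (\<rho> g)" by simp
  qed
  have Phi_unit: "\<Phi> g (unit_matrix R) = unit_matrix R" if "g \<in> carrier G" for g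
    unfolding Phi_apply[OF unit_matrix_in_SL_inf]
    using mprod_unit_right[OF row_finite[OF that]] rho_inv(1)[OF that] by simp
  show "centraliser_aut (SL_inf R) ?H = {\<one>\<^bsub>SL_inf R\<^esub>}"
  proof (intro equalityI subsetI)
    fix A assume "A \<in> centraliser_aut (SL_inf R) ?H"
    then have "A = unit_matrix R" by (intro fixed) (auto simp: centraliser_aut_def)
    then show "A \<in> {\<one>\<^bsub>SL_inf R\<^esub>}" by simp
  qed (use Phi_unit unit_matrix_in_SL_inf in \<open>auto simp: centraliser_aut_def\<close>)
  have "simple_group (?B\<lparr>carrier := ?H\<rparr>)"
  proof (rule G.simple_group_quotientI)
    show "group (?B\<lparr>carrier := ?H\<rparr>)" using sub by (rule B.subgroup_imp_group)
    show "\<Phi> \<in> hom G (?B\<lparr>carrier := ?H\<rparr>)" using Phi_in_BijGroup by (auto simp: hom_def)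
    show "finite (carrier (?B\<lparr>carrier := ?H\<rparr>))" using fin by simp
    obtain A where "A \<in> carrier (SL_inf R)" "A \<noteq> unit_matrix R" using SL_inf_nontrivial by blast
    then obtain g where "g \<in> carrier G" "\<Phi> g A \<noteq> A" using fixed by blast
    then show "\<exists>g\<in>carrier G. \<Phi> g \<noteq> \<one>\<^bsub>?B\<lparr>carrier := ?H\<rparr>\<^esub>"
      using \<open>A \<in> _\<close> by (intro bexI[of _ g]) (auto simp: BijGroup_def dest: fun_cong)
    fix N assume N: "N \<lhd> G"
    have "\<Phi> g = \<one>\<^bsub>?B\<^esub>" if "g \<in> carrier G" "\<rho> g = unit_matrix R" for g
    proof -
      have "\<rho> (inv\<^bsub>G\<^esub> g) = unit_matrix R"
        using rho_inv(2)[OF that(1)] that row_finite[of "inv\<^bsub>G\<^esub> g"] by (simp add: mprod_unit_right)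
      then have "\<Phi> g = \<Phi> \<one>\<^bsub>G\<^esub>" using that rho_one by (simp add: \<Phi>_def)
      then show ?thesis by simp
    qed
    then show "N = carrier G \<or> (\<forall>g\<in>N. \<Phi> g = \<one>\<^bsub>?B\<lparr>carrier := ?H\<rparr>\<^esub>)"
      using dich[OF N] subgroup.subset[OF normal_imp_subgroup[OF N]] by auto
  qed simp
  then show "simple_group ((AutoGroup (SL_inf R))\<lparr>carrier := ?H\<rparr>)" by (simp add: AutoGroup_def)
qed

end

section \<open>The group of two by two matrices of determinant one\<close>

text \<open>Quadruples \<open>(a, b, c, d)\<close> stand for matrices with rows \<open>(a, b)\<close> and \<open>(c, d)\<close>.\<close>

definition SL2 :: "('a, 'b) ring_scheme \<Rightarrow> ('a \<times> 'a \<times> 'a \<times> 'a) monoid" where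
  "SL2 F = \<lparr>carrier = {(a, b, c, d). a \<in> carrier F \<and> b \<in> carrier F \<and> c \<in> carrier F \<and> d \<in> carrier F \<and>
       a \<otimes>\<^bsub>F\<^esub> d \<ominus>\<^bsub>F\<^esub> b \<otimes>\<^bsub>F\<^esub> c = \<one>\<^bsub>F\<^esub>},
     monoid.mult = (\<lambda>(a, b, c, d) (a', b', c', d').
       (a \<otimes>\<^bsub>F\<^esub> a' \<oplus>\<^bsub>F\<^esub> b \<otimes>\<^bsub>F\<^esub> c', a \<otimes>\<^bsub>F\<^esub> b' \<oplus>\<^bsub>F\<^esub> b \<otimes>\<^bsub>F\<^esub> d',
        c \<otimes>\<^bsub>F\<^esub> a' \<oplus>\<^bsub>F\<^esub> d \<otimes>\<^bsub>F\<^esub> c', c \<otimes>\<^bsub>F\<^esub> b' \<oplus>\<^bsub>F\<^esub> d \<otimes>\<^bsub>F\<^esub> d')),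
     one = (\<one>\<^bsub>F\<^esub>, \<zero>\<^bsub>F\<^esub>, \<zero>\<^bsub>F\<^esub>, \<one>\<^bsub>F\<^esub>)\<rparr>"

lemma finite_SL2: "finite (carrier F) \<Longrightarrow> finite (carrier (SL2 F))"
  by (rule finite_subset[of _ "carrier F \<times> carrier F \<times> carrier F \<times> carrier F"]) (auto simp: SL2_def)

context cring begin

lemma SL2_carrier_iff: "(a, b, c, d) \<in> carrier (SL2 R) \<longleftrightarrow>
    a \<in> carrier R \<and> b \<in> carrier R \<and> c \<in> carrier R \<and> d \<in> carrier R \<and> a \<otimes> d \<ominus> b \<otimes> c = \<one>"
  by (simp add: SL2_def)

lemma SL2_mult: "(a, b, c, d) \<otimes>\<^bsub>SL2 R\<^esub> (a', b', c', d') =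
   (a \<otimes> a' \<oplus> b \<otimes> c', a \<otimes> b' \<oplus> b \<otimes> d', c \<otimes> a' \<oplus> d \<otimes> c', c \<otimes> b' \<oplus> d \<otimes> d')"
  by (simp add: SL2_def)

lemma SL2_one: "\<one>\<^bsub>SL2 R\<^esub> = (\<one>, \<zero>, \<zero>, \<one>)"
  by (simp add: SL2_def)

lemma SL2_mult_closed:
  assumes "g \<in> carrier (SL2 R)" "h \<in> carrier (SL2 R)" shows "g \<otimes>\<^bsub>SL2 R\<^esub> h \<in> carrier (SL2 R)"
proof -
  obtain a b c d where g: "g = (a, b, c, d)" by (cases g)
  obtain a' b' c' d' where h: "h = (a', b', c', d')" by (cases h)
  have c: "a \<in> carrier R" "b \<in> carrier R" "c \<in> carrier R" "d \<in> carrier R"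
    "a' \<in> carrier R" "b' \<in> carrier R" "c' \<in> carrier R" "d' \<in> carrier R"
    using assms by (auto simp: g h SL2_carrier_iff)
  have "(a \<otimes> a' \<oplus> b \<otimes> c') \<otimes> (c \<otimes> b' \<oplus> d \<otimes> d') \<ominus> (a \<otimes> b' \<oplus> b \<otimes> d') \<otimes> (c \<otimes> a' \<oplus> d \<otimes> c')
      = (a \<otimes> d \<ominus> b \<otimes> c) \<otimes> (a' \<otimes> d' \<ominus> b' \<otimes> c')"
    using c by algebra
  also have "\<dots> = \<one>" using assms by (simp add: g h SL2_carrier_iff)
  finally show ?thesis using c by (simp add: g h SL2_mult SL2_carrier_iff)
qed

lemma SL2_inverse:
  assumes "(a, b, c, d) \<in> carrier (SL2 R)"
  shows "(d, \<ominus> b, \<ominus> c, a) \<in> carrier (SL2 R)" "(d, \<ominus> b, \<ominus> c, a) \<otimes>\<^bsub>SL2 R\<^esub> (a, b, c, d) = \<one>\<^bsub>SL2 R\<^esub>"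
proof -
  have c: "a \<in> carrier R" "b \<in> carrier R" "c \<in> carrier R" "d \<in> carrier R" and det: "a \<otimes> d \<ominus> b \<otimes> c = \<one>"
    using assms by (auto simp: SL2_carrier_iff)
  have "d \<otimes> a \<ominus> (\<ominus> b) \<otimes> (\<ominus> c) = a \<otimes> d \<ominus> b \<otimes> c" "d \<otimes> a \<oplus> (\<ominus> b) \<otimes> c = a \<otimes> d \<ominus> b \<otimes> c"
    "(\<ominus> c) \<otimes> b \<oplus> a \<otimes> d = a \<otimes> d \<ominus> b \<otimes> c" "d \<otimes> b \<oplus> (\<ominus> b) \<otimes> d = \<zero>" "(\<ominus> c) \<otimes> a \<oplus> a \<otimes> c = \<zero>"
    using c by algebra+
  then show "(d, \<ominus> b, \<ominus> c, a) \<in> carrier (SL2 R)" "(d, \<ominus> b, \<ominus> c, a) \<otimes>\<^bsub>SL2 R\<^esub> (a, b, c, d) = \<one>\<^bsub>SL2 R\<^esub>"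
    using c by (simp_all add: SL2_carrier_iff SL2_mult SL2_one det)
qed

lemma group_SL2: "group (SL2 R)"
proof (rule groupI)
  show "\<one>\<^bsub>SL2 R\<^esub> \<in> carrier (SL2 R)" by (simp add: SL2_one SL2_carrier_iff minus_eq)
  show "\<one>\<^bsub>SL2 R\<^esub> \<otimes>\<^bsub>SL2 R\<^esub> g = g" if "g \<in> carrier (SL2 R)" for g
    using that by (cases g) (auto simp: SL2_one SL2_mult SL2_carrier_iff)
  show "\<exists>h\<in>carrier (SL2 R). h \<otimes>\<^bsub>SL2 R\<^esub> g = \<one>\<^bsub>SL2 R\<^esub>" if "g \<in> carrier (SL2 R)" for g
    using that SL2_inverse by (cases g) blast
  show "g \<otimes>\<^bsub>SL2 R\<^esub> h \<otimes>\<^bsub>SL2 R\<^esub> k = g \<otimes>\<^bsub>SL2 R\<^esub> (h \<otimes>\<^bsub>SL2 R\<^esub> k)"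
    if "g \<in> carrier (SL2 R)" "h \<in> carrier (SL2 R)" "k \<in> carrier (SL2 R)" for g h k
    using that by (cases g; cases h; cases k) (auto simp: SL2_mult SL2_carrier_iff l_distr r_distr m_assoc a_ac)
qed (rule SL2_mult_closed)

lemma SL2_inv:
  assumes "(a, b, c, d) \<in> carrier (SL2 R)" shows "inv\<^bsub>SL2 R\<^esub> (a, b, c, d) = (d, \<ominus> b, \<ominus> c, a)"
  using group.inv_equality[OF group_SL2] SL2_inverse[OF assms] assms by metis

end

context field begin

lemma field_cancel_eq:
  assumes "c \<in> carrier R" "c \<noteq> \<zero>" "x \<in> carrier R" "y \<in> carrier R" "c \<otimes> x = c \<otimes> y" shows "x = y"
  using assms m_lcancel by metis

text \<open>The entries \<open>a\<close> and \<open>d\<close> determine \<open>x\<close> and \<open>y\<close>, and then \<open>b\<close> is correct since the determinant is one.\<close>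

lemma SL2_eq_lower_upper_product:
  assumes g: "(a, b, c, d) \<in> carrier (SL2 R)" and c0: "c \<noteq> \<zero>"
  obtains x y where "x \<in> carrier R" "y \<in> carrier R"
    "(a, b, c, d) = (\<one>, x, \<zero>, \<one>) \<otimes>\<^bsub>SL2 R\<^esub> ((\<one>, \<zero>, c, \<one>) \<otimes>\<^bsub>SL2 R\<^esub> (\<one>, y, \<zero>, \<one>))"
proof
  have cl: "a \<in> carrier R" "b \<in> carrier R" "c \<in> carrier R" "d \<in> carrier R" and det: "a \<otimes> d \<ominus> b \<otimes> c = \<one>"
    using g by (auto simp: SL2_carrier_iff)
  define e where "e = inv c"
  have e: "e \<in> carrier R" "c \<otimes> e = \<one>" using cl c0 by (auto simp: e_def field_Units)
  define x where "x = (a \<ominus> \<one>) \<otimes> e"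
  define y where "y = (d \<ominus> \<one>) \<otimes> e"
  show xc: "x \<in> carrier R" and yc: "y \<in> carrier R" using cl e by (auto simp: x_def y_def)
  have "c \<otimes> x = (c \<otimes> e) \<otimes> (a \<ominus> \<one>)" "c \<otimes> y = (c \<otimes> e) \<otimes> (d \<ominus> \<one>)"
    unfolding x_def y_def using cl e(1) by algebra+
  then have cx: "c \<otimes> x = a \<ominus> \<one>" and cy: "c \<otimes> y = d \<ominus> \<one>" using e cl by auto
  have a: "\<one> \<oplus> c \<otimes> x = a" and d: "\<one> \<oplus> c \<otimes> y = d" unfolding cx cy using cl by algebra+
  have "b = y \<oplus> x \<otimes> d"
  proof (rule field_cancel_eq[OF cl(3) c0 cl(2)])
    have "c \<otimes> (y \<oplus> x \<otimes> d) = c \<otimes> y \<oplus> (c \<otimes> x) \<otimes> d" using cl xc yc by algebra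
    also have "\<dots> = a \<otimes> d \<ominus> \<one>" unfolding cx cy using cl by algebra
    also have "\<dots> = a \<otimes> d \<ominus> (a \<otimes> d \<ominus> b \<otimes> c)" by (simp add: det)
    also have "\<dots> = c \<otimes> b" using cl by algebra
    finally show "c \<otimes> b = c \<otimes> (y \<oplus> x \<otimes> d)" by simp
  qed (use cl xc yc in auto)
  moreover have "(\<one>, x, \<zero>, \<one>) \<otimes>\<^bsub>SL2 R\<^esub> ((\<one>, \<zero>, c, \<one>) \<otimes>\<^bsub>SL2 R\<^esub> (\<one>, y, \<zero>, \<one>))
    = (\<one> \<oplus> c \<otimes> x, y \<oplus> x \<otimes> (\<one> \<oplus> c \<otimes> y), c, \<one> \<oplus> c \<otimes> y)"
    using cl xc yc by (simp add: SL2_mult m_comm a_comm)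
  ultimately show "(a, b, c, d) = (\<one>, x, \<zero>, \<one>) \<otimes>\<^bsub>SL2 R\<^esub> ((\<one>, \<zero>, c, \<one>) \<otimes>\<^bsub>SL2 R\<^esub> (\<one>, y, \<zero>, \<one>))"
    by (simp add: a d)
qed

text \<open>Conjugation with the Weyl element turns lower into upper unipotent elements, and both kinds
  together generate the group.\<close>

lemma SL2_normal_with_lower_unipotents:
  assumes N: "N \<lhd> SL2 R" and low: "\<And>x. x \<in> carrier R \<Longrightarrow> (\<one>, \<zero>, x, \<one>) \<in> N"
  shows "N = carrier (SL2 R)"
proof -
  interpret N: normal N "SL2 R" by (rule N)
  have up: "(\<one>, x, \<zero>, \<one>) \<in> N" if x: "x \<in> carrier R" for x
  proof -
    have w: "(\<zero>, \<ominus> \<one>, \<one>, \<zero>) \<in> carrier (SL2 R)" by (simp add: SL2_carrier_iff) algebra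
    have "(\<zero>, \<ominus> \<one>, \<one>, \<zero>) \<otimes>\<^bsub>SL2 R\<^esub> (\<one>, \<zero>, \<ominus> x, \<one>) \<otimes>\<^bsub>SL2 R\<^esub> inv\<^bsub>SL2 R\<^esub> (\<zero>, \<ominus> \<one>, \<one>, \<zero>) \<in> N"
      using w low x N.inv_op_closed2 by simp
    also have "(\<zero>, \<ominus> \<one>, \<one>, \<zero>) \<otimes>\<^bsub>SL2 R\<^esub> (\<one>, \<zero>, \<ominus> x, \<one>) \<otimes>\<^bsub>SL2 R\<^esub> inv\<^bsub>SL2 R\<^esub> (\<zero>, \<ominus> \<one>, \<one>, \<zero>) = (\<one>, x, \<zero>, \<one>)"
      unfolding SL2_inv[OF w] using x by (simp add: SL2_mult l_minus r_minus)
    finally show ?thesis .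
  qed
  have lower_entry: "(a, b, c, d) \<in> N" if g: "(a, b, c, d) \<in> carrier (SL2 R)" "c \<noteq> \<zero>" for a b c d
  proof -
    obtain x y where "x \<in> carrier R" "y \<in> carrier R"
      "(a, b, c, d) = (\<one>, x, \<zero>, \<one>) \<otimes>\<^bsub>SL2 R\<^esub> ((\<one>, \<zero>, c, \<one>) \<otimes>\<^bsub>SL2 R\<^esub> (\<one>, y, \<zero>, \<one>))"
      using SL2_eq_lower_upper_product[OF g] by blast
    moreover have "c \<in> carrier R" using g by (simp add: SL2_carrier_iff)
    ultimately show ?thesis using low up by simp
  qed
  have "g \<in> N" if g: "g \<in> carrier (SL2 R)" for g
  proof -
    obtain a b c d where g_eq: "g = (a, b, c, d)" by (cases g)
    show ?thesis
    proof (cases "c = \<zero>")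
      case True
      have cl: "a \<in> carrier R" "b \<in> carrier R" "d \<in> carrier R" and det: "a \<otimes> d = \<one>"
        using g True by (auto simp: g_eq SL2_carrier_iff minus_eq)
      then have d: "d \<noteq> \<zero>" by auto
      have l: "(\<one>, \<zero>, \<one>, \<one>) \<in> carrier (SL2 R)" using low[of \<one>] by auto
      have "g \<otimes>\<^bsub>SL2 R\<^esub> (\<one>, \<zero>, \<one>, \<one>) = (a \<oplus> b, b, d, d)"
        using cl by (simp add: g_eq True SL2_mult)
      then have "(a \<oplus> b, b, d, d) \<in> N"
        using lower_entry[of "a \<oplus> b" b d d] d N.m_closed[OF g l] by simp
      then have "(a \<oplus> b, b, d, d) \<otimes>\<^bsub>SL2 R\<^esub> (\<one>, \<zero>, \<ominus> \<one>, \<one>) \<in> N" using low[of "\<ominus> \<one>"] by simp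
      also have "(a \<oplus> b, b, d, d) \<otimes>\<^bsub>SL2 R\<^esub> (\<one>, \<zero>, \<ominus> \<one>, \<one>) = g"
      proof -
        have "a \<oplus> b \<oplus> b \<otimes> (\<ominus> \<one>) = a" "d \<oplus> d \<otimes> (\<ominus> \<one>) = \<zero>" using cl by algebra+
        then show ?thesis using cl by (simp add: g_eq True SL2_mult)
      qed
      finally show ?thesis .
    qed (use lower_entry g g_eq in auto)
  qed
  then show ?thesis using N.subset by blast
qed

end

context field begin

text \<open>If \<open>c = 0\<close>, conjugation with the Weyl element moves \<open>b\<close> to the lower left corner, and if also
  \<open>b = 0\<close>, conjugation with a lower unipotent element produces \<open>a - d\<close> there.\<close>

lemma SL2_normal_nonzero_lower_entry:
  assumes N: "N \<lhd> SL2 R" and g: "(a, b, c, d) \<in> N" and nonscalar: "\<not> (b = \<zero> \<and> c = \<zero> \<and> a = d)"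
  shows "\<exists>a b c d. (a, b, c, d) \<in> N \<and> c \<noteq> \<zero>"
proof -
  interpret N: normal N "SL2 R" by (rule N)
  have cl: "a \<in> carrier R" "b \<in> carrier R" "c \<in> carrier R" "d \<in> carrier R"
    using N.mem_carrier[OF g] by (auto simp: SL2_carrier_iff)
  consider "c \<noteq> \<zero>" | "c = \<zero>" "b \<noteq> \<zero>" | "c = \<zero>" "b = \<zero>" "a \<noteq> d" using nonscalar by blast
  then show ?thesis
  proof cases
    case 1 then show ?thesis using g by blast
  next
    case 2
    have w: "(\<zero>, \<ominus> \<one>, \<one>, \<zero>) \<in> carrier (SL2 R)" by (simp add: SL2_carrier_iff) algebra
    have "(\<zero>, \<ominus> \<one>, \<one>, \<zero>) \<otimes>\<^bsub>SL2 R\<^esub> (a, b, c, d) \<otimes>\<^bsub>SL2 R\<^esub> inv\<^bsub>SL2 R\<^esub> (\<zero>, \<ominus> \<one>, \<one>, \<zero>) \<in> N"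
      using w g N.inv_op_closed2 by simp
    also have "(\<zero>, \<ominus> \<one>, \<one>, \<zero>) \<otimes>\<^bsub>SL2 R\<^esub> (a, b, c, d) \<otimes>\<^bsub>SL2 R\<^esub> inv\<^bsub>SL2 R\<^esub> (\<zero>, \<ominus> \<one>, \<one>, \<zero>) = (d, \<ominus> c, \<ominus> b, a)"
      unfolding SL2_inv[OF w] using cl by (simp add: SL2_mult l_minus r_minus)
    finally show ?thesis using 2 cl by (metis a_inv_closed minus_minus minus_zero)
  next
    case 3
    have l: "(\<one>, \<zero>, \<one>, \<one>) \<in> carrier (SL2 R)" by (simp add: SL2_carrier_iff) algebra
    have "(\<one>, \<zero>, \<one>, \<one>) \<otimes>\<^bsub>SL2 R\<^esub> (a, b, c, d) \<otimes>\<^bsub>SL2 R\<^esub> inv\<^bsub>SL2 R\<^esub> (\<one>, \<zero>, \<one>, \<one>) \<in> N"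
      using l g N.inv_op_closed2 by simp
    also have "(\<one>, \<zero>, \<one>, \<one>) \<otimes>\<^bsub>SL2 R\<^esub> (a, b, c, d) \<otimes>\<^bsub>SL2 R\<^esub> inv\<^bsub>SL2 R\<^esub> (\<one>, \<zero>, \<one>, \<one>) = (a, \<zero>, a \<ominus> d, d)"
      unfolding SL2_inv[OF l] using cl 3 by (simp add: SL2_mult r_minus minus_eq)
    finally show ?thesis using 3 cl r_right_minus_eq by blast
  qed
qed

text \<open>A conjugate of the given element has upper left entry zero. Its commutator with
  \<open>diag(s, 1/s)\<close> is lower triangular with diagonal \<open>s ^ 2\<close>, \<open>1 / s ^ 2\<close>, and the commutator of this one
  with the lower unipotent element with entry \<open>x\<close> is the lower unipotent element with entry
  \<open>(1 / s ^ 4 - 1) x\<close>. Here \<open>s ^ 4 \<noteq> 1\<close> makes every entry \<open>y\<close> possible.\<close>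

lemma SL2_normal_contains_lower_unipotents:
  assumes N: "N \<lhd> SL2 R" and g: "(a, b, c, d) \<in> N" and c0: "c \<noteq> \<zero>"
    and s: "s \<in> carrier R" "s \<noteq> \<zero>" "s [^] (4::nat) \<noteq> \<one>" and y: "y \<in> carrier R"
  shows "(\<one>, \<zero>, y, \<one>) \<in> N"
proof -
  interpret N: normal N "SL2 R" by (rule N)
  have cl: "a \<in> carrier R" "b \<in> carrier R" "c \<in> carrier R" "d \<in> carrier R"
    using N.mem_carrier[OF g] by (auto simp: SL2_carrier_iff)
  define e where "e = inv c"
  have e: "e \<in> carrier R" "c \<otimes> e = \<one>" using cl c0 by (auto simp: e_def field_Units)
  define t where "t = inv s"
  have t: "t \<in> carrier R" "s \<otimes> t = \<one>" using s by (auto simp: t_def field_Units)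
  have "\<exists>b d. (\<zero>, b, c, d) \<in> N"
  proof -
    define x where "x = \<ominus> (a \<otimes> e)"
    have x: "x \<in> carrier R" using cl e by (simp add: x_def)
    have u: "(\<one>, x, \<zero>, \<one>) \<in> carrier (SL2 R)" using x by (simp add: SL2_carrier_iff) algebra
    have "(\<one>, x, \<zero>, \<one>) \<otimes>\<^bsub>SL2 R\<^esub> (a, b, c, d) \<otimes>\<^bsub>SL2 R\<^esub> inv\<^bsub>SL2 R\<^esub> (\<one>, x, \<zero>, \<one>) \<in> N"
      using u g N.inv_op_closed2 by simp
    moreover have "\<exists>b' d'. (\<one>, x, \<zero>, \<one>) \<otimes>\<^bsub>SL2 R\<^esub> (a, b, c, d) \<otimes>\<^bsub>SL2 R\<^esub> inv\<^bsub>SL2 R\<^esub> (\<one>, x, \<zero>, \<one>) = (a \<oplus> x \<otimes> c, b', c, d')"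
      unfolding SL2_inv[OF u] using cl x by (simp add: SL2_mult)
    moreover have "a \<oplus> x \<otimes> c = \<zero>"
    proof -
      have "a \<oplus> x \<otimes> c = a \<ominus> a \<otimes> (c \<otimes> e)" unfolding x_def using cl e(1) by algebra
      then show ?thesis using cl by (simp add: e minus_eq r_neg)
    qed
    ultimately show ?thesis by metis
  qed
  then obtain b d where g: "(\<zero>, b, c, d) \<in> N" by blast
  have gc: "(\<zero>, b, c, d) \<in> carrier (SL2 R)" using N.mem_carrier[OF g] .
  then have cl: "b \<in> carrier R" "c \<in> carrier R" "d \<in> carrier R" and "\<zero> \<otimes> d \<ominus> b \<otimes> c = \<one>"
    by (auto simp: SL2_carrier_iff)
  then have bc: "\<ominus> (b \<otimes> c) = \<one>" by (simp add: minus_eq)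
  have h: "(s, \<zero>, \<zero>, t) \<in> carrier (SL2 R)" using s t by (simp add: SL2_carrier_iff minus_eq)
  define m where "m = (t \<otimes> t) \<otimes> (c \<otimes> d) \<ominus> d \<otimes> c"
  define S T where "S = s \<otimes> s" and "T = t \<otimes> t"
  have ST: "S \<in> carrier R" "T \<in> carrier R" using s t by (auto simp: S_def T_def)
  have ST1: "S \<otimes> T = \<one>"
  proof -
    have "S \<otimes> T = (s \<otimes> t) \<otimes> (s \<otimes> t)" unfolding S_def T_def using s(1) t(1) by algebra
    then show ?thesis by (simp add: t)
  qed
  have m: "m \<in> carrier R" using cl s t by (simp add: m_def)
  have M: "(S, \<zero>, m, T) \<in> N"
  proof -
    have "((s, \<zero>, \<zero>, t) \<otimes>\<^bsub>SL2 R\<^esub> (\<zero>, b, c, d) \<otimes>\<^bsub>SL2 R\<^esub> inv\<^bsub>SL2 R\<^esub> (s, \<zero>, \<zero>, t)) \<otimes>\<^bsub>SL2 R\<^esub> inv\<^bsub>SL2 R\<^esub> (\<zero>, b, c, d) \<in> N"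
      using h g N.inv_op_closed2 by simp
    also have "((s, \<zero>, \<zero>, t) \<otimes>\<^bsub>SL2 R\<^esub> (\<zero>, b, c, d) \<otimes>\<^bsub>SL2 R\<^esub> inv\<^bsub>SL2 R\<^esub> (s, \<zero>, \<zero>, t)) \<otimes>\<^bsub>SL2 R\<^esub> inv\<^bsub>SL2 R\<^esub> (\<zero>, b, c, d)
       = ((s \<otimes> b \<otimes> s) \<otimes> (\<ominus> c), \<zero>, (t \<otimes> c \<otimes> t) \<otimes> d \<oplus> (t \<otimes> d \<otimes> s) \<otimes> (\<ominus> c), (t \<otimes> c \<otimes> t) \<otimes> (\<ominus> b))"
      unfolding SL2_inv[OF h] SL2_inv[OF gc] using cl s t by (simp add: SL2_mult)
    also have "(s \<otimes> b \<otimes> s) \<otimes> (\<ominus> c) = (s \<otimes> s) \<otimes> (\<ominus> (b \<otimes> c))" using cl s(1) by algebra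
    also have "(t \<otimes> c \<otimes> t) \<otimes> (\<ominus> b) = (t \<otimes> t) \<otimes> (\<ominus> (b \<otimes> c))" using cl t(1) by algebra
    also have "(t \<otimes> c \<otimes> t) \<otimes> d \<oplus> (t \<otimes> d \<otimes> s) \<otimes> (\<ominus> c) = (t \<otimes> t) \<otimes> (c \<otimes> d) \<ominus> (s \<otimes> t) \<otimes> (d \<otimes> c)"
      using cl s(1) t(1) by algebra
    finally show ?thesis using s t cl by (simp add: bc m_def S_def T_def)
  qed
  have Mc: "(S, \<zero>, m, T) \<in> carrier (SL2 R)" using N.mem_carrier[OF M] .
  \<comment> \<open>\<open>S\<close> and \<open>T\<close> are \<open>s ^ 2\<close> and its inverse, so \<open>T ^ 2 = 1\<close> would imply \<open>s ^ 4 = 1\<close>.\<close>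
  have diff: "T \<otimes> T \<ominus> \<one> \<noteq> \<zero>"
  proof
    assume "T \<otimes> T \<ominus> \<one> = \<zero>"
    then have "T \<otimes> T = \<one>" using ST r_right_minus_eq by blast
    have "s [^] (4::nat) = S \<otimes> S" using s by (simp add: S_def numeral_eq_Suc m_assoc)
    also have "\<dots> = (S \<otimes> S) \<otimes> (T \<otimes> T)" using \<open>T \<otimes> T = \<one>\<close> ST by simp
    also have "\<dots> = (S \<otimes> T) \<otimes> (S \<otimes> T)" using ST by algebra
    finally show False using s(3) ST1 by simp
  qed
  define f where "f = inv (T \<otimes> T \<ominus> \<one>)"
  have f: "f \<in> carrier R" "(T \<otimes> T \<ominus> \<one>) \<otimes> f = \<one>" using ST diff by (auto simp: f_def field_Units)
  define x where "x = y \<otimes> f"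
  have x: "x \<in> carrier R" using y f by (simp add: x_def)
  have l: "(\<one>, \<zero>, x, \<one>) \<in> carrier (SL2 R)" using x by (simp add: SL2_carrier_iff) algebra
  have "(S, \<zero>, m, T) \<otimes>\<^bsub>SL2 R\<^esub> ((\<one>, \<zero>, x, \<one>) \<otimes>\<^bsub>SL2 R\<^esub> inv\<^bsub>SL2 R\<^esub> (S, \<zero>, m, T) \<otimes>\<^bsub>SL2 R\<^esub> inv\<^bsub>SL2 R\<^esub> (\<one>, \<zero>, x, \<one>)) \<in> N"
    using l M N.inv_op_closed2 by simp
  also have "(S, \<zero>, m, T) \<otimes>\<^bsub>SL2 R\<^esub> ((\<one>, \<zero>, x, \<one>) \<otimes>\<^bsub>SL2 R\<^esub> inv\<^bsub>SL2 R\<^esub> (S, \<zero>, m, T) \<otimes>\<^bsub>SL2 R\<^esub> inv\<^bsub>SL2 R\<^esub> (\<one>, \<zero>, x, \<one>))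
      = (S \<otimes> T, \<zero>, m \<otimes> T \<oplus> T \<otimes> (x \<otimes> T \<oplus> \<ominus> m \<oplus> S \<otimes> (\<ominus> x)), T \<otimes> S)"
    unfolding SL2_inv[OF l] SL2_inv[OF Mc] using x m ST by (simp add: SL2_mult)
  also have "m \<otimes> T \<oplus> T \<otimes> (x \<otimes> T \<oplus> \<ominus> m \<oplus> S \<otimes> (\<ominus> x)) = x \<otimes> (T \<otimes> T) \<ominus> x \<otimes> (S \<otimes> T)"
    using x m ST by algebra
  also have "\<dots> = x \<otimes> (T \<otimes> T \<ominus> \<one>)" unfolding ST1 using x ST by algebra
  also have "\<dots> = y \<otimes> ((T \<otimes> T \<ominus> \<one>) \<otimes> f)" unfolding x_def using y f(1) ST by algebra
  finally show ?thesis using y ST ST1 by (simp add: f m_comm[of T S])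
qed

text \<open>This is the simplicity of \<open>PSL(2)\<close> over the field, in a form that avoids the quotient.\<close>

lemma SL2_normal_dichotomy:
  assumes N: "N \<lhd> SL2 R" and s: "s \<in> carrier R" "s \<noteq> \<zero>" "s [^] (4::nat) \<noteq> \<one>"
  shows "N = carrier (SL2 R) \<or> (\<forall>g\<in>N. \<exists>a. g = (a, \<zero>, \<zero>, a) \<and> a \<in> carrier R \<and> a \<otimes> a = \<one>)"
proof (cases "\<exists>a b c d. (a, b, c, d) \<in> N \<and> \<not> (b = \<zero> \<and> c = \<zero> \<and> a = d)")
  case True
  then obtain a b c d where "(a, b, c, d) \<in> N" "c \<noteq> \<zero>"
    using SL2_normal_nonzero_lower_entry[OF N] by blast
  then show ?thesis
    using SL2_normal_with_lower_unipotents[OF N] SL2_normal_contains_lower_unipotents[OF N _ _ s] by blast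
next
  case False
  have "\<exists>a. g = (a, \<zero>, \<zero>, a) \<and> a \<in> carrier R \<and> a \<otimes> a = \<one>" if g: "g \<in> N" for g
  proof -
    have "g \<in> carrier (SL2 R)" using g normal_imp_subgroup[OF N] subgroup.mem_carrier by metis
    obtain a b c d where g_eq: "g = (a, b, c, d)" by (cases g)
    then have "b = \<zero>" "c = \<zero>" "d = a" using g False by blast+
    then show ?thesis using \<open>g \<in> carrier (SL2 R)\<close> by (auto simp: g_eq SL2_carrier_iff minus_eq)
  qed
  then show ?thesis by blast
qed

end

section \<open>Induced representations\<close>

text \<open>Induction from a subgroup \<open>B\<close> with transversal \<open>T\<close> to \<open>G\<close>, in coordinates. The basis of the induced
  module is \<open>T \<times> UNIV\<close>, where the type \<open>'i\<close> is the basis of the module for \<open>B\<close>, and \<open>e\<close> numbers it by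
  natural numbers, because the matrices of \<open>SL_inf\<close> have index set \<open>nat\<close>.\<close>

locale induced_representation = ring R + G: group G
  for R :: "('a, 'm) ring_scheme" (structure) and G :: "('g, 'n) monoid_scheme" +
  fixes B T :: "'g set" and Y :: "'g \<Rightarrow> 'i \<Rightarrow> 'i \<Rightarrow> 'a" and e :: "nat \<Rightarrow> 'g \<times> 'i"
  assumes B: "subgroup B G"
    and T: "T \<subseteq> carrier G"
    and transversal: "g \<in> carrier G \<Longrightarrow> \<exists>!r. r \<in> T \<and> inv\<^bsub>G\<^esub> r \<otimes>\<^bsub>G\<^esub> g \<in> B"
    and Y_row_finite: "b \<in> B \<Longrightarrow> row_finite R (Y b)"
    and Y_col_finite: "b \<in> B \<Longrightarrow> col_finite R (Y b)"
    and Y_one: "Y \<one>\<^bsub>G\<^esub> = unit_matrix R"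
    and Y_mult: "b \<in> B \<Longrightarrow> b' \<in> B \<Longrightarrow> Y (b \<otimes>\<^bsub>G\<^esub> b') = mprod R (Y b) (Y b')"
    and e: "bij_betw e UNIV (T \<times> UNIV)"
begin

definition coset_rep :: "nat \<Rightarrow> 'g" where "coset_rep i = fst (e i)"
definition vec_index :: "nat \<Rightarrow> 'i" where "vec_index i = snd (e i)"
definition index :: "'g \<Rightarrow> 'i \<Rightarrow> nat" where "index r \<iota> = inv_into UNIV e (r, \<iota>)"

definition \<rho> :: "'g \<Rightarrow> nat \<Rightarrow> nat \<Rightarrow> 'a" where
  "\<rho> g i j = (if inv\<^bsub>G\<^esub> coset_rep i \<otimes>\<^bsub>G\<^esub> g \<otimes>\<^bsub>G\<^esub> coset_rep j \<in> B
     then Y (inv\<^bsub>G\<^esub> coset_rep i \<otimes>\<^bsub>G\<^esub> g \<otimes>\<^bsub>G\<^esub> coset_rep j) (vec_index i) (vec_index j) else \<zero>)"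

lemma coset_rep_in_T [simp]: "coset_rep i \<in> T"
proof -
  have "e i \<in> T \<times> UNIV" using bij_betwE[OF e] by blast
  then show ?thesis by (simp add: coset_rep_def mem_Times_iff)
qed

lemma coset_rep_closed [simp]: "coset_rep i \<in> carrier G"
  using coset_rep_in_T T by blast

lemma coset_rep_index [simp]: "r \<in> T \<Longrightarrow> coset_rep (index r \<iota>) = r" "r \<in> T \<Longrightarrow> vec_index (index r \<iota>) = \<iota>"
  using e by (auto simp: coset_rep_def vec_index_def index_def f_inv_into_f bij_betw_def)

lemma index_coset_rep_vec_index [simp]: "index (coset_rep i) (vec_index i) = i"
  using e by (simp add: coset_rep_def vec_index_def index_def bij_betw_def)

lemma index_eq_iff [simp]: "r \<in> T \<Longrightarrow> index r \<iota> = index r \<kappa> \<longleftrightarrow> \<iota> = \<kappa>"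
  by (metis coset_rep_index(2))

lemma B_closed: "b \<in> B \<Longrightarrow> b \<in> carrier G"
  using B subgroup.mem_carrier by metis

lemma unique_coset_rep:
  assumes "g \<in> carrier G" "r \<in> T" "r' \<in> T" "inv\<^bsub>G\<^esub> r \<otimes>\<^bsub>G\<^esub> g \<in> B" "inv\<^bsub>G\<^esub> r' \<otimes>\<^bsub>G\<^esub> g \<in> B"
  shows "r = r'"
  using transversal[OF assms(1)] assms by blast

lemma unique_coset_rep_left:
  assumes "g \<in> carrier G" "q \<in> T" "r \<in> T" "r' \<in> T"
    "inv\<^bsub>G\<^esub> r \<otimes>\<^bsub>G\<^esub> g \<otimes>\<^bsub>G\<^esub> q \<in> B" "inv\<^bsub>G\<^esub> r' \<otimes>\<^bsub>G\<^esub> g \<otimes>\<^bsub>G\<^esub> q \<in> B"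
  shows "r = r'"
proof -
  have "r \<in> carrier G" "r' \<in> carrier G" "q \<in> carrier G" using T assms by auto
  then show ?thesis using unique_coset_rep[of "g \<otimes>\<^bsub>G\<^esub> q" r r'] assms by (simp add: G.m_assoc)
qed

lemma unique_coset_rep_right:
  assumes "g \<in> carrier G" "q \<in> T" "r \<in> T" "r' \<in> T"
    "inv\<^bsub>G\<^esub> q \<otimes>\<^bsub>G\<^esub> g \<otimes>\<^bsub>G\<^esub> r \<in> B" "inv\<^bsub>G\<^esub> q \<otimes>\<^bsub>G\<^esub> g \<otimes>\<^bsub>G\<^esub> r' \<in> B"
  shows "r = r'"
proof -
  have c: "r \<in> carrier G" "r' \<in> carrier G" "q \<in> carrier G" using T assms by auto
  have "inv\<^bsub>G\<^esub> (inv\<^bsub>G\<^esub> q \<otimes>\<^bsub>G\<^esub> g \<otimes>\<^bsub>G\<^esub> r) \<in> B" "inv\<^bsub>G\<^esub> (inv\<^bsub>G\<^esub> q \<otimes>\<^bsub>G\<^esub> g \<otimes>\<^bsub>G\<^esub> r') \<in> B"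
    using assms(5,6) subgroup.m_inv_closed[OF B] by auto
  then show ?thesis
    using unique_coset_rep_left[of "inv\<^bsub>G\<^esub> g" q r r'] assms(1-4) c by (simp add: G.inv_mult_group G.m_assoc)
qed

lemma rho_closed: "g \<in> carrier G \<Longrightarrow> \<rho> g i j \<in> carrier R"
  using row_finiteD(1)[OF Y_row_finite] by (simp add: \<rho>_def)

lemma rho_nonzeroD:
  assumes "\<rho> g i j \<noteq> \<zero>" shows "inv\<^bsub>G\<^esub> coset_rep i \<otimes>\<^bsub>G\<^esub> g \<otimes>\<^bsub>G\<^esub> coset_rep j \<in> B"
    "Y (inv\<^bsub>G\<^esub> coset_rep i \<otimes>\<^bsub>G\<^esub> g \<otimes>\<^bsub>G\<^esub> coset_rep j) (vec_index i) (vec_index j) \<noteq> \<zero>"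
  using assms by (auto simp: \<rho>_def split: if_splits)

lemma row_finite_rho:
  assumes g: "g \<in> carrier G" shows "row_finite R (\<rho> g)"
  unfolding row_finite_def
proof (intro conjI allI rho_closed g)
  fix i
  show "finite {j. \<rho> g i j \<noteq> \<zero>}"
  proof (cases "\<exists>l. inv\<^bsub>G\<^esub> coset_rep i \<otimes>\<^bsub>G\<^esub> g \<otimes>\<^bsub>G\<^esub> coset_rep l \<in> B")
    case True
    then obtain l where l: "inv\<^bsub>G\<^esub> coset_rep i \<otimes>\<^bsub>G\<^esub> g \<otimes>\<^bsub>G\<^esub> coset_rep l \<in> B" by blast
    have "{j. \<rho> g i j \<noteq> \<zero>} \<subseteq> index (coset_rep l) ` {\<kappa>. Y (inv\<^bsub>G\<^esub> coset_rep i \<otimes>\<^bsub>G\<^esub> g \<otimes>\<^bsub>G\<^esub> coset_rep l) (vec_index i) \<kappa> \<noteq> \<zero>}"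
    proof
      fix j assume "j \<in> {j. \<rho> g i j \<noteq> \<zero>}"
      then have j: "\<rho> g i j \<noteq> \<zero>" by simp
      have "coset_rep j = coset_rep l"
        using unique_coset_rep_right[OF g _ _ _ rho_nonzeroD(1)[OF j] l] by simp
      then show "j \<in> index (coset_rep l) ` {\<kappa>. Y (inv\<^bsub>G\<^esub> coset_rep i \<otimes>\<^bsub>G\<^esub> g \<otimes>\<^bsub>G\<^esub> coset_rep l) (vec_index i) \<kappa> \<noteq> \<zero>}"
        using rho_nonzeroD(2)[OF j] by (intro image_eqI[of _ _ "vec_index j"]) (auto, metis index_coset_rep_vec_index)
    qed
    then show ?thesis using row_finiteD(2)[OF Y_row_finite[OF l]] finite_surj by blast
  qed (simp add: \<rho>_def)
qed

lemma col_finite_rho: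
  assumes g: "g \<in> carrier G" shows "col_finite R (\<rho> g)"
  unfolding col_finite_def
proof (intro conjI allI rho_closed g)
  fix j
  show "finite {i. \<rho> g i j \<noteq> \<zero>}"
  proof (cases "\<exists>l. inv\<^bsub>G\<^esub> coset_rep l \<otimes>\<^bsub>G\<^esub> g \<otimes>\<^bsub>G\<^esub> coset_rep j \<in> B")
    case True
    then obtain l where l: "inv\<^bsub>G\<^esub> coset_rep l \<otimes>\<^bsub>G\<^esub> g \<otimes>\<^bsub>G\<^esub> coset_rep j \<in> B" by blast
    have "{i. \<rho> g i j \<noteq> \<zero>} \<subseteq> index (coset_rep l) ` {\<iota>. Y (inv\<^bsub>G\<^esub> coset_rep l \<otimes>\<^bsub>G\<^esub> g \<otimes>\<^bsub>G\<^esub> coset_rep j) \<iota> (vec_index j) \<noteq> \<zero>}"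
    proof
      fix i assume "i \<in> {i. \<rho> g i j \<noteq> \<zero>}"
      then have i: "\<rho> g i j \<noteq> \<zero>" by simp
      have "coset_rep i = coset_rep l"
        using unique_coset_rep_left[OF g _ _ _ rho_nonzeroD(1)[OF i] l] by simp
      then show "i \<in> index (coset_rep l) ` {\<iota>. Y (inv\<^bsub>G\<^esub> coset_rep l \<otimes>\<^bsub>G\<^esub> g \<otimes>\<^bsub>G\<^esub> coset_rep j) \<iota> (vec_index j) \<noteq> \<zero>}"
        using rho_nonzeroD(2)[OF i] by (intro image_eqI[of _ _ "vec_index i"]) (auto, metis index_coset_rep_vec_index)
    qed
    moreover have "finite {\<iota>. Y (inv\<^bsub>G\<^esub> coset_rep l \<otimes>\<^bsub>G\<^esub> g \<otimes>\<^bsub>G\<^esub> coset_rep j) \<iota> (vec_index j) \<noteq> \<zero>}"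
      using Y_col_finite[OF l] by (simp add: col_finite_def)
    ultimately show ?thesis using finite_surj by blast
  qed (simp add: \<rho>_def)
qed

lemma finsum_index:
  assumes r: "r \<in> T" and f: "\<And>k. f k \<in> carrier R"
  shows "(\<Oplus>k\<in>index r ` S. f k) = (\<Oplus>\<kappa>\<in>S. f (index r \<kappa>))"
  by (rule finsum_reindex) (use r f in \<open>auto simp: inj_on_def\<close>)

text \<open>In row \<open>i\<close> of \<open>\<rho> g\<close> only one coset contributes and in column \<open>j\<close> of \<open>\<rho> h\<close> also only one. If they agree,
  the sum is an entry of a product of two matrices of \<open>Y\<close>, and otherwise both sides vanish.\<close>

lemma rho_mult:
  assumes g: "g \<in> carrier G" and h: "h \<in> carrier G"
  shows "\<rho> (g \<otimes>\<^bsub>G\<^esub> h) = mprod R (\<rho> g) (\<rho> h)"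
proof (intro ext)
  fix i j
  obtain r where r: "r \<in> T" "inv\<^bsub>G\<^esub> r \<otimes>\<^bsub>G\<^esub> (h \<otimes>\<^bsub>G\<^esub> coset_rep j) \<in> B"
    using transversal[of "h \<otimes>\<^bsub>G\<^esub> coset_rep j"] h by auto
  have rc: "r \<in> carrier G" using r T by auto
  define b b' where "b = inv\<^bsub>G\<^esub> coset_rep i \<otimes>\<^bsub>G\<^esub> g \<otimes>\<^bsub>G\<^esub> r" and "b' = inv\<^bsub>G\<^esub> r \<otimes>\<^bsub>G\<^esub> h \<otimes>\<^bsub>G\<^esub> coset_rep j"
  have b': "b' \<in> B" using r rc h by (simp add: b'_def G.m_assoc)
  have bc: "b \<in> carrier G" "b' \<in> carrier G" using rc g h by (auto simp: b_def b'_def)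
  have prod: "inv\<^bsub>G\<^esub> coset_rep i \<otimes>\<^bsub>G\<^esub> (g \<otimes>\<^bsub>G\<^esub> h) \<otimes>\<^bsub>G\<^esub> coset_rep j = b \<otimes>\<^bsub>G\<^esub> b'"
  proof -
    have "r \<otimes>\<^bsub>G\<^esub> (inv\<^bsub>G\<^esub> r \<otimes>\<^bsub>G\<^esub> (h \<otimes>\<^bsub>G\<^esub> coset_rep j)) = h \<otimes>\<^bsub>G\<^esub> coset_rep j"
      using rc h by (simp add: G.m_assoc[symmetric])
    then show ?thesis using g h rc by (simp add: b_def b'_def G.m_assoc)
  qed
  have h0: "coset_rep k = r" if "\<rho> h k j \<noteq> \<zero>" for k
    using unique_coset_rep_left[OF h _ _ _ rho_nonzeroD(1)[OF that], of r] b' r by (simp add: b'_def)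
  show "\<rho> (g \<otimes>\<^bsub>G\<^esub> h) i j = mprod R (\<rho> g) (\<rho> h) i j"
  proof (cases "b \<in> B")
    case True
    note y = row_finiteD[OF Y_row_finite[OF True]] and y' = row_finiteD[OF Y_row_finite[OF b']]
    let ?S = "{\<kappa>. Y b (vec_index i) \<kappa> \<noteq> \<zero>}"
    have "mprod R (\<rho> g) (\<rho> h) i j = (\<Oplus>k\<in>index r ` ?S. \<rho> g i k \<otimes> \<rho> h k j)"
    proof (rule mprod_eq_finsum_right[OF row_finite_rho[OF g]])
      fix k assume k: "k \<notin> index r ` ?S" "\<rho> g i k \<noteq> \<zero>"
      show "\<rho> h k j = \<zero>"
      proof (rule ccontr)
        assume "\<rho> h k j \<noteq> \<zero>"
        then have "coset_rep k = r" by (rule h0)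
        then have "vec_index k \<in> ?S" "index r (vec_index k) = k" using rho_nonzeroD(2)[OF k(2)] by (auto simp: b_def)
        then show False using k(1) by force
      qed
    qed (use y h rho_closed in auto)
    also have "\<dots> = (\<Oplus>\<kappa>\<in>?S. \<rho> g i (index r \<kappa>) \<otimes> \<rho> h (index r \<kappa>) j)"
      by (rule finsum_index) (use r g h rho_closed in auto)
    also have "\<dots> = (\<Oplus>\<kappa>\<in>?S. Y b (vec_index i) \<kappa> \<otimes> Y b' \<kappa> (vec_index j))"
      using True b' r(1) y y' by (intro finsum_cong') (auto simp: \<rho>_def b_def[symmetric] b'_def[symmetric])
    also have "\<dots> = mprod R (Y b) (Y b') (vec_index i) (vec_index j)" by (simp add: mprod_def)
    also have "\<dots> = \<rho> (g \<otimes>\<^bsub>G\<^esub> h) i j"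
      using Y_mult[OF True b'] subgroup.m_closed[OF B True b'] by (simp add: \<rho>_def prod)
    finally show ?thesis by simp
  next
    case False
    have "b \<otimes>\<^bsub>G\<^esub> b' \<notin> B"
    proof
      assume "b \<otimes>\<^bsub>G\<^esub> b' \<in> B"
      then have "b \<otimes>\<^bsub>G\<^esub> b' \<otimes>\<^bsub>G\<^esub> inv\<^bsub>G\<^esub> b' \<in> B"
        using subgroup.m_closed[OF B] subgroup.m_inv_closed[OF B] b' by blast
      then show False using False bc by (simp add: G.m_assoc)
    qed
    then have "\<rho> (g \<otimes>\<^bsub>G\<^esub> h) i j = \<zero>" by (simp add: \<rho>_def prod)
    moreover have "mprod R (\<rho> g) (\<rho> h) i j = \<zero>"
    proof (rule mprod_eq_zero)
      fix k assume k: "\<rho> g i k \<noteq> \<zero>"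
      show "\<rho> h k j = \<zero>"
      proof (rule ccontr)
        assume "\<rho> h k j \<noteq> \<zero>"
        then have "coset_rep k = r" by (rule h0)
        then show False using rho_nonzeroD(1)[OF k] False by (simp add: b_def)
      qed
    qed (use g rho_closed in auto)
    ultimately show ?thesis by simp
  qed
qed

text \<open>A central element of \<open>B\<close> permutes no cosets, so it acts on the induced module as on each copy of
  the original one.\<close>

lemma rho_central:
  assumes b: "b \<in> B" "Y b = unit_matrix R" and central: "\<And>g. g \<in> carrier G \<Longrightarrow> b \<otimes>\<^bsub>G\<^esub> g = g \<otimes>\<^bsub>G\<^esub> b"
  shows "\<rho> b = unit_matrix R"
proof (intro ext)
  fix i j
  have bc: "b \<in> carrier G" using b B_closed by auto
  have "inv\<^bsub>G\<^esub> coset_rep i \<otimes>\<^bsub>G\<^esub> b \<otimes>\<^bsub>G\<^esub> coset_rep j = (inv\<^bsub>G\<^esub> coset_rep i \<otimes>\<^bsub>G\<^esub> coset_rep j) \<otimes>\<^bsub>G\<^esub> b"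
    using bc central[of "coset_rep j"] by (simp add: G.m_assoc)
  note eq = this
  show "\<rho> b i j = unit_matrix R i j"
  proof (cases "coset_rep i = coset_rep j")
    case True
    have "i = j \<longleftrightarrow> vec_index i = vec_index j" using True index_coset_rep_vec_index by metis
    then show ?thesis
      unfolding \<rho>_def eq using True bc b by (simp add: unit_matrix_def)
  next
    case False
    have "(inv\<^bsub>G\<^esub> coset_rep i \<otimes>\<^bsub>G\<^esub> coset_rep j) \<otimes>\<^bsub>G\<^esub> b \<notin> B"
    proof
      assume "(inv\<^bsub>G\<^esub> coset_rep i \<otimes>\<^bsub>G\<^esub> coset_rep j) \<otimes>\<^bsub>G\<^esub> b \<in> B"
      then have "(inv\<^bsub>G\<^esub> coset_rep i \<otimes>\<^bsub>G\<^esub> coset_rep j) \<otimes>\<^bsub>G\<^esub> b \<otimes>\<^bsub>G\<^esub> inv\<^bsub>G\<^esub> b \<in> B"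
        using subgroup.m_closed[OF B] subgroup.m_inv_closed[OF B] b by blast
      then have "inv\<^bsub>G\<^esub> coset_rep i \<otimes>\<^bsub>G\<^esub> coset_rep j \<in> B" using bc by (simp add: G.m_assoc)
      moreover have "inv\<^bsub>G\<^esub> coset_rep j \<otimes>\<^bsub>G\<^esub> coset_rep j \<in> B" using subgroup.one_closed[OF B] by simp
      ultimately show False using unique_coset_rep[of "coset_rep j" "coset_rep i" "coset_rep j"] False by simp
    qed
    then show ?thesis unfolding \<rho>_def eq using False by (auto simp: unit_matrix_def)
  qed
qed

lemma rho_one: "\<rho> \<one>\<^bsub>G\<^esub> = unit_matrix R"
  by (rule rho_central) (auto simp: Y_one subgroup.one_closed[OF B])

end

context induced_representation begin

text \<open>The block of \<open>X\<close> at \<open>(p', q')\<close> is obtained from the one at \<open>(p, q)\<close> by the action of \<open>g\<close>, since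
  \<open>X\<close> is the product of \<open>\<rho> g\<close>, \<open>X\<close> and \<open>\<rho> (inv g)\<close>.\<close>

lemma commuting_block_translate:
  assumes X: "row_finite R X" and comm: "\<And>g. g \<in> carrier G \<Longrightarrow> mprod R (\<rho> g) X = mprod R X (\<rho> g)"
    and pq: "p \<in> T" "q \<in> T" and zero: "\<And>\<iota> \<kappa>. X (index p \<iota>) (index q \<kappa>) = \<zero>"
    and g: "g \<in> carrier G" and p': "p' \<in> T" "inv\<^bsub>G\<^esub> p' \<otimes>\<^bsub>G\<^esub> g \<otimes>\<^bsub>G\<^esub> p \<in> B"
    and q': "q' \<in> T" "inv\<^bsub>G\<^esub> q' \<otimes>\<^bsub>G\<^esub> g \<otimes>\<^bsub>G\<^esub> q \<in> B"
  shows "X (index p' \<iota>) (index q' \<kappa>) = \<zero>"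
proof -
  note x = row_finiteD[OF X]
  let ?g' = "inv\<^bsub>G\<^esub> g"
  have g': "?g' \<in> carrier G" using g by simp
  have c: "p \<in> carrier G" "q \<in> carrier G" "p' \<in> carrier G" "q' \<in> carrier G" using pq p' q' T by auto
  have "mprod R (\<rho> g) (mprod R X (\<rho> ?g')) = mprod R (mprod R (\<rho> g) X) (\<rho> ?g')"
    using mprod_assoc[of "\<rho> g" X "\<rho> ?g'"] row_finite_rho[OF g] X rho_closed[OF g'] by simp
  also have "\<dots> = mprod R X (mprod R (\<rho> g) (\<rho> ?g'))"
    unfolding comm[OF g] using mprod_assoc[of X "\<rho> g" "\<rho> ?g'"] row_finite_rho[OF g] X rho_closed[OF g'] by simp
  also have "mprod R (\<rho> g) (\<rho> ?g') = unit_matrix R" using rho_mult[OF g g'] g by (simp add: rho_one)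
  also have "mprod R X (unit_matrix R) = X" using X by (rule mprod_unit_right)
  finally have "X (index p' \<iota>) (index q' \<kappa>) = mprod R (\<rho> g) (mprod R X (\<rho> ?g')) (index p' \<iota>) (index q' \<kappa>)"
    by simp
  also have "\<dots> = \<zero>"
  proof (rule mprod_eq_zero)
    fix k assume "\<rho> g (index p' \<iota>) k \<noteq> \<zero>"
    then have "inv\<^bsub>G\<^esub> p' \<otimes>\<^bsub>G\<^esub> g \<otimes>\<^bsub>G\<^esub> coset_rep k \<in> B" using rho_nonzeroD(1) p' by fastforce
    then have k: "coset_rep k = p" using unique_coset_rep_right[OF g p'(1) _ pq(1) _ p'(2)] by simp
    show "mprod R X (\<rho> ?g') k (index q' \<kappa>) = \<zero>"
    proof (rule mprod_eq_zero)
      fix l assume l: "X k l \<noteq> \<zero>"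
      show "\<rho> ?g' l (index q' \<kappa>) = \<zero>"
      proof (rule ccontr)
        assume "\<rho> ?g' l (index q' \<kappa>) \<noteq> \<zero>"
        then have 1: "inv\<^bsub>G\<^esub> coset_rep l \<otimes>\<^bsub>G\<^esub> ?g' \<otimes>\<^bsub>G\<^esub> q' \<in> B" using rho_nonzeroD(1) q' by fastforce
        have "inv\<^bsub>G\<^esub> (inv\<^bsub>G\<^esub> q' \<otimes>\<^bsub>G\<^esub> g \<otimes>\<^bsub>G\<^esub> q) \<in> B" using q' subgroup.m_inv_closed[OF B] by blast
        then have "inv\<^bsub>G\<^esub> q \<otimes>\<^bsub>G\<^esub> ?g' \<otimes>\<^bsub>G\<^esub> q' \<in> B" using c g by (simp add: G.inv_mult_group G.m_assoc)
        then have "coset_rep l = q" using unique_coset_rep_left[OF g' q'(1) _ pq(2) 1] by simp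
        then have "X (index p (vec_index k)) (index q (vec_index l)) \<noteq> \<zero>" using k l by auto
        then show False using zero by simp
      qed
    qed (rule x)
  qed (rule rho_closed[OF g])
  finally show ?thesis .
qed

text \<open>Mackey's description of the endomorphisms of an induced module when there are two double cosets,
  \<open>B\<close> and \<open>B w B\<close>. By translation only the blocks at \<open>(1, w)\<close> and at \<open>(1, 1)\<close> matter. The first one is
  killed by elements \<open>t\<close> of \<open>B\<close> that act by different scalars on two given basis vectors, one of the
  module and one of its twist by \<open>w\<close>. The second one is an endomorphism of the module for \<open>B\<close>.\<close>

theorem commuting_finite_matrix_eq_zero:
  assumes X: "row_finite R X" and fin: "finite {i. \<exists>j. X i j \<noteq> \<zero>}"
    and comm: "\<And>g. g \<in> carrier G \<Longrightarrow> mprod R (\<rho> g) X = mprod R X (\<rho> g)"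
    and one: "\<one>\<^bsub>G\<^esub> \<in> T" and w: "w \<in> T"
    and bruhat: "\<And>g. g \<in> carrier G \<Longrightarrow> g \<notin> B \<Longrightarrow> \<exists>b\<in>B. \<exists>b'\<in>B. g = b \<otimes>\<^bsub>G\<^esub> w \<otimes>\<^bsub>G\<^esub> b'"
    and separate: "\<And>\<iota> \<kappa>. \<exists>t\<in>B. inv\<^bsub>G\<^esub> w \<otimes>\<^bsub>G\<^esub> t \<otimes>\<^bsub>G\<^esub> w \<in> B \<and>
        (\<forall>\<iota>'. \<iota>' \<noteq> \<iota> \<longrightarrow> Y t \<iota> \<iota>' = \<zero>) \<and> (\<forall>\<kappa>'. \<kappa>' \<noteq> \<kappa> \<longrightarrow> Y (inv\<^bsub>G\<^esub> w \<otimes>\<^bsub>G\<^esub> t \<otimes>\<^bsub>G\<^esub> w) \<kappa>' \<kappa> = \<zero>) \<and>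
        (\<forall>x\<in>carrier R. Y t \<iota> \<iota> \<otimes> x = x \<otimes> Y (inv\<^bsub>G\<^esub> w \<otimes>\<^bsub>G\<^esub> t \<otimes>\<^bsub>G\<^esub> w) \<kappa> \<kappa> \<longrightarrow> x = \<zero>)"
    and local: "\<And>Z. row_finite R Z \<Longrightarrow> finite {\<iota>. \<exists>\<kappa>. Z \<iota> \<kappa> \<noteq> \<zero>} \<Longrightarrow>
        (\<And>b. b \<in> B \<Longrightarrow> mprod R (Y b) Z = mprod R Z (Y b)) \<Longrightarrow> \<forall>\<iota> \<kappa>. Z \<iota> \<kappa> = \<zero>"
  shows "X i j = \<zero>"
proof -
  note x = row_finiteD[OF X]
  have wc: "w \<in> carrier G" using w T by auto
  have one_w: "X (index \<one>\<^bsub>G\<^esub> \<iota>) (index w \<kappa>) = \<zero>" for \<iota> \<kappa>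
  proof -
    obtain t where t: "t \<in> B" and t': "inv\<^bsub>G\<^esub> w \<otimes>\<^bsub>G\<^esub> t \<otimes>\<^bsub>G\<^esub> w \<in> B" and diag: "\<And>\<iota>'. \<iota>' \<noteq> \<iota> \<Longrightarrow> Y t \<iota> \<iota>' = \<zero>"
        "\<And>\<kappa>'. \<kappa>' \<noteq> \<kappa> \<Longrightarrow> Y (inv\<^bsub>G\<^esub> w \<otimes>\<^bsub>G\<^esub> t \<otimes>\<^bsub>G\<^esub> w) \<kappa>' \<kappa> = \<zero>"
      and sep: "\<And>x. x \<in> carrier R \<Longrightarrow> Y t \<iota> \<iota> \<otimes> x = x \<otimes> Y (inv\<^bsub>G\<^esub> w \<otimes>\<^bsub>G\<^esub> t \<otimes>\<^bsub>G\<^esub> w) \<kappa> \<kappa> \<Longrightarrow> x = \<zero>"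
      using separate[of \<iota> \<kappa>] by blast
    have tc: "t \<in> carrier G" using t B_closed by auto
    let ?i = "index \<one>\<^bsub>G\<^esub> \<iota>" and ?j = "index w \<kappa>"
    have row: "\<rho> t ?i k = (if k = ?i then Y t \<iota> \<iota> else \<zero>)" for k
    proof (cases "coset_rep k = \<one>\<^bsub>G\<^esub>")
      case True
      then have "k = index \<one>\<^bsub>G\<^esub> (vec_index k)" by (metis index_coset_rep_vec_index)
      then have "k = ?i \<longleftrightarrow> vec_index k = \<iota>" using index_eq_iff[OF one] by metis
      then show ?thesis using True diag(1)[of "vec_index k"] tc t one by (auto simp: \<rho>_def)
    next
      case False
      have "inv\<^bsub>G\<^esub> \<one>\<^bsub>G\<^esub> \<otimes>\<^bsub>G\<^esub> t \<otimes>\<^bsub>G\<^esub> \<one>\<^bsub>G\<^esub> \<in> B" using t tc by simp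
      then have "\<not> (inv\<^bsub>G\<^esub> \<one>\<^bsub>G\<^esub> \<otimes>\<^bsub>G\<^esub> t \<otimes>\<^bsub>G\<^esub> coset_rep k \<in> B)"
        using unique_coset_rep_right[OF tc one _ one] False by fastforce
      moreover have "k \<noteq> ?i" using False one by auto
      ultimately show ?thesis using one by (simp add: \<rho>_def)
    qed
    have col: "\<rho> t k ?j = (if k = ?j then Y (inv\<^bsub>G\<^esub> w \<otimes>\<^bsub>G\<^esub> t \<otimes>\<^bsub>G\<^esub> w) \<kappa> \<kappa> else \<zero>)" for k
    proof (cases "coset_rep k = w")
      case True
      then have "k = index w (vec_index k)" by (metis index_coset_rep_vec_index)
      then have "k = ?j \<longleftrightarrow> vec_index k = \<kappa>" using index_eq_iff[OF w] by metis
      then show ?thesis using True diag(2)[of "vec_index k"] t' w by (auto simp: \<rho>_def)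
    next
      case False
      have "\<not> (inv\<^bsub>G\<^esub> coset_rep k \<otimes>\<^bsub>G\<^esub> t \<otimes>\<^bsub>G\<^esub> w \<in> B)"
        using unique_coset_rep_left[OF tc w _ w] t' False by fastforce
      moreover have "k \<noteq> ?j" using False w by auto
      ultimately show ?thesis using w by (simp add: \<rho>_def)
    qed
    have "Y t \<iota> \<iota> \<otimes> X ?i ?j = mprod R (\<rho> t) X ?i ?j"
      using mprod_eq_single[of ?i "\<rho> t" ?i X ?j] row row_finiteD(1)[OF Y_row_finite[OF t]] x by simp
    also have "\<dots> = X ?i ?j \<otimes> Y (inv\<^bsub>G\<^esub> w \<otimes>\<^bsub>G\<^esub> t \<otimes>\<^bsub>G\<^esub> w) \<kappa> \<kappa>"
      unfolding comm[OF tc] using mprod_eq_single_right[OF X, of ?j "\<rho> t" ?j ?i] col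
        row_finiteD(1)[OF Y_row_finite[OF t']] by simp
    finally show ?thesis using sep x by blast
  qed
  have off_diagonal: "X (index p \<iota>) (index q \<kappa>) = \<zero>" if p: "p \<in> T" and q: "q \<in> T" and neq: "p \<noteq> q" for p q \<iota> \<kappa>
  proof -
    have c: "p \<in> carrier G" "q \<in> carrier G" using p q T by auto
    have "inv\<^bsub>G\<^esub> q \<otimes>\<^bsub>G\<^esub> q \<in> B" using c subgroup.one_closed[OF B] by simp
    then have "inv\<^bsub>G\<^esub> p \<otimes>\<^bsub>G\<^esub> q \<notin> B" using unique_coset_rep[OF c(2) p q] neq by blast
    then obtain b b' where b: "b \<in> B" "b' \<in> B" "inv\<^bsub>G\<^esub> p \<otimes>\<^bsub>G\<^esub> q = b \<otimes>\<^bsub>G\<^esub> w \<otimes>\<^bsub>G\<^esub> b'"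
      using bruhat[of "inv\<^bsub>G\<^esub> p \<otimes>\<^bsub>G\<^esub> q"] c by auto
    have bc: "b \<in> carrier G" "b' \<in> carrier G" using b B_closed by auto
    have "q = p \<otimes>\<^bsub>G\<^esub> (inv\<^bsub>G\<^esub> p \<otimes>\<^bsub>G\<^esub> q)" using c by (simp add: G.m_assoc[symmetric])
    then have q_eq: "q = p \<otimes>\<^bsub>G\<^esub> b \<otimes>\<^bsub>G\<^esub> w \<otimes>\<^bsub>G\<^esub> b'" using b(3) c bc wc by (simp add: G.m_assoc)
    show ?thesis
    proof (rule commuting_block_translate[OF X comm one w one_w, of "p \<otimes>\<^bsub>G\<^esub> b"])
      show "p \<otimes>\<^bsub>G\<^esub> b \<in> carrier G" using c bc by simp
      show "inv\<^bsub>G\<^esub> p \<otimes>\<^bsub>G\<^esub> (p \<otimes>\<^bsub>G\<^esub> b) \<otimes>\<^bsub>G\<^esub> \<one>\<^bsub>G\<^esub> \<in> B" using c bc b by (simp add: G.m_assoc[symmetric])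
      have "inv\<^bsub>G\<^esub> q \<otimes>\<^bsub>G\<^esub> (p \<otimes>\<^bsub>G\<^esub> b) \<otimes>\<^bsub>G\<^esub> w = inv\<^bsub>G\<^esub> b'"
        unfolding q_eq using c bc wc by (simp add: G.inv_mult_group G.m_assoc G.inv_solve_left')
      then show "inv\<^bsub>G\<^esub> q \<otimes>\<^bsub>G\<^esub> (p \<otimes>\<^bsub>G\<^esub> b) \<otimes>\<^bsub>G\<^esub> w \<in> B" using b subgroup.m_inv_closed[OF B] by simp
    qed (use p q in auto)
  qed
  define Z where "Z = (\<lambda>\<iota> \<kappa>. X (index \<one>\<^bsub>G\<^esub> \<iota>) (index \<one>\<^bsub>G\<^esub> \<kappa>))"
  have one_one: "\<forall>\<iota> \<kappa>. Z \<iota> \<kappa> = \<zero>"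
  proof (rule local)
    have inj: "inj (index \<one>\<^bsub>G\<^esub>)" using one by (auto simp: inj_on_def)
    have "finite {\<kappa>. Z \<iota> \<kappa> \<noteq> \<zero>}" for \<iota>
      using finite_vimageI[OF x(2) inj, of "index \<one>\<^bsub>G\<^esub> \<iota>"] by (simp add: Z_def vimage_def)
    then show Zr: "row_finite R Z"
      unfolding row_finite_def using x by (auto simp: Z_def)
    have "{\<iota>. \<exists>\<kappa>. Z \<iota> \<kappa> \<noteq> \<zero>} \<subseteq> index \<one>\<^bsub>G\<^esub> -` {i. \<exists>j. X i j \<noteq> \<zero>}" by (auto simp: Z_def)
    then show "finite {\<iota>. \<exists>\<kappa>. Z \<iota> \<kappa> \<noteq> \<zero>}" using finite_vimageI[OF fin inj] finite_subset by blast
    fix b assume b: "b \<in> B"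
    then have bc: "b \<in> carrier G" using B_closed by auto
    have conj: "inv\<^bsub>G\<^esub> \<one>\<^bsub>G\<^esub> \<otimes>\<^bsub>G\<^esub> b \<otimes>\<^bsub>G\<^esub> \<one>\<^bsub>G\<^esub> = b" using bc by simp
    note y = row_finiteD[OF Y_row_finite[OF b]]
    have rho_b: "\<rho> b (index \<one>\<^bsub>G\<^esub> \<iota>) (index \<one>\<^bsub>G\<^esub> \<kappa>) = Y b \<iota> \<kappa>" for \<iota> \<kappa>
      using b bc one by (simp add: \<rho>_def)
    have ran: "k \<in> index \<one>\<^bsub>G\<^esub> ` S" if "coset_rep k = \<one>\<^bsub>G\<^esub>" "vec_index k \<in> S" for k S
      using that by (intro image_eqI[of _ _ "vec_index k"]) (metis index_coset_rep_vec_index, simp)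
    show "mprod R (Y b) Z = mprod R Z (Y b)"
    proof (intro ext)
      fix \<iota> \<kappa>
      let ?i = "index \<one>\<^bsub>G\<^esub> \<iota>" and ?j = "index \<one>\<^bsub>G\<^esub> \<kappa>"
      let ?S = "{\<kappa>'. Y b \<iota> \<kappa>' \<noteq> \<zero>}" and ?S' = "{\<kappa>'. Z \<iota> \<kappa>' \<noteq> \<zero>}"
      have "mprod R (Y b) Z \<iota> \<kappa> = (\<Oplus>\<kappa>'\<in>?S. \<rho> b ?i (index \<one>\<^bsub>G\<^esub> \<kappa>') \<otimes> X (index \<one>\<^bsub>G\<^esub> \<kappa>') ?j)"
        by (simp add: mprod_def rho_b Z_def)
      also have "\<dots> = (\<Oplus>k\<in>index \<one>\<^bsub>G\<^esub> ` ?S. \<rho> b ?i k \<otimes> X k ?j)"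
        by (rule finsum_index[symmetric]) (use one x rho_closed[OF bc] in auto)
      also have "\<dots> = mprod R (\<rho> b) X ?i ?j"
      proof (rule mprod_eq_finsum_right[OF row_finite_rho[OF bc], symmetric])
        fix k assume k: "k \<notin> index \<one>\<^bsub>G\<^esub> ` ?S" "\<rho> b ?i k \<noteq> \<zero>"
        have "inv\<^bsub>G\<^esub> \<one>\<^bsub>G\<^esub> \<otimes>\<^bsub>G\<^esub> b \<otimes>\<^bsub>G\<^esub> coset_rep k \<in> B" using rho_nonzeroD(1)[OF k(2)] one by simp
        then have r: "coset_rep k = \<one>\<^bsub>G\<^esub>"
          using unique_coset_rep_right[OF bc one _ one] conj b by fastforce
        then have "vec_index k \<in> ?S" using rho_nonzeroD(2)[OF k(2)] one bc by simp
        then show "X k ?j = \<zero>" using ran[OF r] k by blast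
      qed (use x y in auto)
      also have "\<dots> = mprod R X (\<rho> b) ?i ?j" by (simp add: comm[OF bc])
      also have "\<dots> = (\<Oplus>k\<in>index \<one>\<^bsub>G\<^esub> ` ?S'. X ?i k \<otimes> \<rho> b k ?j)"
      proof (rule mprod_eq_finsum_right[OF X])
        show "finite (index \<one>\<^bsub>G\<^esub> ` ?S')" using row_finiteD(2)[OF Zr] by blast
        fix k assume k: "k \<notin> index \<one>\<^bsub>G\<^esub> ` ?S'" "X ?i k \<noteq> \<zero>"
        have r: "coset_rep k = \<one>\<^bsub>G\<^esub>"
        proof (rule ccontr)
          assume "coset_rep k \<noteq> \<one>\<^bsub>G\<^esub>"
          then show False using off_diagonal[OF one coset_rep_in_T[of k], of \<iota> "vec_index k"] k(2) by simp
        qed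
        then have "index \<one>\<^bsub>G\<^esub> (vec_index k) = k" by (metis index_coset_rep_vec_index)
        then have "vec_index k \<in> ?S'" using k(2) by (simp add: Z_def)
        then show "\<rho> b k ?j = \<zero>" using ran[OF r] k by blast
      qed (rule rho_closed[OF bc])
      also have "\<dots> = (\<Oplus>\<kappa>'\<in>?S'. X ?i (index \<one>\<^bsub>G\<^esub> \<kappa>') \<otimes> \<rho> b (index \<one>\<^bsub>G\<^esub> \<kappa>') ?j)"
        by (rule finsum_index) (use one x rho_closed[OF bc] in auto)
      also have "\<dots> = mprod R Z (Y b) \<iota> \<kappa>"
        by (simp add: mprod_def rho_b Z_def)
      finally show "mprod R (Y b) Z \<iota> \<kappa> = mprod R Z (Y b) \<iota> \<kappa>" .
    qed
  qed
  have "X (index p \<iota>) (index q \<kappa>) = \<zero>" if p: "p \<in> T" and q: "q \<in> T" for p q \<iota> \<kappa>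
  proof (cases "p = q")
    case True
    have pc: "p \<in> carrier G" using p T by auto
    have "X (index p \<iota>) (index p \<kappa>) = \<zero>"
    proof (rule commuting_block_translate[OF X comm one one, of p])
      show "X (index \<one>\<^bsub>G\<^esub> \<iota>) (index \<one>\<^bsub>G\<^esub> \<kappa>) = \<zero>" for \<iota> \<kappa> using one_one by (simp add: Z_def)
      show "inv\<^bsub>G\<^esub> p \<otimes>\<^bsub>G\<^esub> p \<otimes>\<^bsub>G\<^esub> \<one>\<^bsub>G\<^esub> \<in> B" using pc subgroup.one_closed[OF B] by simp
      then show "inv\<^bsub>G\<^esub> p \<otimes>\<^bsub>G\<^esub> p \<otimes>\<^bsub>G\<^esub> \<one>\<^bsub>G\<^esub> \<in> B" .
    qed (use p pc in auto)
    then show ?thesis using True by simp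
  qed (use off_diagonal p q in auto)
  from this[of "coset_rep i" "coset_rep j" "vec_index i" "vec_index j"] show ?thesis by simp
qed

end

section \<open>An infinite-dimensional module for the Borel subgroup\<close>

datatype branch = B0 | B1 | B2 | B3

text \<open>\<open>Top\<close> spans the head and \<open>Leaf j\<close>, for each of the four branches \<open>j\<close>, one isotypic part of the socle
  of the module for the Borel subgroup.\<close>

datatype basis = Top nat | Leaf branch nat

fun level :: "branch \<Rightarrow> nat" where
  "level B0 = 0" | "level B1 = 1" | "level B2 = 2" | "level B3 = 3"

text \<open>The linear map from the head to branch \<open>j\<close> sends basis vector \<open>n\<close> to the basis vector \<open>r\<close> with
  \<open>covers j r n\<close>, or to zero if there is none. The kernels of the first two maps are spanned by the
  odd and by the even basis vectors. Those of the other two are spanned by differences of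
  neighbours, for the two ways to pair off the natural numbers in adjacent pairs (with \<open>0\<close> left
  alone in the second one). This is an infinite-dimensional configuration of four subspaces.\<close>

fun covers :: "branch \<Rightarrow> nat \<Rightarrow> nat \<Rightarrow> bool" where
  "covers B0 r n \<longleftrightarrow> n = 2 * r"
| "covers B1 r n \<longleftrightarrow> n = 2 * r + 1"
| "covers B2 r n \<longleftrightarrow> n div 2 = r"
| "covers B3 r n \<longleftrightarrow> (n + 1) div 2 = r"

text \<open>The torus element with diagonal \<open>t\<close>, \<open>1 / t\<close> acts on a basis vector by \<open>t\<close> to the power of its
  weight. It multiplies an upper unipotent entry by \<open>t ^ 2\<close>, which accounts for the difference
  \<open>2 * p ^ level j\<close> between branch and head. All weights are even, so that \<open>-1\<close> acts trivially, and
  positive and small, so that no two of them are opposite modulo the order of the torus.\<close>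

fun weight :: "nat \<Rightarrow> basis \<Rightarrow> nat" where
  "weight p (Top n) = 2"
| "weight p (Leaf j r) = 2 + 2 * p ^ level j"

lemma covers_bound: "covers j r n \<Longrightarrow> n < 2 * r + 2"
  by (cases j) auto

lemma covers_unique: "covers j r n \<Longrightarrow> covers j r' n \<Longrightarrow> r = r'"
  by (cases j) auto

lemma finite_covers: "finite {n. covers j r n}" "finite {r. covers j r n}"
proof -
  show "finite {n. covers j r n}" by (rule finite_subset[of _ "{..<2 * r + 2}"]) (auto dest: covers_bound)
  show "finite {r. covers j r n}"
  proof (cases "\<exists>r. covers j r n")
    case True
    then obtain r where "covers j r n" by blast
    then have "{r. covers j r n} \<subseteq> {r}" using covers_unique by blast
    then show ?thesis using finite_subset by blast
  qed simp
qed

text \<open>The bound on \<open>m\<close> is twice the largest weight of the module below. So powers of \<open>\<zeta>\<close> separate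
  different weights, and no sum of two weights is trivial on \<open>\<zeta>\<close>.\<close>

locale borel_field = finite_field +
  fixes p :: nat and \<zeta> :: 'a
  assumes p_ge_2: "2 \<le> p"
    and frobenius: "x \<in> carrier R \<Longrightarrow> y \<in> carrier R \<Longrightarrow> (x \<oplus> y) [^] (p ^ m) = x [^] (p ^ m) \<oplus> y [^] (p ^ m)"
    and zeta: "\<zeta> \<in> carrier R" "\<zeta> \<noteq> \<zero>"
    and zeta_power: "0 < m \<Longrightarrow> m \<le> 4 + 4 * p ^ 3 \<Longrightarrow> \<zeta> [^] m \<noteq> \<one>"
begin

definition borel :: "('a \<times> 'a \<times> 'a \<times> 'a) set" where
  "borel = {(a, b, c, d) \<in> carrier (SL2 R). c = \<zero>}"

text \<open>The map from head to branch \<open>j\<close> is multiplied by the function \<open>(t * y) ^ (p ^ level j)\<close>, which is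
  additive in \<open>y\<close>. The factor \<open>t ^ 2\<close> is the action of the torus on the head.\<close>

fun borel_mat :: "'a \<times> 'a \<times> 'a \<times> 'a \<Rightarrow> basis \<Rightarrow> basis \<Rightarrow> 'a" where
  "borel_mat (t, y, c, s) (Leaf j r) (Top n) = (if covers j r n then t [^] (2::nat) \<otimes> (t \<otimes> y) [^] (p ^ level j) else \<zero>)"
| "borel_mat (t, y, c, s) \<iota> \<kappa> = (if \<iota> = \<kappa> then t [^] weight p \<iota> else \<zero>)"

lemma borel_mat_diag [simp]: "borel_mat (t, y, c, s) \<iota> \<iota> = t [^] weight p \<iota>"
  by (cases \<iota>) auto

lemma borel_mat_Top [simp]: "borel_mat (t, y, c, s) (Top m) \<kappa> = (if \<kappa> = Top m then t [^] (2::nat) else \<zero>)"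
  by auto

lemma borel_mat_col_Leaf [simp]: "borel_mat (t, y, c, s) \<iota> (Leaf j r) = (if \<iota> = Leaf j r then t [^] weight p (Leaf j r) else \<zero>)"
  by (cases \<iota>) auto

lemma borelE:
  assumes "b \<in> borel"
  obtains t y s where "b = (t, y, \<zero>, s)" "t \<in> carrier R" "y \<in> carrier R" "s \<in> carrier R" "t \<otimes> s = \<one>"
  using assms by (auto simp: borel_def SL2_carrier_iff minus_eq)

lemma borelI:
  "t \<in> carrier R \<Longrightarrow> y \<in> carrier R \<Longrightarrow> s \<in> carrier R \<Longrightarrow> t \<otimes> s = \<one> \<Longrightarrow> (t, y, \<zero>, s) \<in> borel"
  by (auto simp: borel_def SL2_carrier_iff minus_eq)

lemma p_pos: "0 < p" using p_ge_2 by simp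

lemma zero_pow: "\<zero> [^] (p ^ m) = \<zero>"
  using p_pos by (simp add: nat_pow_zero)

lemma borel_mat_closed: "t \<in> carrier R \<Longrightarrow> y \<in> carrier R \<Longrightarrow> borel_mat (t, y, c, s) \<iota> \<kappa> \<in> carrier R"
  by (cases \<iota>; cases \<kappa>) auto

lemma borel_mat_row_support: "{\<kappa>. borel_mat (t, y, c, s) (Leaf j r) \<kappa> \<noteq> \<zero>} \<subseteq> insert (Leaf j r) (Top ` {n. covers j r n})"
proof
  fix \<kappa> assume "\<kappa> \<in> {\<kappa>. borel_mat (t, y, c, s) (Leaf j r) \<kappa> \<noteq> \<zero>}"
  then show "\<kappa> \<in> insert (Leaf j r) (Top ` {n. covers j r n})"
    by (cases \<kappa>) (auto split: if_splits)
qed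

lemma row_finite_borel_mat:
  assumes "b \<in> borel" shows "row_finite R (borel_mat b)"
proof -
  obtain t y s where b: "b = (t, y, \<zero>, s)" "t \<in> carrier R" "y \<in> carrier R"
    using assms by (elim borelE)
  have "finite {\<kappa>. borel_mat b \<iota> \<kappa> \<noteq> \<zero>}" for \<iota>
  proof (cases \<iota>)
    case (Leaf j r)
    then show ?thesis
      unfolding b(1) using finite_subset[OF borel_mat_row_support[of t y \<zero> s j r]] finite_covers(1) by simp
  qed (simp add: b)
  then show ?thesis using b borel_mat_closed by (simp add: row_finite_def)
qed

lemma col_finite_borel_mat:
  assumes "b \<in> borel" shows "col_finite R (borel_mat b)"
proof -
  obtain t y s where b: "b = (t, y, \<zero>, s)" "t \<in> carrier R" "y \<in> carrier R"
    using assms by (elim borelE)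
  have "finite {\<iota>. borel_mat b \<iota> \<kappa> \<noteq> \<zero>}" for \<kappa>
  proof (cases \<kappa>)
    case (Top n)
    have "{\<iota>. borel_mat b \<iota> \<kappa> \<noteq> \<zero>} \<subseteq> insert (Top n) (\<Union>j\<in>{B0, B1, B2, B3}. Leaf j ` {r. covers j r n})"
    proof
      fix \<iota> assume "\<iota> \<in> {\<iota>. borel_mat b \<iota> \<kappa> \<noteq> \<zero>}"
      then show "\<iota> \<in> insert (Top n) (\<Union>j\<in>{B0, B1, B2, B3}. Leaf j ` {r. covers j r n})"
        by (cases \<iota>; cases "case \<iota> of Leaf j r \<Rightarrow> j | _ \<Rightarrow> B0") (auto simp: b(1) Top split: if_splits)
    qed
    moreover have "finite (insert (Top n) (\<Union>j\<in>{B0, B1, B2, B3}. Leaf j ` {r. covers j r n}))"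
      by (intro finite.insertI finite_UN_I finite_imageI finite_covers) simp
    ultimately show ?thesis by (rule finite_subset)
  qed (simp add: b)
  then show ?thesis using b borel_mat_closed by (simp add: col_finite_def)
qed

lemma borel_mat_one: "borel_mat \<one>\<^bsub>SL2 R\<^esub> = unit_matrix R"
proof (intro ext)
  fix \<iota> \<kappa> show "borel_mat \<one>\<^bsub>SL2 R\<^esub> \<iota> \<kappa> = unit_matrix R \<iota> \<kappa>"
    by (cases \<iota>; cases \<kappa>) (auto simp: SL2_one unit_matrix_def zero_pow)
qed

lemma borel_mat_scalar:
  assumes "a \<in> carrier R" "a \<otimes> a = \<one>" shows "borel_mat (a, \<zero>, \<zero>, a) = unit_matrix R"
proof (intro ext)
  have even: "a [^] (2 * m :: nat) = \<one>" for m
    using assms nat_pow_pow[of a 2 m] by (simp add: numeral_2_eq_2)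
  have "weight p \<iota> = 2 * (weight p \<iota> div 2)" for \<iota> by (cases \<iota>) auto
  then have "a [^] weight p \<iota> = \<one>" for \<iota> using even by metis
  then show "borel_mat (a, \<zero>, \<zero>, a) \<iota> \<kappa> = unit_matrix R \<iota> \<kappa>" for \<iota> \<kappa>
    using assms even[of 1] by (cases \<iota>; cases \<kappa>) (auto simp: unit_matrix_def zero_pow simp del: weight.simps)
qed

text \<open>The only entries that need an argument are those from head to branch. There the claim is the
  additivity of the Frobenius power in the upper right entry of the product.\<close>

lemma borel_mat_mult:
  assumes "b \<in> borel" "b' \<in> borel" shows "borel_mat (b \<otimes>\<^bsub>SL2 R\<^esub> b') = mprod R (borel_mat b) (borel_mat b')"
proof -
  obtain t y s where b: "b = (t, y, \<zero>, s)" "t \<in> carrier R" "y \<in> carrier R" "s \<in> carrier R" "t \<otimes> s = \<one>"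
    using assms by (elim borelE)
  obtain t' y' s' where b': "b' = (t', y', \<zero>, s')" "t' \<in> carrier R" "y' \<in> carrier R" "s' \<in> carrier R" "t' \<otimes> s' = \<one>"
    using assms by (elim borelE)
  note cl = b(2-4) b'(2-4)
  have prod: "b \<otimes>\<^bsub>SL2 R\<^esub> b' = (t \<otimes> t', t \<otimes> y' \<oplus> y \<otimes> s', \<zero>, s \<otimes> s')"
    unfolding b(1) b'(1) SL2_mult using cl by simp
  note rb = row_finite_borel_mat[OF assms(1)]
  note yc = row_finiteD(1)[OF rb] row_finiteD(1)[OF row_finite_borel_mat[OF assms(2)]]
  show ?thesis
  proof (intro ext)
    fix \<iota> \<kappa>
    show "borel_mat (b \<otimes>\<^bsub>SL2 R\<^esub> b') \<iota> \<kappa> = mprod R (borel_mat b) (borel_mat b') \<iota> \<kappa>"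
    proof (cases \<iota>)
      case (Top m)
      have "mprod R (borel_mat b) (borel_mat b') \<iota> \<kappa> = borel_mat b \<iota> \<iota> \<otimes> borel_mat b' \<iota> \<kappa>"
        by (rule mprod_eq_single) (use yc in \<open>auto simp: Top b\<close>)
      then show ?thesis using cl unfolding prod unfolding b b' Top by (auto simp: nat_pow_distrib)
    next
      case (Leaf j r)
      show ?thesis
      proof (cases \<kappa>)
        case (Leaf j' r')
        have "mprod R (borel_mat b) (borel_mat b') \<iota> \<kappa> = borel_mat b \<iota> \<kappa> \<otimes> borel_mat b' \<kappa> \<kappa>"
          by (rule mprod_eq_single_right[OF rb]) (use yc b'(2) in \<open>auto simp: Leaf b'(1)\<close>)
        then show ?thesis using cl unfolding prod unfolding b b' Leaf by (simp add: nat_pow_distrib del: weight.simps)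
      next
        case (Top n)
        have "mprod R (borel_mat b) (borel_mat b') \<iota> \<kappa> = (\<Oplus>k\<in>{\<iota>, \<kappa>}. borel_mat b \<iota> k \<otimes> borel_mat b' k \<kappa>)"
        proof (rule mprod_eq_finsum_right[OF rb])
          fix k assume k: "k \<notin> {\<iota>, \<kappa>}" "borel_mat b \<iota> k \<noteq> \<zero>"
          then obtain m where "k = Top m" using borel_mat_row_support[of t y \<zero> s j r] by (auto simp: b(1) Leaf)
          then show "borel_mat b' k \<kappa> = \<zero>" using k by (simp add: b' Top)
        qed (use yc in auto)
        also have "\<dots> = borel_mat b \<iota> \<iota> \<otimes> borel_mat b' \<iota> \<kappa> \<oplus> borel_mat b \<iota> \<kappa> \<otimes> borel_mat b' \<kappa> \<kappa>"
          using yc by (simp add: Leaf Top)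
        finally have eq: "mprod R (borel_mat b) (borel_mat b') \<iota> \<kappa> = borel_mat b \<iota> \<iota> \<otimes> borel_mat b' \<iota> \<kappa> \<oplus> borel_mat b \<iota> \<kappa> \<otimes> borel_mat b' \<kappa> \<kappa>" .
        show ?thesis
        proof (cases "covers j r n")
          case True
          let ?q = "p ^ level j"
          have u: "(t \<otimes> t') \<otimes> (t \<otimes> y' \<oplus> y \<otimes> s') = (t [^] (2::nat)) \<otimes> (t' \<otimes> y') \<oplus> t \<otimes> y"
          proof -
            have "(t \<otimes> t') \<otimes> (t \<otimes> y' \<oplus> y \<otimes> s') = (t \<otimes> t) \<otimes> (t' \<otimes> y') \<oplus> (t \<otimes> y) \<otimes> (t' \<otimes> s')"
              using cl by algebra
            then show ?thesis using cl b'(5) by (simp add: numeral_2_eq_2)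
          qed
          have v: "((t \<otimes> t') \<otimes> (t \<otimes> y' \<oplus> y \<otimes> s')) [^] ?q
              = t [^] (2 * ?q) \<otimes> (t' \<otimes> y') [^] ?q \<oplus> (t \<otimes> y) [^] ?q"
            unfolding u using cl by (simp add: frobenius nat_pow_distrib nat_pow_pow)
          define A C D U where "A = t [^] (2::nat)" and "C = (t' \<otimes> y') [^] ?q" and "D = (t \<otimes> y) [^] ?q" and "U = t' [^] (2::nat)"
          define E where "E = t [^] (2 * ?q)"
          have d: "A \<in> carrier R" "C \<in> carrier R" "D \<in> carrier R" "U \<in> carrier R" "E \<in> carrier R"
            using cl by (auto simp: A_def C_def D_def U_def E_def)
          have AE: "t [^] (2 + 2 * ?q) = A \<otimes> E" using cl by (simp add: A_def E_def nat_pow_mult)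
          have W: "t [^] weight p (Leaf j r) = A \<otimes> E" using AE by (simp only: weight.simps)
          have "borel_mat (b \<otimes>\<^bsub>SL2 R\<^esub> b') \<iota> \<kappa> = (A \<otimes> U) \<otimes> (E \<otimes> C \<oplus> D)"
            unfolding prod unfolding Leaf Top using True v cl by (simp add: nat_pow_distrib A_def C_def D_def U_def E_def)
          also have "\<dots> = (A \<otimes> E) \<otimes> (U \<otimes> C) \<oplus> (A \<otimes> D) \<otimes> U" using d by algebra
          also have "\<dots> = mprod R (borel_mat b) (borel_mat b') \<iota> \<kappa>"
            unfolding eq unfolding b(1) b'(1) Leaf Top using True
            by (simp add: W del: weight.simps(2)) (simp add: A_def C_def D_def U_def)
          finally show ?thesis .
        next
          case False
          then show ?thesis unfolding eq prod unfolding b b' Leaf Top using cl by simp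
        qed
      qed
    qed
  qed
qed

end

text \<open>Moving along a diagonal leaves the finite support.\<close>

lemma constant_diagonals_finite_support:
  fixes \<alpha> :: "nat \<Rightarrow> nat \<Rightarrow> 'a"
  assumes step: "\<And>m n. even m = even n \<Longrightarrow> \<alpha> m n = \<alpha> (m + 1) (n + 1)"
    and fin: "finite {m. \<exists>n. \<alpha> m n \<noteq> z}" and mn: "even m = even n"
  shows "\<alpha> m n = z"
proof -
  have shift: "\<alpha> m n = \<alpha> (m + k) (n + k)" for k
  proof (induction k)
    case (Suc k)
    have "even (m + k) = even (n + k)" using mn by simp
    then show ?case using Suc step[of "m + k" "n + k"] by simp
  qed simp
  obtain N where N: "\<forall>m\<in>{m. \<exists>n. \<alpha> m n \<noteq> z}. m < N" using fin finite_nat_set_iff_bounded by metis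
  have "\<alpha> (m + N) (n + N) = z"
  proof (rule ccontr)
    assume "\<alpha> (m + N) (n + N) \<noteq> z"
    then have "m + N < N" using N by blast
    then show False by simp
  qed
  then show ?thesis using shift[of N] by simp
qed

lemma covers_sets:
  "{n. covers B0 r n} = {2 * r}" "{n. covers B1 r n} = {2 * r + 1}"
  "{n. covers B2 r n} = {2 * r, 2 * r + 1}" "{n. covers B3 (Suc r) n} = {2 * r + 1, 2 * r + 2}"
  by auto

context borel_field begin

lemma zeta_power_inject:
  assumes "a \<le> 2 + 2 * p ^ 3" "b \<le> 2 + 2 * p ^ 3" "\<zeta> [^] a = \<zeta> [^] b"
  shows "a = b"
proof -
  have *: "a = b" if "a \<le> b" "b \<le> 2 + 2 * p ^ 3" "\<zeta> [^] a = \<zeta> [^] b" for a b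
  proof (rule ccontr)
    assume "a \<noteq> b"
    then have d: "0 < b - a" "b - a \<le> 4 + 4 * p ^ 3" using that by auto
    have "\<zeta> [^] a \<otimes> \<zeta> [^] (b - a) = \<zeta> [^] a \<otimes> \<one>"
      using zeta that nat_pow_mult[OF zeta(1), of a "b - a"] by simp
    moreover have "\<zeta> [^] a \<noteq> \<zero>" using zeta by (induction a) (auto simp: integral_iff)
    ultimately have "\<zeta> [^] (b - a) = \<one>" using zeta m_lcancel[of "\<zeta> [^] a" "\<zeta> [^] (b - a)" \<one>] by auto
    then show False using zeta_power[OF d] by simp
  qed
  show ?thesis using *[of a b] *[of b a] assms by (cases "a \<le> b") auto
qed

lemma weight_le: "weight p \<iota> \<le> 2 + 2 * p ^ 3"
proof (cases \<iota>)
  case (Leaf j r)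
  have "level j \<le> 3" by (cases j) auto
  then show ?thesis using p_pos by (simp add: Leaf power_increasing)
qed simp

lemma weight_Leaf_ne_Top [simp]: "weight p (Leaf j r) \<noteq> weight p (Top n)"
  using p_pos by simp

lemma weight_Leaf_eq_iff: "weight p (Leaf j r) = weight p (Leaf j' r') \<longleftrightarrow> j = j'"
proof -
  have "p ^ level j = p ^ level j' \<longleftrightarrow> level j = level j'" using p_ge_2 by (simp add: power_inject_exp)
  then show ?thesis by (cases j; cases j') auto
qed

definition zeta_inv :: 'a where "zeta_inv = inv \<zeta>"

lemma zeta_inv: "zeta_inv \<in> carrier R" "\<zeta> \<otimes> zeta_inv = \<one>" "zeta_inv \<otimes> \<zeta> = \<one>"
  using zeta field_Units by (auto simp: zeta_inv_def)

definition torus :: "'a \<times> 'a \<times> 'a \<times> 'a" where "torus = (\<zeta>, \<zero>, \<zero>, zeta_inv)"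
definition unipotent :: "'a \<times> 'a \<times> 'a \<times> 'a" where "unipotent = (\<one>, \<one>, \<zero>, \<one>)"

lemma torus_in_borel: "torus \<in> borel"
  unfolding torus_def using zeta zeta_inv by (intro borelI) auto

lemma unipotent_in_borel: "unipotent \<in> borel"
  unfolding unipotent_def by (intro borelI) auto

lemma borel_mat_diagonal: "t \<in> carrier R \<Longrightarrow> borel_mat (t, \<zero>, c, s) \<iota> \<kappa> = (if \<iota> = \<kappa> then t [^] weight p \<iota> else \<zero>)"
  by (cases \<iota>; cases \<kappa>) (auto simp: zero_pow)

lemma borel_mat_torus: "borel_mat torus \<iota> \<kappa> = (if \<iota> = \<kappa> then \<zeta> [^] weight p \<iota> else \<zero>)"
  unfolding torus_def using zeta by (simp add: borel_mat_diagonal)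

lemma borel_mat_unipotent: "borel_mat unipotent (Leaf j r) \<kappa> = (if \<kappa> = Leaf j r then \<one>
    else case \<kappa> of Top n \<Rightarrow> if covers j r n then \<one> else \<zero> | Leaf _ _ \<Rightarrow> \<zero>)"
  unfolding unipotent_def by (cases \<kappa>) auto

text \<open>Endomorphisms preserve the weight spaces of the torus.\<close>

lemma commuting_weight_eq:
  assumes Z: "row_finite R Z" and comm: "mprod R (borel_mat torus) Z = mprod R Z (borel_mat torus)" and nz: "Z \<iota> \<kappa> \<noteq> \<zero>"
  shows "weight p \<iota> = weight p \<kappa>"
proof (rule zeta_power_inject[OF weight_le weight_le])
  note z = row_finiteD[OF Z]
  have "\<zeta> [^] weight p \<iota> \<otimes> Z \<iota> \<kappa> = mprod R (borel_mat torus) Z \<iota> \<kappa>"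
    using mprod_eq_single[of \<iota> "borel_mat torus" \<iota> Z \<kappa>] z zeta by (simp add: borel_mat_torus)
  also have "\<dots> = Z \<iota> \<kappa> \<otimes> \<zeta> [^] weight p \<kappa>"
    unfolding comm using mprod_eq_single_right[OF Z, of \<kappa> "borel_mat torus" \<kappa> \<iota>] zeta by (simp add: borel_mat_torus)
  finally have "Z \<iota> \<kappa> \<otimes> \<zeta> [^] weight p \<iota> = Z \<iota> \<kappa> \<otimes> \<zeta> [^] weight p \<kappa>" using z zeta by (simp add: m_comm)
  then show "\<zeta> [^] weight p \<iota> = \<zeta> [^] weight p \<kappa>" using nz z zeta m_lcancel by auto
qed

text \<open>By weights \<open>Z\<close> is given by \<open>\<alpha>\<close> on the head and \<open>\<beta> j\<close> on the branches, and commutation with one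
  unipotent element says that \<open>\<beta> j\<close> after the map to branch \<open>j\<close> is that map after \<open>\<alpha>\<close>. Thus \<open>\<alpha>\<close>
  preserves the four kernels. The first two make \<open>\<alpha>\<close> preserve parity, and the other two then
  identify adjacent entries on each diagonal. So \<open>\<alpha> = 0\<close>, and \<open>\<beta> j = 0\<close> as the maps are onto.\<close>

lemma finite_commuting_matrix_eq_zero:
  assumes Z: "row_finite R Z" and fin: "finite {\<iota>. \<exists>\<kappa>. Z \<iota> \<kappa> \<noteq> \<zero>}"
    and comm: "\<And>b. b \<in> borel \<Longrightarrow> mprod R (borel_mat b) Z = mprod R Z (borel_mat b)"
  shows "Z \<iota> \<kappa> = \<zero>"
proof -
  note z = row_finiteD[OF Z]
  define \<alpha> where "\<alpha> m n = Z (Top m) (Top n)" for m n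
  define \<beta> where "\<beta> j r r' = Z (Leaf j r) (Leaf j r')" for j r r'
  have \<alpha>c: "\<alpha> m n \<in> carrier R" and \<beta>c: "\<beta> j r r' \<in> carrier R" for m n j r r' using z by (auto simp: \<alpha>_def \<beta>_def)
  have weights: "Z \<iota> \<kappa> = \<zero>" if "weight p \<iota> \<noteq> weight p \<kappa>" for \<iota> \<kappa>
    using commuting_weight_eq[OF Z comm[OF torus_in_borel], of \<iota> \<kappa>] that by blast
  \<comment> \<open>The entries of the two products from head to branch.\<close>
  have left: "mprod R (borel_mat unipotent) Z (Leaf j r) (Top n) = (\<Oplus>m\<in>{m. covers j r m}. \<alpha> m n)" for j r n
  proof -
    let ?f = "\<lambda>k. borel_mat unipotent (Leaf j r) k \<otimes> Z k (Top n)"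
    have yc: "borel_mat unipotent (Leaf j r) k \<in> carrier R" for k
      using row_finiteD(1)[OF row_finite_borel_mat[OF unipotent_in_borel]] .
    have "mprod R (borel_mat unipotent) Z (Leaf j r) (Top n) = (\<Oplus>k\<in>Top ` {m. covers j r m}. ?f k)"
    proof (rule mprod_eq_finsum_right[OF row_finite_borel_mat[OF unipotent_in_borel]])
      show "finite (Top ` {m. covers j r m})" using finite_covers(1) by simp
      fix k assume k: "k \<notin> Top ` {m. covers j r m}" "borel_mat unipotent (Leaf j r) k \<noteq> \<zero>"
      then have "k = Leaf j r" by (cases k) (auto simp: borel_mat_unipotent split: if_splits)
      then show "Z k (Top n) = \<zero>" using weights weight_Leaf_ne_Top by metis
    qed (rule z)
    also have "\<dots> = (\<Oplus>m\<in>{m. covers j r m}. ?f (Top m))"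
      by (rule finsum_reindex) (use yc z in \<open>auto simp: inj_on_def\<close>)
    also have "\<dots> = (\<Oplus>m\<in>{m. covers j r m}. \<alpha> m n)"
      using z by (intro finsum_cong') (auto simp: borel_mat_unipotent \<alpha>_def)
    finally show ?thesis .
  qed
  have right: "mprod R Z (borel_mat unipotent) (Leaf j r) (Top n) = (if covers j r' n then \<beta> j r r' else \<zero>)"
    if r': "\<And>r''. covers j r'' n \<Longrightarrow> r'' = r'" for j r r' n
  proof -
    have "mprod R Z (borel_mat unipotent) (Leaf j r) (Top n) = (\<Oplus>k\<in>{Leaf j r'}. Z (Leaf j r) k \<otimes> borel_mat unipotent k (Top n))"
    proof (rule mprod_eq_finsum_right[OF Z])
      fix k assume k: "k \<notin> {Leaf j r'}" "Z (Leaf j r) k \<noteq> \<zero>"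
      then have w: "weight p (Leaf j r) = weight p k" using weights by blast
      show "borel_mat unipotent k (Top n) = \<zero>"
      proof (cases k)
        case (Leaf j' r'')
        then have "j' = j" using w weight_Leaf_eq_iff by metis
        then show ?thesis using Leaf k(1) r'[of r''] by (auto simp: borel_mat_unipotent)
      qed (use w weight_Leaf_ne_Top in metis)
    qed (use row_finiteD(1)[OF row_finite_borel_mat[OF unipotent_in_borel]] in auto)
    also have "\<dots> = (if covers j r' n then \<beta> j r r' else \<zero>)"
      using z by (auto simp: borel_mat_unipotent \<beta>_def)
    finally show ?thesis .
  qed
  have main: "(\<Oplus>m\<in>{m. covers j r m}. \<alpha> m n) = (if covers j r' n then \<beta> j r r' else \<zero>)"
    if "\<And>r''. covers j r'' n \<Longrightarrow> r'' = r'" for j r r' n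
    using left[of j r n] right[where j = j and n = n and r = r and r' = r', OF that] comm[OF unipotent_in_borel] by simp
  have sums: "(\<Oplus>m\<in>{2 * r}. \<alpha> m n) = \<alpha> (2 * r) n" "(\<Oplus>m\<in>{2 * r + 1}. \<alpha> m n) = \<alpha> (2 * r + 1) n"
    "(\<Oplus>m\<in>{2 * r, 2 * r + 1}. \<alpha> m n) = \<alpha> (2 * r) n \<oplus> \<alpha> (2 * r + 1) n"
    "(\<Oplus>m\<in>{2 * r + 1, 2 * r + 2}. \<alpha> m n) = \<alpha> (2 * r + 1) n \<oplus> \<alpha> (2 * r + 2) n" for r n
    using \<alpha>c by simp_all
  have zero_odd: "\<alpha> (2 * r) (2 * s + 1) = \<zero>" for r s
  proof -
    have "\<not> covers B0 r' (2 * s + 1)" for r' by (simp; presburger)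
    then show ?thesis using main[of B0 "2 * s + 1" 0 r] unfolding covers_sets sums by metis
  qed
  have odd_zero: "\<alpha> (2 * r + 1) (2 * s) = \<zero>" for r s
  proof -
    have "\<not> covers B1 r' (2 * s)" for r' by (simp; presburger)
    then show ?thesis using main[of B1 "2 * s" 0 r] unfolding covers_sets sums by metis
  qed
  have b2: "\<alpha> (2 * r) n \<oplus> \<alpha> (2 * r + 1) n = \<beta> B2 r (n div 2)" for r n
    using main[of B2 n "n div 2" r] unfolding covers_sets sums by simp
  have b3: "\<alpha> (2 * r + 1) n \<oplus> \<alpha> (2 * r + 2) n = \<beta> B3 (Suc r) ((n + 1) div 2)" for r n
    using main[of B3 n "(n + 1) div 2" "Suc r"] unfolding covers_sets sums by simp
  have parity: "\<alpha> m n = \<zero>" if "even m \<noteq> even n" for m n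
    using that zero_odd odd_zero by (cases "even m") (auto elim!: evenE oddE)
  have step: "\<alpha> m n = \<alpha> (m + 1) (n + 1)" if mn: "even m = even n" for m n
  proof (cases "even m")
    case True
    then obtain r s where rs: "m = 2 * r" "n = 2 * s" using mn by (auto elim!: evenE)
    have "\<alpha> (2 * r) (2 * s) \<oplus> \<alpha> (2 * r + 1) (2 * s) = \<alpha> (2 * r) (2 * s + 1) \<oplus> \<alpha> (2 * r + 1) (2 * s + 1)"
      unfolding b2 by simp
    then show ?thesis using rs \<alpha>c zero_odd odd_zero by simp
  next
    case False
    then obtain r s where rs: "m = 2 * r + 1" "n = 2 * s + 1" using mn by (auto elim!: oddE)
    have "\<alpha> (2 * r + 1) (2 * s + 1) \<oplus> \<alpha> (2 * r + 2) (2 * s + 1) = \<alpha> (2 * r + 1) (2 * s + 2) \<oplus> \<alpha> (2 * r + 2) (2 * s + 2)"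
      unfolding b3 by simp
    then show ?thesis using rs \<alpha>c parity[of "2 * r + 2" "2 * s + 1"] parity[of "2 * r + 1" "2 * s + 2"] by simp
  qed
  have "finite {m. \<exists>n. \<alpha> m n \<noteq> \<zero>}"
  proof -
    have "{m. \<exists>n. \<alpha> m n \<noteq> \<zero>} \<subseteq> Top -` {\<iota>. \<exists>\<kappa>. Z \<iota> \<kappa> \<noteq> \<zero>}" by (auto simp: \<alpha>_def)
    then show ?thesis using finite_vimageI[OF fin, of Top] finite_subset by (auto simp: inj_on_def)
  qed
  then have \<alpha>0: "\<alpha> m n = \<zero>" for m n
    using constant_diagonals_finite_support[of \<alpha> \<zero>, OF step] parity by (cases "even m = even n") auto
  have \<beta>0: "\<beta> j r r' = \<zero>" for j r r'
  proof -
    obtain n where n: "covers j r' n"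
    proof (cases j)
      case B3
      have "covers B3 r' (2 * r')" by simp
      then show thesis using that B3 by blast
    next
      case B2
      have "covers B2 r' (2 * r')" by simp
      then show thesis using that B2 by blast
    qed (use that in auto)
    have "(\<Oplus>m\<in>{m. covers j r m}. \<alpha> m n) = \<beta> j r r'"
      using main[of j n r' r] n covers_unique by auto
    then show ?thesis by (simp add: \<alpha>0)
  qed
  have "Z (Top m) (Top n) = \<zero>" for m n using \<alpha>0[of m n] by (simp add: \<alpha>_def)
  moreover have "Z (Leaf j r) (Top n) = \<zero>" "Z (Top n) (Leaf j r) = \<zero>" for j r n
    using weights weight_Leaf_ne_Top by metis+
  moreover have "Z (Leaf j r) (Leaf j' r') = \<zero>" for j j' r r'
    using weights[of "Leaf j r" "Leaf j' r'"] weight_Leaf_eq_iff[of j r j' r'] \<beta>0[of j r r']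
    by (auto simp: \<beta>_def simp del: weight.simps)
  ultimately show ?thesis by (cases \<iota>; cases \<kappa>) simp_all
qed

end

section \<open>Finite fields\<close>

text \<open>The pair \<open>(a, b)\<close> stands for \<open>a + b \<omega>\<close> with \<open>\<omega> ^ 2 = \<omega> + c\<close>. This form of a quadratic extension works
  in all characteristics, including two.\<close>

definition quad_ext :: "('a, 'b) ring_scheme \<Rightarrow> 'a \<Rightarrow> ('a \<times> 'a) ring" where
  "quad_ext F c = \<lparr>carrier = carrier F \<times> carrier F,
     monoid.mult = (\<lambda>(a, b) (a', b'). (a \<otimes>\<^bsub>F\<^esub> a' \<oplus>\<^bsub>F\<^esub> c \<otimes>\<^bsub>F\<^esub> (b \<otimes>\<^bsub>F\<^esub> b'),
       a \<otimes>\<^bsub>F\<^esub> b' \<oplus>\<^bsub>F\<^esub> b \<otimes>\<^bsub>F\<^esub> a' \<oplus>\<^bsub>F\<^esub> b \<otimes>\<^bsub>F\<^esub> b')),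
     one = (\<one>\<^bsub>F\<^esub>, \<zero>\<^bsub>F\<^esub>), zero = (\<zero>\<^bsub>F\<^esub>, \<zero>\<^bsub>F\<^esub>),
     add = (\<lambda>(a, b) (a', b'). (a \<oplus>\<^bsub>F\<^esub> a', b \<oplus>\<^bsub>F\<^esub> b'))\<rparr>"

lemma (in cring) cring_quad_ext:
  assumes c: "c \<in> carrier R" shows "cring (quad_ext R c)"
proof (rule cringI)
  show "abelian_group (quad_ext R c)"
  proof (rule abelian_groupI)
    fix x assume x: "x \<in> carrier (quad_ext R c)"
    then obtain a b where ab: "x = (a, b)" "a \<in> carrier R" "b \<in> carrier R" by (auto simp: quad_ext_def)
    show "\<exists>y\<in>carrier (quad_ext R c). y \<oplus>\<^bsub>quad_ext R c\<^esub> x = \<zero>\<^bsub>quad_ext R c\<^esub>"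
      by (rule bexI[of _ "(\<ominus> a, \<ominus> b)"]) (use ab in \<open>auto simp: quad_ext_def l_neg\<close>)
  qed (auto simp: quad_ext_def a_ac)
  show "comm_monoid (quad_ext R c)"
  proof (rule comm_monoidI)
    fix x y z assume "x \<in> carrier (quad_ext R c)" "y \<in> carrier (quad_ext R c)" "z \<in> carrier (quad_ext R c)"
    then obtain a b a' b' a'' b'' where xyz: "x = (a, b)" "y = (a', b')" "z = (a'', b'')"
      and cl: "a \<in> carrier R" "b \<in> carrier R" "a' \<in> carrier R" "b' \<in> carrier R" "a'' \<in> carrier R" "b'' \<in> carrier R"
      by (auto simp: quad_ext_def)
    have "(a \<otimes> a' \<oplus> c \<otimes> (b \<otimes> b')) \<otimes> a'' \<oplus> c \<otimes> ((a \<otimes> b' \<oplus> b \<otimes> a' \<oplus> b \<otimes> b') \<otimes> b'')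
        = a \<otimes> (a' \<otimes> a'' \<oplus> c \<otimes> (b' \<otimes> b'')) \<oplus> c \<otimes> (b \<otimes> (a' \<otimes> b'' \<oplus> b' \<otimes> a'' \<oplus> b' \<otimes> b''))"
      using cl c by algebra
    moreover have "(a \<otimes> a' \<oplus> c \<otimes> (b \<otimes> b')) \<otimes> b'' \<oplus> (a \<otimes> b' \<oplus> b \<otimes> a' \<oplus> b \<otimes> b') \<otimes> a'' \<oplus> (a \<otimes> b' \<oplus> b \<otimes> a' \<oplus> b \<otimes> b') \<otimes> b''
        = a \<otimes> (a' \<otimes> b'' \<oplus> b' \<otimes> a'' \<oplus> b' \<otimes> b'') \<oplus> b \<otimes> (a' \<otimes> a'' \<oplus> c \<otimes> (b' \<otimes> b'')) \<oplus> b \<otimes> (a' \<otimes> b'' \<oplus> b' \<otimes> a'' \<oplus> b' \<otimes> b'')"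
      using cl c by algebra
    ultimately show "x \<otimes>\<^bsub>quad_ext R c\<^esub> y \<otimes>\<^bsub>quad_ext R c\<^esub> z = x \<otimes>\<^bsub>quad_ext R c\<^esub> (y \<otimes>\<^bsub>quad_ext R c\<^esub> z)"
      by (simp add: xyz quad_ext_def)
  qed (use c in \<open>auto simp: quad_ext_def m_comm a_comm\<close>)
  show "(x \<oplus>\<^bsub>quad_ext R c\<^esub> y) \<otimes>\<^bsub>quad_ext R c\<^esub> z = x \<otimes>\<^bsub>quad_ext R c\<^esub> z \<oplus>\<^bsub>quad_ext R c\<^esub> y \<otimes>\<^bsub>quad_ext R c\<^esub> z"
    if "x \<in> carrier (quad_ext R c)" "y \<in> carrier (quad_ext R c)" "z \<in> carrier (quad_ext R c)" for x y z
    using that c by (auto simp: quad_ext_def l_distr r_distr a_ac)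
qed

text \<open>The conjugate of \<open>a + b \<omega>\<close> is \<open>a + b - b \<omega>\<close>, and the norm \<open>n\<close> below is not zero, for otherwise \<open>- a / b\<close>
  would be a root of \<open>x ^ 2 - x = c\<close>.\<close>

lemma (in field) field_quad_ext:
  assumes c: "c \<in> carrier R" and noroot: "\<And>x. x \<in> carrier R \<Longrightarrow> x \<otimes> x \<ominus> x \<noteq> c"
  shows "field (quad_ext R c)"
proof -
  interpret Q: cring "quad_ext R c" by (rule cring_quad_ext[OF c])
  show ?thesis
  proof (rule Q.cring_fieldI2)
    show "\<zero>\<^bsub>quad_ext R c\<^esub> \<noteq> \<one>\<^bsub>quad_ext R c\<^esub>" by (simp add: quad_ext_def)
    fix x assume x: "x \<in> carrier (quad_ext R c)" "x \<noteq> \<zero>\<^bsub>quad_ext R c\<^esub>"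
    then obtain a b where ab: "x = (a, b)" "a \<in> carrier R" "b \<in> carrier R" "\<not> (a = \<zero> \<and> b = \<zero>)"
      by (auto simp: quad_ext_def)
    define n where "n = a \<otimes> (a \<oplus> b) \<ominus> c \<otimes> (b \<otimes> b)"
    have nc: "n \<in> carrier R" using ab c by (simp add: n_def)
    have n0: "n \<noteq> \<zero>"
    proof
      assume n: "n = \<zero>"
      show False
      proof (cases "b = \<zero>")
        case True
        then have "a \<otimes> a = \<zero>" using n ab c by (simp add: n_def minus_eq)
        then show False using ab True integral by blast
      next
        case False
        define e where "e = inv b"
        have e: "e \<in> carrier R" "b \<otimes> e = \<one>" using ab False by (auto simp: e_def field_Units)
        define x where "x = \<ominus> (a \<otimes> e)"
        have xc: "x \<in> carrier R" using ab e by (simp add: x_def)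
        have "x \<otimes> x \<ominus> x = (e \<otimes> e) \<otimes> (a \<otimes> a) \<oplus> a \<otimes> e" unfolding x_def using ab(2) e(1) by algebra
        also have "a \<otimes> e = a \<otimes> e \<otimes> (b \<otimes> e)" using ab e by simp
        also have "(e \<otimes> e) \<otimes> (a \<otimes> a) \<oplus> a \<otimes> e \<otimes> (b \<otimes> e) = (e \<otimes> e) \<otimes> n \<oplus> c \<otimes> ((b \<otimes> e) \<otimes> (b \<otimes> e))"
          unfolding n_def using ab(2,3) e(1) c by algebra
        also have "\<dots> = c" using n e c by simp
        finally show False using noroot[OF xc] by simp
      qed
    qed
    define m where "m = inv n"
    have m: "m \<in> carrier R" "n \<otimes> m = \<one>" using n0 nc by (auto simp: m_def field_Units)
    show "\<exists>y\<in>carrier (quad_ext R c). x \<otimes>\<^bsub>quad_ext R c\<^esub> y = \<one>\<^bsub>quad_ext R c\<^esub>"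
    proof (rule bexI[of _ "((a \<oplus> b) \<otimes> m, \<ominus> b \<otimes> m)"])
      have "a \<otimes> ((a \<oplus> b) \<otimes> m) \<oplus> c \<otimes> (b \<otimes> (\<ominus> b \<otimes> m)) = n \<otimes> m"
        unfolding n_def using ab(2,3) c m(1) by algebra
      moreover have "a \<otimes> (\<ominus> b \<otimes> m) \<oplus> b \<otimes> ((a \<oplus> b) \<otimes> m) \<oplus> b \<otimes> (\<ominus> b \<otimes> m) = \<zero>"
        using ab(2,3) m(1) by algebra
      ultimately show "x \<otimes>\<^bsub>quad_ext R c\<^esub> ((a \<oplus> b) \<otimes> m, \<ominus> b \<otimes> m) = \<one>\<^bsub>quad_ext R c\<^esub>"
        by (simp add: quad_ext_def ab(1) m)
    qed (use ab m in \<open>auto simp: quad_ext_def\<close>)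
  qed
qed

text \<open>The map \<open>x \<mapsto> x ^ 2 - x\<close> takes the value \<open>0\<close> at both \<open>0\<close> and \<open>1\<close>, so on a finite field it is not onto.\<close>

lemma (in field) exists_not_artin_schreier:
  assumes fin: "finite (carrier R)"
  shows "\<exists>c\<in>carrier R. \<forall>x\<in>carrier R. x \<otimes> x \<ominus> x \<noteq> c"
proof (rule ccontr)
  let ?f = "\<lambda>x. x \<otimes> x \<ominus> x"
  assume "\<not> ?thesis"
  then have "\<exists>x\<in>carrier R. c = ?f x" if "c \<in> carrier R" for c using that by metis
  then have "carrier R \<subseteq> ?f ` carrier R" by blast
  moreover have "?f ` carrier R \<subseteq> carrier R" by auto
  ultimately have "inj_on ?f (carrier R)" using fin by (metis eq_card_imp_inj_on subset_antisym)
  moreover have "?f \<zero> = ?f \<one>" by (simp add: minus_eq r_neg)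
  ultimately show False using inj_onD[of ?f "carrier R" \<zero> \<one>] by simp
qed

lemma finite_field_on_nat:
  assumes "field F" "finite (carrier F)"
  shows "\<exists>F' :: nat ring. field F' \<and> finite (carrier F') \<and> card (carrier F') = card (carrier F)"
proof -
  obtain f :: "'a \<Rightarrow> nat" where f: "inj_on f (carrier F)"
    using assms(2) finite_imp_inj_to_nat_seg by metis
  have "field (image_ring f F)" using field.inj_imp_image_ring_is_field[OF assms(1) f] .
  then show ?thesis using f assms(2) by (intro exI[of _ "image_ring f F"]) (auto simp: image_ring_carrier card_image)
qed

lemma finite_field_power_two:
  assumes p: "Factorial_Ring.prime (p :: nat)"
  shows "\<exists>F :: nat ring. field F \<and> finite (carrier F) \<and> card (carrier F) = p ^ 2 ^ m"
proof (induction m)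
  case 0
  interpret residues_prime p "residue_ring (int p)"
    by unfold_locales (use p in auto)
  have "card (carrier (residue_ring (int p))) = p" by (simp add: res_carrier_eq)
  then show ?case using finite_field_on_nat[OF is_field] by (simp add: res_carrier_eq)
next
  case (Suc m)
  then obtain F :: "nat ring" where F: "field F" "finite (carrier F)" "card (carrier F) = p ^ 2 ^ m" by blast
  interpret F: field F by fact
  obtain c where c: "c \<in> carrier F" "\<And>x. x \<in> carrier F \<Longrightarrow> x \<otimes>\<^bsub>F\<^esub> x \<ominus>\<^bsub>F\<^esub> x \<noteq> c"
    using F.exists_not_artin_schreier[OF F(2)] by blast
  have "field (quad_ext F c)" using F.field_quad_ext[OF c] .
  moreover have "carrier (quad_ext F c) = carrier F \<times> carrier F" by (simp add: quad_ext_def)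
  moreover have "card (carrier F \<times> carrier F) = p ^ 2 ^ Suc m"
    by (simp add: card_cartesian_product F(3) power_add[symmetric] mult_2)
  ultimately show ?case using finite_field_on_nat[of "quad_ext F c"] F(2) by auto
qed

lemma freshmans_dream_mod:
  fixes x y :: "'a :: comm_ring_1"
  assumes p: "Factorial_Ring.prime (p :: nat)"
  shows "\<exists>h. (x + y) ^ p = x ^ p + y ^ p + of_nat p * h"
proof -
  have p0: "p > 0" using p prime_gt_0_nat by blast
  let ?t = "\<lambda>k. of_nat (p choose k) * x ^ k * y ^ (p - k)"
  have "of_nat p dvd (\<Sum>k\<in>{0<..<p}. ?t k)"
  proof (rule dvd_sum)
    fix k assume k: "k \<in> {0<..<p}"
    then have "p dvd (p choose k)" using dvd_choose_prime[of k p] p by auto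
    then have "(of_nat p :: 'a) dvd of_nat (p choose k)" by (auto elim!: dvdE)
    then show "of_nat p dvd ?t k" by (simp add: dvd_mult2 mult.assoc)
  qed
  then obtain h where h: "(\<Sum>k\<in>{0<..<p}. ?t k) = of_nat p * h" by (auto elim!: dvdE)
  have "(x + y) ^ p = (\<Sum>k\<le>p. ?t k)" by (rule binomial_ring)
  also have "{..p} = insert 0 (insert p {0<..<p})" using p0 by auto
  also have "sum ?t \<dots> = y ^ p + (x ^ p + of_nat p * h)" using p0 h by simp
  finally show ?thesis by (intro exI[of _ h]) (simp add: algebra_simps)
qed

text \<open>Since \<open>p ^ k\<close> annihilates \<open>1\<close> in the additive group and a field has no zero divisors, \<open>p\<close> is zero in the
  field. The binomial formula is applied to lifts in the integer polynomials.\<close>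

lemma (in finite_field) finite_field_frobenius:
  assumes p: "Factorial_Ring.prime p" and card: "card (carrier R) = p ^ k" and x: "x \<in> carrier R" and y: "y \<in> carrier R"
  shows "(x \<oplus> y) [^] (p ^ m) = x [^] (p ^ m) \<oplus> y [^] (p ^ m)"
proof -
  obtain z L where z: "z \<in> carrier R" and L: "\<And>x. x \<in> carrier R \<Longrightarrow> int_poly_eval z (L x) = x"
    using finite_field_int_poly_eval_surj finite_carrier by metis
  have power: "int_poly_eval z (f ^ n) = int_poly_eval z f [^] n" for f n
    by (induction n) (use z in \<open>auto simp: int_poly_eval_mult m_comm\<close>)
  have nat: "int_poly_eval z (of_nat n) = [n] \<cdot> \<one>" for n
    by (induction n) (use z in \<open>auto simp: int_poly_eval_add a_comm\<close>)
  have "[(p ^ k)] \<cdot> \<one> = \<zero>"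
    using add.pow_order_eq_1[of \<one>] card by (simp add: Coset.order_def)
  then have "int_poly_eval z (of_nat p) [^] k = \<zero>" using nat[of "p ^ k"] power by simp
  then have p0: "int_poly_eval z (of_nat p) = \<zero>"
    using int_poly_eval_closed[OF z] by (induction k) (auto simp: integral_iff)
  have step: "(x \<oplus> y) [^] p = x [^] p \<oplus> y [^] p" if "x \<in> carrier R" "y \<in> carrier R" for x y
  proof -
    obtain h where "(L x + L y) ^ p = L x ^ p + L y ^ p + of_nat p * h"
      using freshmans_dream_mod[OF p] by blast
    then have "int_poly_eval z ((L x + L y) ^ p) = int_poly_eval z (L x ^ p + L y ^ p + of_nat p * h)" by simp
    then show ?thesis using that z by (simp add: power int_poly_eval_add int_poly_eval_mult L p0)
  qed
  show ?thesis
  proof (induction m)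
    case (Suc m)
    have "(x \<oplus> y) [^] (p ^ Suc m) = ((x \<oplus> y) [^] (p ^ m)) [^] p"
      using x y by (simp add: nat_pow_pow mult.commute)
    also have "\<dots> = (x [^] (p ^ m)) [^] p \<oplus> (y [^] (p ^ m)) [^] p" unfolding Suc using x y by (simp add: step)
    finally show ?case using x y by (simp add: nat_pow_pow mult.commute)
  qed (use x y in auto)
qed

lemma (in finite_field) exists_element_of_large_order:
  obtains z where "z \<in> carrier R" "z \<noteq> \<zero>" "\<And>m::nat. 0 < m \<Longrightarrow> m < card (carrier R) - 1 \<Longrightarrow> z [^] m \<noteq> \<one>"
proof -
  obtain z where z: "z \<in> carrier (mult_of R)" "carrier (mult_of R) = {z [^] i | i::nat. i \<in> UNIV}"
    using finite_field_mult_group_has_gen[OF finite_carrier] by blast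
  have zc: "z \<in> carrier R" "z \<noteq> \<zero>" using z(1) by (auto simp: carrier_mult_of)
  have "z [^] m \<noteq> \<one>" if m: "0 < m" "m < card (carrier R) - 1" for m :: nat
  proof
    assume 1: "z [^] m = \<one>"
    have "carrier (mult_of R) \<subseteq> (\<lambda>i. z [^] i) ` {..<m}"
    proof
      fix x assume "x \<in> carrier (mult_of R)"
      then obtain i :: nat where i: "x = z [^] i" using z(2) by blast
      have "z [^] i = z [^] (m * (i div m) + i mod m)" by simp
      also have "\<dots> = (z [^] m) [^] (i div m) \<otimes> z [^] (i mod m)"
        using zc by (simp only: nat_pow_mult[symmetric] nat_pow_pow)
      also have "\<dots> = z [^] (i mod m)" using 1 zc by simp
      finally show "x \<in> (\<lambda>i. z [^] i) ` {..<m}" using i m(1) by auto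
    qed
    then have "card (carrier (mult_of R)) \<le> m"
      by (metis card_image_le card_lessThan card_mono finite_imageI finite_lessThan le_trans)
    moreover have "card (carrier (mult_of R)) = card (carrier R) - 1"
      using finite_carrier by (simp add: carrier_mult_of card_Diff_singleton)
    ultimately show False using m by simp
  qed
  then show thesis using zc that by blast
qed

section \<open>The induced representation of the special linear group\<close>

instance branch :: countable by countable_datatype
instance basis :: countable by countable_datatype

context borel_field begin

text \<open>A coset of the Borel subgroup is determined by the first column of its elements up to scalars,
  that is, by a point of the projective line. The identity is the point at infinity.\<close>

definition coset_reps :: "('a \<times> 'a \<times> 'a \<times> 'a) set" where
  "coset_reps = insert \<one>\<^bsub>SL2 R\<^esub> ((\<lambda>z. (z, \<ominus> \<one>, \<one>, \<zero>)) ` carrier R)"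

definition weyl :: "'a \<times> 'a \<times> 'a \<times> 'a" where "weyl = (\<zero>, \<ominus> \<one>, \<one>, \<zero>)"

lemma coset_reps_subset: "coset_reps \<subseteq> carrier (SL2 R)"
proof -
  have "(z, \<ominus> \<one>, \<one>, \<zero>) \<in> carrier (SL2 R)" if "z \<in> carrier R" for z
    using that by (simp add: SL2_carrier_iff) algebra
  then show ?thesis using monoid.one_closed[OF group.is_monoid[OF group_SL2]] by (auto simp: coset_reps_def)
qed

lemma weyl_in_coset_reps: "weyl \<in> coset_reps"
  by (auto simp: weyl_def coset_reps_def)

lemma borel_iff_lower_entry:
  assumes "r \<in> carrier (SL2 R)" "r = (x, x', y, y')" "(a, b, c, d) \<in> carrier (SL2 R)"
  shows "inv\<^bsub>SL2 R\<^esub> r \<otimes>\<^bsub>SL2 R\<^esub> (a, b, c, d) \<in> borel \<longleftrightarrow> x \<otimes> c = y \<otimes> a"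
proof -
  interpret G: group "SL2 R" by (rule group_SL2)
  have cl: "x \<in> carrier R" "x' \<in> carrier R" "y \<in> carrier R" "y' \<in> carrier R"
    "a \<in> carrier R" "b \<in> carrier R" "c \<in> carrier R" "d \<in> carrier R"
    using assms by (auto simp: SL2_carrier_iff)
  have "inv\<^bsub>SL2 R\<^esub> r \<otimes>\<^bsub>SL2 R\<^esub> (a, b, c, d) \<in> carrier (SL2 R)" using assms by simp
  moreover have "inv\<^bsub>SL2 R\<^esub> r = (y', \<ominus> x', \<ominus> y, x)" using assms SL2_inv by simp
  ultimately have "inv\<^bsub>SL2 R\<^esub> r \<otimes>\<^bsub>SL2 R\<^esub> (a, b, c, d) \<in> borel \<longleftrightarrow> \<ominus> y \<otimes> a \<oplus> x \<otimes> c = \<zero>"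
    by (simp add: borel_def SL2_mult)
  also have "\<ominus> y \<otimes> a \<oplus> x \<otimes> c = x \<otimes> c \<ominus> y \<otimes> a" using cl by algebra
  also have "x \<otimes> c \<ominus> y \<otimes> a = \<zero> \<longleftrightarrow> x \<otimes> c = y \<otimes> a" using cl by (simp add: r_right_minus_eq)
  finally show ?thesis .
qed

lemma coset_reps_transversal:
  assumes g: "g \<in> carrier (SL2 R)"
  shows "\<exists>!r. r \<in> coset_reps \<and> inv\<^bsub>SL2 R\<^esub> r \<otimes>\<^bsub>SL2 R\<^esub> g \<in> borel"
proof -
  obtain a b c d where g_eq: "g = (a, b, c, d)" by (cases g)
  have cl: "a \<in> carrier R" "b \<in> carrier R" "c \<in> carrier R" "d \<in> carrier R" and det: "a \<otimes> d \<ominus> b \<otimes> c = \<one>"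
    using g by (auto simp: g_eq SL2_carrier_iff)
  have one: "inv\<^bsub>SL2 R\<^esub> \<one>\<^bsub>SL2 R\<^esub> \<otimes>\<^bsub>SL2 R\<^esub> g \<in> borel \<longleftrightarrow> c = \<zero>"
    using borel_iff_lower_entry[of "\<one>\<^bsub>SL2 R\<^esub>" \<one> \<zero> \<zero> \<one> a b c d] g cl coset_reps_subset
    by (auto simp: g_eq SL2_one coset_reps_def)
  have z: "inv\<^bsub>SL2 R\<^esub> (z, \<ominus> \<one>, \<one>, \<zero>) \<otimes>\<^bsub>SL2 R\<^esub> g \<in> borel \<longleftrightarrow> z \<otimes> c = a" if "z \<in> carrier R" for z
    using borel_iff_lower_entry[of "(z, \<ominus> \<one>, \<one>, \<zero>)" z "\<ominus> \<one>" \<one> \<zero> a b c d] g cl that coset_reps_subset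
    by (auto simp: g_eq coset_reps_def)
  show ?thesis
  proof (cases "c = \<zero>")
    case True
    have "a \<noteq> \<zero>" using det True cl by (auto simp: minus_eq)
    then have "\<not> inv\<^bsub>SL2 R\<^esub> (z, \<ominus> \<one>, \<one>, \<zero>) \<otimes>\<^bsub>SL2 R\<^esub> g \<in> borel" if "z \<in> carrier R" for z
      using z[OF that] that True by simp
    then show ?thesis using one True by (intro ex1I[of _ "\<one>\<^bsub>SL2 R\<^esub>"]) (auto simp: coset_reps_def)
  next
    case False
    define e where "e = inv c"
    have e: "e \<in> carrier R" "c \<otimes> e = \<one>" "e \<otimes> c = \<one>" using cl False by (auto simp: e_def field_Units)
    have ae: "a \<otimes> e \<in> carrier R" "a \<otimes> e \<otimes> c = a" using e cl by (auto simp: m_assoc)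
    have unique: "z' = a \<otimes> e" if "z' \<in> carrier R" "z' \<otimes> c = a" for z'
    proof -
      have "a \<otimes> e = z' \<otimes> (c \<otimes> e)" using that e(1) cl by (simp add: m_assoc[symmetric])
      then show ?thesis using that e by simp
    qed
    show ?thesis
    proof (rule ex1I[of _ "(a \<otimes> e, \<ominus> \<one>, \<one>, \<zero>)"])
      show "(a \<otimes> e, \<ominus> \<one>, \<one>, \<zero>) \<in> coset_reps \<and> inv\<^bsub>SL2 R\<^esub> (a \<otimes> e, \<ominus> \<one>, \<one>, \<zero>) \<otimes>\<^bsub>SL2 R\<^esub> g \<in> borel"
        using z[OF ae(1)] ae by (simp add: coset_reps_def)
      fix r assume r: "r \<in> coset_reps \<and> inv\<^bsub>SL2 R\<^esub> r \<otimes>\<^bsub>SL2 R\<^esub> g \<in> borel"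
      then have "r \<noteq> \<one>\<^bsub>SL2 R\<^esub>" using one False by blast
      then obtain z' where z': "z' \<in> carrier R" "r = (z', \<ominus> \<one>, \<one>, \<zero>)" using r by (auto simp: coset_reps_def)
      then show "r = (a \<otimes> e, \<ominus> \<one>, \<one>, \<zero>)" using r z[OF z'(1)] unique by simp
    qed
  qed
qed

lemma borel_closed: "b \<in> borel \<Longrightarrow> b \<in> carrier (SL2 R)"
  by (cases b) (simp add: borel_def)

lemma subgroup_borel: "subgroup borel (SL2 R)"
proof -
  interpret G: group "SL2 R" by (rule group_SL2)
  show ?thesis
  proof (rule G.subgroupI)
    show "borel \<subseteq> carrier (SL2 R)" using borel_closed by blast
    show "borel \<noteq> {}" using torus_in_borel by auto
    show "inv\<^bsub>SL2 R\<^esub> b \<in> borel" if b: "b \<in> borel" for b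
    proof -
      obtain t y s where tys: "b = (t, y, \<zero>, s)" "t \<in> carrier R" "y \<in> carrier R" "s \<in> carrier R" "t \<otimes> s = \<one>"
        using b by (elim borelE)
      have "b \<in> carrier (SL2 R)" using b by (rule borel_closed)
      then have "inv\<^bsub>SL2 R\<^esub> b = (s, \<ominus> y, \<zero>, t)" using SL2_inv[of t y \<zero> s] tys by simp
      then show ?thesis using tys by (auto intro!: borelI simp: m_comm)
    qed
    show "b \<otimes>\<^bsub>SL2 R\<^esub> b' \<in> borel" if b: "b \<in> borel" "b' \<in> borel" for b b'
    proof -
      have closed: "b \<otimes>\<^bsub>SL2 R\<^esub> b' \<in> carrier (SL2 R)" using b borel_closed by simp
      obtain t y s where 1: "b = (t, y, \<zero>, s)" "t \<in> carrier R" "s \<in> carrier R" using b(1) by (elim borelE)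
      obtain t' y' s' where 2: "b' = (t', y', \<zero>, s')" "t' \<in> carrier R" "s' \<in> carrier R" using b(2) by (elim borelE)
      have "\<zero> \<otimes> t' \<oplus> s \<otimes> \<zero> = \<zero>" using 1 2 by simp
      then show ?thesis using closed unfolding 1(1) 2(1) borel_def SL2_mult by simp
    qed
  qed
qed

text \<open>If \<open>g\<close> is not in the Borel subgroup, then its coset representative is an upper unipotent element
  times the Weyl element.\<close>

lemma bruhat:
  assumes g: "g \<in> carrier (SL2 R)" "g \<notin> borel"
  shows "\<exists>b\<in>borel. \<exists>b'\<in>borel. g = b \<otimes>\<^bsub>SL2 R\<^esub> weyl \<otimes>\<^bsub>SL2 R\<^esub> b'"
proof -
  interpret G: group "SL2 R" by (rule group_SL2)
  obtain r where r: "r \<in> coset_reps" "inv\<^bsub>SL2 R\<^esub> r \<otimes>\<^bsub>SL2 R\<^esub> g \<in> borel"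
    using coset_reps_transversal[OF g(1)] by blast
  have "r \<noteq> \<one>\<^bsub>SL2 R\<^esub>" using r(2) g by auto
  then obtain z where z: "z \<in> carrier R" "r = (z, \<ominus> \<one>, \<one>, \<zero>)" using r(1) by (auto simp: coset_reps_def)
  have rc: "r \<in> carrier (SL2 R)" using r(1) coset_reps_subset by blast
  have "(\<one>, z, \<zero>, \<one>) \<otimes>\<^bsub>SL2 R\<^esub> weyl = r"
    using z by (simp add: weyl_def SL2_mult)
  moreover have "(\<one>, z, \<zero>, \<one>) \<in> borel" using z by (intro borelI) auto
  moreover have "g = r \<otimes>\<^bsub>SL2 R\<^esub> (inv\<^bsub>SL2 R\<^esub> r \<otimes>\<^bsub>SL2 R\<^esub> g)" using rc g by (simp add: G.m_assoc[symmetric])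
  ultimately show ?thesis using r(2) by metis
qed

definition basis_enum :: "nat \<Rightarrow> ('a \<times> 'a \<times> 'a \<times> 'a) \<times> basis" where
  "basis_enum = from_nat_into (coset_reps \<times> UNIV)"

lemma infinite_basis: "infinite (UNIV :: basis set)"
proof
  assume "finite (UNIV :: basis set)"
  then have "finite (range Top)" using finite_subset[OF subset_UNIV] by blast
  moreover have "inj Top" by (auto simp: inj_on_def)
  ultimately have "finite (UNIV :: nat set)" by (rule finite_imageD)
  then show False by simp
qed

lemma bij_basis_enum: "bij_betw basis_enum UNIV (coset_reps \<times> UNIV)"
  unfolding basis_enum_def
proof (rule bij_betw_from_nat_into)
  have "finite coset_reps" using finite_subset[OF coset_reps_subset finite_SL2[OF finite_carrier]] .
  then show "countable (coset_reps \<times> (UNIV :: basis set))" by (intro countable_SIGMA) (auto intro: countable_finite)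
  show "infinite (coset_reps \<times> (UNIV :: basis set))"
    using infinite_basis weyl_in_coset_reps by (auto simp: finite_cartesian_product_iff)
qed

sublocale induced: induced_representation R "SL2 R" borel coset_reps borel_mat basis_enum
proof (rule induced_representation.intro)
  show "induced_representation_axioms R (SL2 R) borel coset_reps borel_mat basis_enum"
  proof (rule induced_representation_axioms.intro)
  qed (fact subgroup_borel coset_reps_subset coset_reps_transversal row_finite_borel_mat col_finite_borel_mat
      borel_mat_one borel_mat_mult bij_basis_enum)+
qed (fact ring_axioms group_SL2)+

sublocale action: SL_inf_action R "SL2 R" induced.\<rho>
proof (rule SL_inf_action.intro)
  show "SL_inf_action_axioms R (SL2 R) induced.\<rho>"
  proof (rule SL_inf_action_axioms.intro)
  qed (fact induced.row_finite_rho induced.col_finite_rho induced.rho_one induced.rho_mult)+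
qed (fact finite_field_axioms group_SL2)+

lemma rho_scalar:
  assumes "a \<in> carrier R" "a \<otimes> a = \<one>"
  shows "induced.\<rho> (a, \<zero>, \<zero>, a) = unit_matrix R"
proof (rule induced.rho_central)
  show "(a, \<zero>, \<zero>, a) \<in> borel" using assms by (intro borelI) auto
  show "borel_mat (a, \<zero>, \<zero>, a) = unit_matrix R" using assms by (rule borel_mat_scalar)
  show "(a, \<zero>, \<zero>, a) \<otimes>\<^bsub>SL2 R\<^esub> g = g \<otimes>\<^bsub>SL2 R\<^esub> (a, \<zero>, \<zero>, a)" if "g \<in> carrier (SL2 R)" for g
    using that assms by (cases g) (auto simp: SL2_mult SL2_carrier_iff m_comm)
qed

lemma torus_conj_weyl: "inv\<^bsub>SL2 R\<^esub> weyl \<otimes>\<^bsub>SL2 R\<^esub> torus \<otimes>\<^bsub>SL2 R\<^esub> weyl = (zeta_inv, \<zero>, \<zero>, \<zeta>)"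
proof -
  have "weyl \<in> carrier (SL2 R)" using weyl_in_coset_reps coset_reps_subset by blast
  then have "inv\<^bsub>SL2 R\<^esub> weyl = (\<zero>, \<ominus> (\<ominus> \<one>), \<ominus> \<one>, \<zero>)" unfolding weyl_def by (rule SL2_inv)
  then show ?thesis using zeta zeta_inv by (simp add: weyl_def torus_def SL2_mult l_minus r_minus)
qed

lemma rho_commuting_finite_eq_zero:
  assumes X: "row_finite R X" "finite {i. \<exists>j. X i j \<noteq> \<zero>}"
    and comm: "\<And>g. g \<in> carrier (SL2 R) \<Longrightarrow> mprod R (induced.\<rho> g) X = mprod R X (induced.\<rho> g)"
  shows "X i j = \<zero>"
proof (rule induced.commuting_finite_matrix_eq_zero[OF X comm, where w = weyl])
  show "\<one>\<^bsub>SL2 R\<^esub> \<in> coset_reps" by (simp add: coset_reps_def)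
  show "\<exists>t\<in>borel. inv\<^bsub>SL2 R\<^esub> weyl \<otimes>\<^bsub>SL2 R\<^esub> t \<otimes>\<^bsub>SL2 R\<^esub> weyl \<in> borel \<and>
        (\<forall>\<iota>'. \<iota>' \<noteq> \<iota> \<longrightarrow> borel_mat t \<iota> \<iota>' = \<zero>) \<and> (\<forall>\<kappa>'. \<kappa>' \<noteq> \<kappa> \<longrightarrow> borel_mat (inv\<^bsub>SL2 R\<^esub> weyl \<otimes>\<^bsub>SL2 R\<^esub> t \<otimes>\<^bsub>SL2 R\<^esub> weyl) \<kappa>' \<kappa> = \<zero>) \<and>
        (\<forall>x\<in>carrier R. borel_mat t \<iota> \<iota> \<otimes> x = x \<otimes> borel_mat (inv\<^bsub>SL2 R\<^esub> weyl \<otimes>\<^bsub>SL2 R\<^esub> t \<otimes>\<^bsub>SL2 R\<^esub> weyl) \<kappa> \<kappa> \<longrightarrow> x = \<zero>)" for \<iota> \<kappa>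
  proof (rule bexI[of _ torus, OF _ torus_in_borel], unfold torus_conj_weyl, intro conjI allI impI ballI)
    show "(zeta_inv, \<zero>, \<zero>, \<zeta>) \<in> borel" using zeta zeta_inv by (intro borelI) auto
    show "borel_mat torus \<iota> \<iota>' = \<zero>" if "\<iota>' \<noteq> \<iota>" for \<iota>' using that by (simp add: borel_mat_torus)
    show "borel_mat (zeta_inv, \<zero>, \<zero>, \<zeta>) \<kappa>' \<kappa> = \<zero>" if "\<kappa>' \<noteq> \<kappa>" for \<kappa>' using that zeta_inv by (simp add: borel_mat_diagonal)
    fix x assume x: "x \<in> carrier R" and eq: "borel_mat torus \<iota> \<iota> \<otimes> x = x \<otimes> borel_mat (zeta_inv, \<zero>, \<zero>, \<zeta>) \<kappa> \<kappa>"
    let ?a = "weight p \<iota>" and ?b = "weight p \<kappa>"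
    have inv: "zeta_inv [^] ?b \<otimes> \<zeta> [^] ?b = \<one>"
      using zeta zeta_inv by (simp add: nat_pow_distrib[symmetric])
    have eq': "\<zeta> [^] ?a \<otimes> x = x \<otimes> zeta_inv [^] ?b" using eq by (simp add: borel_mat_torus)
    have "\<zeta> [^] (?a + ?b) \<otimes> x = (\<zeta> [^] ?a \<otimes> x) \<otimes> \<zeta> [^] ?b"
      using zeta x by (simp add: nat_pow_mult[symmetric] m_ac)
    also have "\<dots> = x" unfolding eq' using zeta zeta_inv x inv by (simp add: m_assoc)
    finally have fixed: "\<zeta> [^] (?a + ?b) \<otimes> x = \<one> \<otimes> x" using x by simp
    have "0 < ?a + ?b" by (cases \<iota>) auto
    moreover have "?a + ?b \<le> 4 + 4 * p ^ 3" using weight_le[of \<iota>] weight_le[of \<kappa>] by simp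
    ultimately have "\<zeta> [^] (?a + ?b) \<noteq> \<one>" by (rule zeta_power)
    then show "x = \<zero>" using fixed x zeta m_rcancel[of x "\<zeta> [^] (?a + ?b)" \<one>] by auto
  qed
next
  show "\<forall>\<iota> \<kappa>. Z \<iota> \<kappa> = \<zero>"
    if "row_finite R Z" "finite {\<iota>. \<exists>\<kappa>. Z \<iota> \<kappa> \<noteq> \<zero>}"
      "\<And>b. b \<in> borel \<Longrightarrow> mprod R (borel_mat b) Z = mprod R Z (borel_mat b)" for Z
    using finite_commuting_matrix_eq_zero[OF that] by blast
qed (simp_all add: weyl_in_coset_reps bruhat)

text \<open>The group is the image of \<open>SL2 R\<close> under the induced representation, acting by conjugation. Scalar
  matrices act trivially, and a fixed element \<open>1 + X\<close> has \<open>X\<close> commuting with the representation.\<close>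

theorem exists_simple_group_trivial_centraliser:
  "\<exists>H. subgroup H (AutoGroup (SL_inf R)) \<and> finite H \<and>
       simple_group ((AutoGroup (SL_inf R))\<lparr>carrier := H\<rparr>) \<and>
       centraliser_aut (SL_inf R) H = {\<one>\<^bsub>SL_inf R\<^esub>}"
proof (rule action.exists_simple_group_of_automorphisms)
  show "finite (carrier (SL2 R))" using finite_carrier by (rule finite_SL2)
  have "(4::nat) \<le> 4 + 4 * p ^ 3" by simp
  then have z4: "\<zeta> [^] (4::nat) \<noteq> \<one>" using zeta_power[of 4] by simp
  show "N = carrier (SL2 R) \<or> (\<forall>g\<in>N. induced.\<rho> g = unit_matrix R)" if "N \<lhd> SL2 R" for N
    using SL2_normal_dichotomy[OF that zeta z4]
  proof
    assume scalar: "\<forall>g\<in>N. \<exists>a. g = (a, \<zero>, \<zero>, a) \<and> a \<in> carrier R \<and> a \<otimes> a = \<one>"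
    have "induced.\<rho> g = unit_matrix R" if g: "g \<in> N" for g
    proof -
      obtain a where "g = (a, \<zero>, \<zero>, a)" "a \<in> carrier R" "a \<otimes> a = \<one>" using bspec[OF scalar g] by blast
      then show ?thesis using rho_scalar by simp
    qed
    then show ?thesis by simp
  qed simp
  fix A assume A: "A \<in> carrier (SL_inf R)"
    and comm: "\<And>g. g \<in> carrier (SL2 R) \<Longrightarrow> mprod R (induced.\<rho> g) A = mprod R A (induced.\<rho> g)"
  obtain n where n: "A \<in> SL n R" using A by (auto simp: carrier_SL_inf)
  have uc: "unit_matrix R i j \<in> carrier R" for i j :: nat by (simp add: unit_matrix_def)
  obtain X where AX: "A = madd R (unit_matrix R) X" and Xc: "\<And>i j. X i j \<in> carrier R"
    and X0: "\<And>i j. n \<le> i \<or> n \<le> j \<Longrightarrow> X i j = \<zero>" and Xr: "row_finite R X"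
    using SL_eq_one_plus_finite[OF n] by blast
  have "{i. \<exists>j. X i j \<noteq> \<zero>} \<subseteq> {..<n}" using X0 not_le by blast
  then have fin: "finite {i. \<exists>j. X i j \<noteq> \<zero>}" using finite_subset by blast
  have commX: "mprod R (induced.\<rho> g) X = mprod R X (induced.\<rho> g)" if g: "g \<in> carrier (SL2 R)" for g
  proof (intro ext)
    fix i j
    note rg = induced.row_finite_rho[OF g]
    note rc = row_finiteD(1)[OF rg]
    have "madd R (induced.\<rho> g) (mprod R (induced.\<rho> g) X) = mprod R (induced.\<rho> g) A"
      unfolding AX using mprod_madd_right[of "induced.\<rho> g" "unit_matrix R" X] rg uc Xc mprod_unit_right[OF rg] by simp
    also have "\<dots> = madd R (induced.\<rho> g) (mprod R X (induced.\<rho> g))"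
      unfolding comm[OF g] unfolding AX
      using mprod_madd_left[of "unit_matrix R" X "induced.\<rho> g"] row_finite_unit_matrix Xr rc mprod_unit_left[of "induced.\<rho> g"] by simp
    finally have "madd R (induced.\<rho> g) (mprod R (induced.\<rho> g) X) i j = madd R (induced.\<rho> g) (mprod R X (induced.\<rho> g)) i j" by simp
    moreover have "mprod R (induced.\<rho> g) X i j \<in> carrier R" "mprod R X (induced.\<rho> g) i j \<in> carrier R"
      using rc Xc by (auto intro!: mprod_closed)
    ultimately show "mprod R (induced.\<rho> g) X i j = mprod R X (induced.\<rho> g) i j"
      using rc[of i j] by (simp add: madd_def)
  qed
  have "X i j = \<zero>" for i j by (rule rho_commuting_finite_eq_zero[OF Xr fin commX])
  then show "A = unit_matrix R" unfolding AX madd_def using uc by (intro ext) simp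
qed

end

theorem theorem1p3:
  fixes p :: nat
  assumes "Factorial_Ring.prime p"
  shows "\<exists>q k. 0 < k \<and> q = p ^ k \<and>
    (\<exists>F :: nat ring. field F \<and> finite (carrier F) \<and> card (carrier F) = q \<and>
      (\<exists>H. subgroup H (AutoGroup (SL_inf F)) \<and> finite H \<and>
           simple_group ((AutoGroup (SL_inf F))\<lparr>carrier := H\<rparr>) \<and>
           centraliser_aut (SL_inf F) H = {\<one>\<^bsub>SL_inf F\<^esub>}))"
proof -
  obtain F :: "nat ring" where F: "field F" "finite (carrier F)" "card (carrier F) = p ^ 2 ^ 3"
    using finite_field_power_two[OF assms] by blast
  have card: "card (carrier F) = p ^ 8" using F(3) by simp
  interpret F: finite_field F using F by (simp add: finite_field_def finite_field_axioms_def)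
  have p2: "2 \<le> p" using assms prime_ge_2_nat by blast
  obtain z where z: "z \<in> carrier F" "z \<noteq> \<zero>\<^bsub>F\<^esub>"
    "\<And>m::nat. 0 < m \<Longrightarrow> m < card (carrier F) - 1 \<Longrightarrow> z [^]\<^bsub>F\<^esub> m \<noteq> \<one>\<^bsub>F\<^esub>"
    using F.exists_element_of_large_order by blast
  \<comment> \<open>For \<open>p = 2\<close> this says \<open>36 < 255\<close>.\<close>
  have large: "4 + 4 * p ^ 3 < card (carrier F) - 1"
  proof -
    have "2 ^ 5 * p ^ 3 \<le> p ^ 5 * p ^ 3" using p2 by (intro mult_right_mono power_mono) auto
    also have "\<dots> = p ^ 8" by (simp add: power_add[symmetric])
    finally have "32 * p ^ 3 \<le> p ^ 8" by simp
    moreover have "2 ^ 3 \<le> p ^ 3" using p2 by (rule power_mono) simp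
    ultimately show ?thesis unfolding card by simp
  qed
  interpret F: borel_field F p z
  proof unfold_locales
    show "2 \<le> p" by (rule p2)
    show "(x \<oplus>\<^bsub>F\<^esub> y) [^]\<^bsub>F\<^esub> (p ^ m) = x [^]\<^bsub>F\<^esub> (p ^ m) \<oplus>\<^bsub>F\<^esub> y [^]\<^bsub>F\<^esub> (p ^ m)"
      if "x \<in> carrier F" "y \<in> carrier F" for x y and m :: nat
      using F.finite_field_frobenius[OF assms card that] .
    show "z [^]\<^bsub>F\<^esub> m \<noteq> \<one>\<^bsub>F\<^esub>" if "0 < m" "m \<le> 4 + 4 * p ^ 3" for m :: nat
      using z(3)[of m] that large by linarith
  qed (use z in auto)
  obtain H where H: "subgroup H (AutoGroup (SL_inf F))" "finite H"
    "simple_group ((AutoGroup (SL_inf F))\<lparr>carrier := H\<rparr>)"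
    "centraliser_aut (SL_inf F) H = {\<one>\<^bsub>SL_inf F\<^esub>}"
    using F.exists_simple_group_trivial_centraliser by blast
  show ?thesis
    by (intro exI[of _ "p ^ 8"] exI[of _ 8] exI[of _ F] exI[of _ H] conjI) (simp_all add: F(1,2) card H)
qed

end
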